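(* Let $q=p$ be prime, $m\ge0$, $n\ge1$. Every element of $\mathcal B_m(n)$ is a polynomial in $\mathbb{F}_p[x_1,\dots,x_n]$, and the images of the elements of $\mathcal B_m(n)$ in $Q(m,n)$ are pairwise distinct and form an $\mathbb{F}_p$-basis of the invariant ring $Q(m,n)^{U_n}$.
   Context: $p$ is a prime, $S=\mathbb{F}_p[x_1,\dots,x_n]$, $Q(m,n)=S/(x_1^{p^m},\dots,x_n^{p^m})$. $GL_n(\mathbb{F}_p)$ acts on $S$ by $\sigma(f)(x_1,\dots,x_n)=f(\sigma(x_1),\dots,\sigma(x_n))$ with $\sigma(x_j)=\sum_i\sigma_{ij}x_i$; this induces an action on $Q(m,n)$. $U_n$ is the subgroup of upper triangular matrices with all diagonal entries $1$, and $Q(m,n)^{U_n}$ the fixed subring. Delta operators: for integers $b\ge0$, $c\ge0$, $1\le a\le c+1$, $\delta_{a;b}:\mathbb{F}_p(x_1,\dots,x_c)\to\mathbb{F}_p(x_1,\dots,x_{c+1})$ sends $f$ to $N/L(x_1,\dots,x_a)$, where $N$ is the $a\times a$ determinant whose $t$-th row is $(x_1^{p^{t-1}},\dots,x_a^{p^{t-1}})$ for $t=1,\dots,a-1$ and whose last row is $(x_1^{p^b}f(\hat x_1),\dots,x_a^{p^b}f(\hat x_a))$, with $f(\hat x_i)=f(x_1,\dots,x_{i-1},x_{i+1},\dots,x_{c+1})$, and $L(x_1,\dots,x_a)=\det(x_j^{p^{t-1}})_{1\le t,j\le a}$; $\delta_{a;b}^h$ denotes $h$-fold composition (the number of variables increasing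 by one each time). Mui invariants: $V_1=x_1$ and $V_i=\prod_{w\in\mathrm{span}_{\mathbb{F}_p}\{x_1,\dots,x_{i-1}\}}(x_i+w)$. For sequences $I=(i_1,\dots,i_k)$, $J=(j_1,\dots,j_k)$ of nonnegative integers, $Y_b(I;J)=\delta_{1;b}^{i_1}\Big(V_1^{j_1}\,\delta_{2;b}^{i_2}\big(V_2^{j_2}\cdots\delta_{k;b}^{i_k}(V_k^{j_k})\cdots\big)\Big)$, where $V_t^{j_t}$ is viewed as a function of $x_1,\dots,x_t$ (so $Y_b(I;J)$ is a rational function in $k+i_1+\dots+i_k$ variables). $\mathcal B_m(n)$ is the set of all $Y_m(I;J)$ with $1\le k\le\min(n,m+1)$, $i_1+\dots+i_k=n-k$, and $0\le j_1<p^m-1$, $0\le j_2<p^{m-1}-1$, …, $0\le j_{k-1}<p^{m-k+2}-1$, $0\le j_k\le p^{m-k+1}-1$. *)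

theory Defs
  imports "HOL-Library.Poly_Mapping" "HOL-Computational_Algebra.Fraction_Field"
          "Jordan_Normal_Form.Determinant"
begin

text \<open>Polynomials in the variables x_0, x_1, x_2, ... (only x_1, x_2, ... are used)
  with coefficients in 'a: finitely supported maps from monomials (exponent vectors)
  to coefficients.  Rational functions: the fraction field of this integral domain.\<close>

type_synonym 'a mpoly = "(nat \<Rightarrow>\<^sub>0 nat) \<Rightarrow>\<^sub>0 'a"
type_synonym 'a ratfun = "'a mpoly fract"

definition mconst :: "'a::zero \<Rightarrow> 'a mpoly" where
  "mconst c = Poly_Mapping.single 0 c"

definition mvar :: "nat \<Rightarrow> 'a::{zero,one} mpoly" where
  "mvar i = Poly_Mapping.single (Poly_Mapping.single i 1) 1"

definition mvars :: "'a::zero mpoly \<Rightarrow> nat set" where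
  "mvars P = (\<Union>mo\<in>Poly_Mapping.keys P. Poly_Mapping.keys mo)"

definition meval :: "('a::zero \<Rightarrow> 'b::comm_semiring_1) \<Rightarrow> (nat \<Rightarrow> 'b) \<Rightarrow> 'a mpoly \<Rightarrow> 'b" where
  "meval h s P = (\<Sum>mo\<in>Poly_Mapping.keys P.
       h (Poly_Mapping.lookup P mo) * (\<Prod>v\<in>Poly_Mapping.keys mo. s v ^ Poly_Mapping.lookup mo v))"

definition rvar :: "nat \<Rightarrow> 'a::idom ratfun" where
  "rvar i = Fract (mvar i) 1"

definition rconst :: "'a::idom \<Rightarrow> 'a ratfun" where
  "rconst c = Fract (mconst c) 1"

text \<open>Substitution of rational functions for the variables of a rational function
  (used only for variable renamings, where it is well defined).\<close>
definition ratfun_subst :: "(nat \<Rightarrow> 'a::idom ratfun) \<Rightarrow> 'a ratfun \<Rightarrow> 'a ratfun" where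
  "ratfun_subst s q = (SOME r. \<exists>a b. b \<noteq> 0 \<and> q = Fract a b \<and>
       r = meval rconst s a / meval rconst s b)"

definition skip_var :: "nat \<Rightarrow> nat \<Rightarrow> nat" where
  "skip_var i j = (if j < i then j else Suc j)"

definition omit :: "'a::idom ratfun \<Rightarrow> nat \<Rightarrow> 'a ratfun" where
  "omit f i = ratfun_subst (\<lambda>j. rvar (skip_var i j)) f"

text \<open>Matrix rows t = 0..a-1 (row t+1 of the paper), columns j = 0..a-1 (variable x_{j+1}).\<close>
definition L_mat :: "nat \<Rightarrow> ('a::{field,finite}) ratfun mat" where
  "L_mat a = mat a a (\<lambda>(t,j). rvar (Suc j) ^ (card (UNIV :: 'a set) ^ t))"

definition N_mat :: "nat \<Rightarrow> nat \<Rightarrow> ('a::{field,finite}) ratfun \<Rightarrow> 'a ratfun mat" where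
  "N_mat a b f = mat a a (\<lambda>(t,j).
      if t < a - 1 then rvar (Suc j) ^ (card (UNIV :: 'a set) ^ t)
      else rvar (Suc j) ^ (card (UNIV :: 'a set) ^ b) * omit f (Suc j))"

definition delta :: "nat \<Rightarrow> nat \<Rightarrow> ('a::{field,finite}) ratfun \<Rightarrow> 'a ratfun" where
  "delta a b f = det (N_mat a b f) / det (L_mat a)"

definition muiV :: "nat \<Rightarrow> ('a::{field,finite}) mpoly" where
  "muiV i = (\<Prod>w\<in>{\<Sum>j\<in>{1..<i}. mconst (c j) * mvar j | c. True}. mvar i + w)"

fun Yaux :: "nat \<Rightarrow> nat \<Rightarrow> (nat \<times> nat) list \<Rightarrow> ('a::{field,finite}) ratfun" where
  "Yaux b t [] = 1"
| "Yaux b t ((i,j) # rest) =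
     (delta t b ^^ i) (Fract (muiV t ^ j) 1 * Yaux b (Suc t) rest)"

definition Y :: "nat \<Rightarrow> nat list \<Rightarrow> nat list \<Rightarrow> ('a::{field,finite}) ratfun" where
  "Y b I J = Yaux b 1 (zip I J)"

text \<open>The set B_m(n); list positions are 0-based, so J!t is j_{t+1}.\<close>
definition Bset :: "nat \<Rightarrow> nat \<Rightarrow> ('a::{field,finite}) ratfun set" where
  "Bset m n = {Y m I J | I J k. 1 \<le> k \<and> k \<le> min n (m + 1) \<and>
      length I = k \<and> length J = k \<and> sum_list I = n - k \<and>
      (\<forall>t < k - 1. J ! t < card (UNIV :: 'a set) ^ (m - t) - 1) \<and>
      J ! (k - 1) \<le> card (UNIV :: 'a set) ^ (m + 1 - k) - 1}"

definition Bpoly :: "nat \<Rightarrow> nat \<Rightarrow> ('a::{field,finite}) mpoly set" where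
  "Bpoly m n = {P. Fract P 1 \<in> Bset m n}"

text \<open>The ideal (x_1^{p^m},...,x_n^{p^m}) of S = F_p[x_1..x_n]; Q(m,n) = S / QI m n.\<close>
definition QI :: "nat \<Rightarrow> nat \<Rightarrow> ('a::{field,finite}) mpoly set" where
  "QI m n = {P. \<exists>g. (\<forall>i\<in>{1..n}. mvars (g i) \<subseteq> {1..n}) \<and>
       P = (\<Sum>i\<in>{1..n}. g i * mvar i ^ (card (UNIV :: 'a set) ^ m))}"

definition unitri :: "nat \<Rightarrow> 'a::field mat \<Rightarrow> bool" where
  "unitri n \<sigma> \<longleftrightarrow> \<sigma> \<in> carrier_mat n n \<and> (\<forall>i<n. \<sigma> $$ (i,i) = 1) \<and>
      (\<forall>i<n. \<forall>j<i. \<sigma> $$ (i,j) = 0)"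

definition act :: "'a::field mat \<Rightarrow> 'a mpoly \<Rightarrow> 'a mpoly" where
  "act \<sigma> f = meval mconst
     (\<lambda>j. if 1 \<le> j \<and> j \<le> dim_row \<sigma>
          then (\<Sum>i<dim_row \<sigma>. mconst (\<sigma> $$ (i, j - 1)) * mvar (Suc i))
          else mvar j) f"

end

theory Submission
  imports Defs
begin

text \<open>
  Write \<open>q = p\<close> and, for vectors \<open>\<xi>\<^sub>1, \<xi>\<^sub>2, \<dots>\<close> of polynomials, \<open>L\<close> for the Moore
  determinant.

  The numerator of \<open>\<delta>\<^bsub>a;b\<^esub> f\<close> is divisible by \<open>L\<close> as soon as
  \<open>\<Sum>\<^sub>i c\<^sub>i \<xi>\<^sub>i^(q^b) f(\<xi> without \<xi>\<^sub>i) = 0\<close> whenever \<open>\<Sum>\<^bsub>i\<le>a\<^esub> c\<^sub>i \<xi>\<^sub>i = 0\<close> with \<open>c\<^sub>i\<close> in the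
  prime field.  By Cramer's rule and the cancellation of an alternating double sum, \<open>\<delta>\<^bsub>a;b\<^esub> f\<close>
  satisfies the same condition with \<open>a + 1\<close> in place of \<open>a\<close>; multiplication by powers of \<open>V\<^sub>a\<close>
  preserves it, so all the \<open>Y\<close> are polynomials.  The condition for a three-term relation
  says that replacing \<open>x\<^sub>s\<close> by \<open>x\<^sub>s + c x\<^bsub>s-1\<^esub>\<close> changes \<open>f\<close> by a multiple of \<open>x\<^bsub>s-1\<^esub>^(q^b)\<close>; this gives
  the invariance of the \<open>Y\<close> modulo the ideal.

  For independence and spanning, filter by powers of \<open>x\<^sub>1\<close> and use induction on \<open>n\<close>.  If
  \<open>x\<^sub>1^j F\<close> is invariant and \<open>j < q^m - 1\<close>, invariance under \<open>x\<^sub>i \<mapsto> x\<^sub>i + x\<^sub>1\<close> makes all partial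
  derivatives of \<open>F(0, x\<^sub>2, \<dots>)\<close> vanish, so it is the \<open>p\<close>-th power of an invariant of
  \<open>Q(m-1,n-1)\<close>; and setting \<open>x\<^sub>1 = 0\<close> in \<open>\<delta>\<^bsub>2;m\<^esub>^i(V\<^sub>2^j \<dots>)\<close> gives the \<open>p\<close>-th power of the element
  \<open>\<delta>\<^bsub>1;m-1\<^esub>^i(V\<^sub>1^j \<dots>)\<close> of the basis of \<open>Q(m-1,n-1)\<close>.  In the top degree \<open>j = q^m - 1\<close> one has
  \<open>\<delta>\<^bsub>1;m\<^esub> f = x\<^sub>1^(q^m-1) f(x\<^sub>2, \<dots>)\<close> and the basis of \<open>Q(m,n-1)\<close>.
\<close>

section \<open>Evaluation of multivariate polynomials\<close>

text \<open>The filtration explains the bounds on the exponents. The basis for m - 1 enters only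
  below x_1-degree q^m - 1, through q-th roots, so each step to the next entry of J lowers m by one.
  At x_1-degree q^m - 1 the next power of x_1 already lies in the ideal: the derivative argument
  yields nothing there, but no correction term is left either, so m stays and only the number of
  variables drops. The q-th roots exist for two reasons: vanishing derivatives make exponents
  divisible by the characteristic, which is q because q is prime, and elements of the prime field
  are their own q-th powers.

  The obstacle to invariance is that membership of a defect in the ideal is lost under \<delta>.
  Each defect therefore carries, besides a power x_t^(q^b), a cofactor to which \<delta> can be
  applied in turn.

  All polynomials live in one ring with infinitely many variables. The operator \<delta>, which
  raises the number of variables, thus becomes a self-map of that ring, and the restriction to n
  variables is a support condition checked separately.\<close>

definition mmon :: "(nat \<Rightarrow> 'b::comm_semiring_1) \<Rightarrow> (nat \<Rightarrow>\<^sub>0 nat) \<Rightarrow> 'b" where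
  "mmon s mo = (\<Prod>v\<in>Poly_Mapping.keys mo. s v ^ Poly_Mapping.lookup mo v)"

lemma mmon_superset:
  assumes "finite A" "Poly_Mapping.keys mo \<subseteq> A"
  shows "mmon s mo = (\<Prod>v\<in>A. s v ^ Poly_Mapping.lookup mo v)"
  unfolding mmon_def using assms
  by (intro prod.mono_neutral_left) (auto simp: in_keys_iff)

lemma mmon_add: "mmon s (a + b) = mmon s a * mmon s b"
proof -
  let ?A = "Poly_Mapping.keys a \<union> Poly_Mapping.keys b"
  have "mmon s (a + b) = (\<Prod>v\<in>?A. s v ^ Poly_Mapping.lookup (a + b) v)"
    by (rule mmon_superset) (auto dest: set_mp[OF keys_add])
  also have "\<dots> = (\<Prod>v\<in>?A. s v ^ Poly_Mapping.lookup a v) * (\<Prod>v\<in>?A. s v ^ Poly_Mapping.lookup b v)"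
    by (simp add: lookup_add power_add prod.distrib)
  finally show ?thesis
    by (simp add: mmon_superset[of ?A])
qed

lemma mmon_zero [simp]: "mmon s 0 = 1"
  by (simp add: mmon_def)

lemma mmon_single [simp]: "mmon s (Poly_Mapping.single i e) = s i ^ e"
  by (simp add: mmon_def)

lemma meval_superset:
  assumes "finite A" "Poly_Mapping.keys P \<subseteq> A" "h 0 = 0"
  shows "meval h s P = (\<Sum>mo\<in>A. h (Poly_Mapping.lookup P mo) * mmon s mo)"
  unfolding meval_def mmon_def[symmetric] using assms
  by (intro sum.mono_neutral_left) (auto simp: in_keys_iff)

lemma poly_mapping_sum_single:
  "P = (\<Sum>mo\<in>Poly_Mapping.keys P. Poly_Mapping.single mo (Poly_Mapping.lookup P mo))"
  by (rule poly_mapping_eqI)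
     (auto simp: lookup_sum lookup_single when_def in_keys_iff sum.delta' cong: if_cong)

context comm_ring_hom
begin

text \<open>Kept general in the coefficient homomorphism because two instances occur:
  \<open>mconst\<close> for substitution of polynomials and \<open>rconst\<close> for substitution
  of rational functions.\<close>

lemma meval_add: "meval hom s (P + Q) = meval hom s P + meval hom s Q"
proof -
  let ?A = "Poly_Mapping.keys P \<union> Poly_Mapping.keys Q"
  have "meval hom s (P + Q) = (\<Sum>mo\<in>?A. hom (Poly_Mapping.lookup (P + Q) mo) * mmon s mo)"
    by (rule meval_superset) (auto dest: set_mp[OF keys_add])
  then show ?thesis
    by (simp add: meval_superset[of ?A] lookup_add hom_add distrib_right sum.distrib)
qed

lemma meval_zero: "meval hom s 0 = 0"
  by (simp add: meval_def)

lemma meval_single: "meval hom s (Poly_Mapping.single mo c) = hom c * mmon s mo"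
  by (simp add: meval_def mmon_def)

lemma meval_sum: "meval hom s (sum f A) = (\<Sum>a\<in>A. meval hom s (f a))"
  by (induction A rule: infinite_finite_induct) (auto simp: meval_add meval_zero)

lemma meval_mult: "meval hom s (P * Q) = meval hom s P * meval hom s Q"
proof -
  let ?s = "\<lambda>P mo. Poly_Mapping.single mo (Poly_Mapping.lookup P mo)"
  have "P * Q = (\<Sum>a\<in>Poly_Mapping.keys P. ?s P a) * (\<Sum>b\<in>Poly_Mapping.keys Q. ?s Q b)"
    by (simp flip: poly_mapping_sum_single)
  also have "\<dots> = (\<Sum>a\<in>Poly_Mapping.keys P. \<Sum>b\<in>Poly_Mapping.keys Q. ?s P a * ?s Q b)"
    by (simp add: sum_product)
  also have "meval hom s \<dots> = (\<Sum>a\<in>Poly_Mapping.keys P. \<Sum>b\<in>Poly_Mapping.keys Q.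
      meval hom s (?s P a) * meval hom s (?s Q b))"
    by (simp add: meval_sum mult_single meval_single mmon_add hom_mult mult_ac)
  also have "\<dots> = meval hom s (\<Sum>a\<in>Poly_Mapping.keys P. ?s P a) * meval hom s (\<Sum>b\<in>Poly_Mapping.keys Q. ?s Q b)"
    by (simp add: meval_sum sum_product)
  finally show ?thesis
    by (simp flip: poly_mapping_sum_single)
qed

lemma meval_one: "meval hom s 1 = 1"
  using meval_single[of s 0 1] by simp

lemma comm_ring_hom_meval: "comm_ring_hom (meval hom s)"
  by unfold_locales (simp_all add: meval_add meval_mult meval_one meval_zero)

end

lemma mconst_0 [simp]: "mconst 0 = 0"
  and mconst_1 [simp]: "mconst (1::'a::comm_ring_1) = 1"
  and mconst_add: "mconst ((a::'a) + b) = mconst a + mconst b"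
  and mconst_mult: "mconst (a * b) = mconst a * mconst b"
  and mconst_uminus: "mconst (- a) = - mconst a"
  and mconst_diff: "mconst (a - b) = mconst a - mconst b"
  by (simp_all add: mconst_def single_add mult_single single_uminus single_diff)

lemma mconst_power: "mconst ((a::'a::comm_ring_1) ^ k) = mconst a ^ k"
  by (induction k) (simp_all add: mconst_mult)

lemma mconst_eq_iff [simp]: "mconst a = mconst b \<longleftrightarrow> a = b"
  unfolding mconst_def by (metis lookup_single_eq)

lemma mconst_eq_0_iff [simp]: "mconst a = 0 \<longleftrightarrow> a = 0"
  using mconst_eq_iff[of a 0] by (simp del: mconst_eq_iff)

interpretation mconst: comm_ring_hom "mconst :: 'a::comm_ring_1 \<Rightarrow> 'a mpoly"
  by unfold_locales (simp_all add: mconst_add mconst_mult)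

interpretation rconst: comm_ring_hom "rconst :: 'a::idom \<Rightarrow> 'a ratfun"
  by unfold_locales (simp_all add: rconst_def mconst_add mconst_mult Zero_fract_def One_fract_def)

definition subst :: "(nat \<Rightarrow> 'a mpoly) \<Rightarrow> 'a mpoly \<Rightarrow> 'a::comm_ring_1 mpoly" where
  "subst \<xi> = meval mconst \<xi>"

interpretation subst: comm_ring_hom "subst \<xi>" for \<xi> :: "nat \<Rightarrow> 'a::comm_ring_1 mpoly"
  unfolding subst_def by (rule mconst.comm_ring_hom_meval)

lemma subst_mconst [simp]: "subst \<xi> (mconst c) = mconst c"
  using mconst.meval_single[of \<xi> 0 c] by (simp add: subst_def mconst_def)

lemma subst_mvar [simp]: "subst \<xi> (mvar i) = \<xi> i"
  using mconst.meval_single[of \<xi> "Poly_Mapping.single i 1" 1] by (simp add: subst_def mvar_def)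

lemma subst_single: "subst \<xi> (Poly_Mapping.single mo c) = mconst c * mmon \<xi> mo"
  unfolding subst_def by (rule mconst.meval_single)

lemma mvar_power: "(mvar i :: 'a::comm_ring_1 mpoly) ^ k = Poly_Mapping.single (Poly_Mapping.single i k) 1"
  by (induction k) (simp_all add: mvar_def mult_single flip: single_add)

lemma mmon_mvar: "mmon mvar mo = (Poly_Mapping.single mo 1 :: 'a::comm_ring_1 mpoly)"
proof -
  have *: "(\<Prod>v\<in>A. Poly_Mapping.single (f v) (1::'a)) = Poly_Mapping.single (\<Sum>v\<in>A. f v) 1"
    if "finite A" for A :: "nat set" and f :: "nat \<Rightarrow> nat \<Rightarrow>\<^sub>0 nat"
    using that by (induction A rule: finite_induct) (simp_all add: mult_single)
  show ?thesis
    unfolding mmon_def mvar_power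
    by (subst *) (simp_all flip: poly_mapping_sum_single)
qed

lemma single_eq_mconst_mmon:
  "Poly_Mapping.single mo c = mconst c * (mmon mvar mo :: 'a::comm_ring_1 mpoly)"
  by (simp add: mmon_mvar mconst_def mult_single)

lemma subst_id [simp]: "subst mvar P = P"
  unfolding subst_def meval_def mmon_def[symmetric] single_eq_mconst_mmon[symmetric]
  by (simp flip: poly_mapping_sum_single)

lemma mpoly_induct [case_names const var add mult]:
  fixes P :: "'a::comm_ring_1 mpoly"
  assumes "\<And>c. R (mconst c)" "\<And>i. R (mvar i)"
    and add: "\<And>P Q. R P \<Longrightarrow> R Q \<Longrightarrow> R (P + Q)" and mult: "\<And>P Q. R P \<Longrightarrow> R Q \<Longrightarrow> R (P * Q)"
  shows "R P"
proof -
  have 0: "R 0" and 1: "R 1"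
    using assms(1)[of 0] assms(1)[of 1] by simp_all
  have pow: "R (P ^ k)" if "R P" for P k
    using that by (induction k) (auto intro: mult 1)
  have prod: "R (prod f A)" if "finite A" "\<And>x. x \<in> A \<Longrightarrow> R (f x)" for f :: "nat \<Rightarrow> _" and A
    using that by (induction A rule: finite_induct) (auto intro: mult 1)
  have sum: "R (sum f A)" if "finite A" "\<And>x. x \<in> A \<Longrightarrow> R (f x)" for f :: "(nat \<Rightarrow>\<^sub>0 nat) \<Rightarrow> _" and A
    using that by (induction A rule: finite_induct) (auto intro: add 0)
  have "R (Poly_Mapping.single mo c)" for mo c
    unfolding single_eq_mconst_mmon mmon_def by (intro mult assms prod pow) auto
  then show ?thesis
    by (subst poly_mapping_sum_single) (intro sum; simp)
qed

lemma subst_subst: "subst \<xi> (subst \<eta> P) = subst (\<lambda>i. subst \<xi> (\<eta> i)) P"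
  by (induction P rule: mpoly_induct) (simp_all add: subst.hom_add subst.hom_mult)

lemma mvars_mconst [simp]: "mvars (mconst c) = {}"
  by (simp add: mvars_def mconst_def)

lemma mvars_mvar [simp]: "mvars (mvar i :: 'a::comm_ring_1 mpoly) = {i}"
  by (simp add: mvars_def mvar_def)

lemma mvars_0 [simp]: "mvars 0 = {}" and mvars_1 [simp]: "mvars 1 = {}"
  by (simp_all add: mvars_def)

lemma mvars_add: "mvars (P + Q) \<subseteq> mvars P \<union> mvars Q"
  unfolding mvars_def using keys_add[of P Q] by blast

lemma mvars_mult: "mvars (P * Q) \<subseteq> mvars P \<union> mvars Q"
  unfolding mvars_def using keys_mult[of P Q] keys_add by fastforce

lemma mvars_uminus [simp]: "mvars (- P :: 'a::comm_ring_1 mpoly) = mvars P"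
  by (simp add: mvars_def in_keys_iff set_eq_iff)

lemma mvars_diff: "mvars (P - Q) \<subseteq> mvars P \<union> mvars (Q::'a::comm_ring_1 mpoly)"
  using mvars_add[of P "- Q"] by simp

lemma mvars_sum: "mvars (sum f A) \<subseteq> (\<Union>a\<in>A. mvars (f a))"
  by (induction A rule: infinite_finite_induct) (use mvars_add in force)+

lemma mvars_prod: "mvars (prod f A) \<subseteq> (\<Union>a\<in>A. mvars (f a :: 'a::comm_ring_1 mpoly))"
  by (induction A rule: infinite_finite_induct) (use mvars_mult in force)+

lemma mvars_power: "mvars (P ^ k) \<subseteq> mvars (P :: 'a::comm_ring_1 mpoly)"
  by (induction k) (use mvars_mult in force)+

lemma subst_cong:
  assumes "\<And>i. i \<in> mvars P \<Longrightarrow> \<xi> i = \<eta> i"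
  shows "subst \<xi> P = subst \<eta> P"
  unfolding subst_def meval_def using assms
  by (intro sum.cong refl arg_cong2[of _ _ _ _ times] prod.cong arg_cong2[of _ _ _ _ power])
     (auto simp: mvars_def)

lemma mvars_subst: "mvars (subst \<xi> P) \<subseteq> (\<Union>i\<in>mvars P. mvars (\<xi> i))" (is "_ \<subseteq> ?U")
proof -
  have v: "mvars (\<xi> v ^ k) \<subseteq> ?U" if "v \<in> mvars P" for v k
    by (rule order.trans[OF mvars_power]) (use that in blast)
  have "mvars (mmon \<xi> mo) \<subseteq> ?U" if "mo \<in> Poly_Mapping.keys P" for mo
    unfolding mmon_def
    by (intro order.trans[OF mvars_prod] UN_least v) (use that in \<open>auto simp: mvars_def\<close>)
  then have "mvars (mconst (Poly_Mapping.lookup P mo) * mmon \<xi> mo) \<subseteq> ?U"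
    if "mo \<in> Poly_Mapping.keys P" for mo
    by (intro order.trans[OF mvars_mult]) (use that in simp)
  then show ?thesis
    unfolding subst_def meval_def mmon_def[symmetric]
    by (intro order.trans[OF mvars_sum] UN_least)
qed

section \<open>Divisibility tested by substitution\<close>

lemma dvd_subst_diff:
  assumes "\<And>i. l dvd \<xi> i - \<eta> i"
  shows "l dvd subst \<xi> P - subst \<eta> P"
proof (induction P rule: mpoly_induct)
  case (add P Q)
  then show ?case
    using dvd_add[OF add] by (simp add: subst.hom_add algebra_simps)
next
  case (mult P Q)
  have "subst \<xi> (P * Q) - subst \<eta> (P * Q) =
      subst \<xi> P * (subst \<xi> Q - subst \<eta> Q) + (subst \<xi> P - subst \<eta> P) * subst \<eta> Q"
    by (simp add: subst.hom_mult algebra_simps)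
  then show ?case
    using mult by (metis dvd_add dvd_mult dvd_mult2)
qed (use assms in auto)

text \<open>The substitution is the identity modulo \<open>l\<close> and kills \<open>l\<close>, so
  its kernel is the ideal of \<open>l\<close>.\<close>

lemma dvd_iff_subst_eq_0:
  assumes "\<And>i. l dvd \<xi> i - mvar i" "subst \<xi> l = 0"
  shows "l dvd P \<longleftrightarrow> subst \<xi> P = 0"
proof
  assume "l dvd P"
  then show "subst \<xi> P = 0"
    using assms(2) by (auto elim!: dvdE simp: subst.hom_mult)
next
  assume "subst \<xi> P = 0"
  then show "l dvd P"
    using dvd_subst_diff[of l \<xi> mvar P] assms(1) by simp
qed

text \<open>The kernel of a homomorphism into a domain is a prime ideal.\<close>

lemma prime_elem_if_subst:
  assumes "\<And>i. l dvd \<xi> i - mvar i" "subst \<xi> l = 0" "l \<noteq> (0 :: 'a::idom mpoly)"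
  shows "prime_elem l"
proof (rule prime_elemI)
  show "\<not> l dvd 1"
    using dvd_iff_subst_eq_0[OF assms(1,2)] by (simp add: subst.hom_one)
qed (use dvd_iff_subst_eq_0[OF assms(1,2)] assms(3) in \<open>auto simp: subst.hom_mult\<close>)

lemma mvar_nonzero [simp]: "(mvar i :: 'a::comm_ring_1 mpoly) \<noteq> 0"
  by (metis mvars_0 mvars_mvar insert_not_empty)

lemma mvar_eq_iff [simp]: "(mvar i :: 'a::comm_ring_1 mpoly) = mvar j \<longleftrightarrow> i = j"
  by (metis mvars_mvar singleton_inject)

lemma mvar_dvd_iff: "(mvar i :: 'a::idom mpoly) dvd P \<longleftrightarrow> subst (mvar(i := 0)) P = 0"
  by (rule dvd_iff_subst_eq_0) auto

lemma prime_elem_mvar: "prime_elem (mvar i :: 'a::idom mpoly)"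
  by (rule prime_elem_if_subst[of _ "mvar(i := 0)"]) auto

lemma prime_elem_power_dvd_cancel:
  fixes p :: "'b::idom"
  assumes "prime_elem p" "\<not> p dvd y" "p ^ k dvd y * z"
  shows "p ^ k dvd z"
  using assms(3)
proof (induction k arbitrary: z)
  case (Suc k)
  have "p dvd y * z"
    using Suc.prems by (auto elim: dvd_trans[rotated])
  then obtain z' where z': "z = p * z'"
    using assms(1,2) prime_elem_dvd_multD by blast
  have "p ^ k dvd y * z'"
    using Suc.prems assms(1) by (simp add: z' mult.left_commute[of y] prime_elem_def)
  from Suc.IH[OF this] show ?case
    by (simp add: z')
qed simp

text \<open>Takes the place of unique factorization: the primes are split off one at a time, and
  none of them divides the product of the others.\<close>

lemma prod_primes_dvd:
  fixes \<Lambda> :: "'b::idom set"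
  assumes "finite \<Lambda>" "\<And>l. l \<in> \<Lambda> \<Longrightarrow> prime_elem l" "\<And>l. l \<in> \<Lambda> \<Longrightarrow> l dvd N"
    and "\<And>l l'. l \<in> \<Lambda> \<Longrightarrow> l' \<in> \<Lambda> \<Longrightarrow> l dvd l' \<Longrightarrow> l = l'"
  shows "\<Prod>\<Lambda> dvd N"
  using assms
proof (induction \<Lambda> rule: finite_induct)
  case (insert l \<Lambda>)
  have "\<Prod>\<Lambda> dvd N"
    by (rule insert.IH) (use insert.prems in blast)+
  then obtain M where M: "N = \<Prod>\<Lambda> * M"
    by blast
  have pl: "prime_elem l"
    using insert.prems by blast
  have "\<not> l dvd \<Prod>\<Lambda>"
  proof
    assume "l dvd \<Prod>\<Lambda>"
    with insert.hyps(1) have "\<exists>l'\<in>\<Lambda>. l dvd l'"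
      by (induction \<Lambda> rule: finite_induct) (use pl prime_elem_dvd_multD in \<open>auto simp: prime_elem_def\<close>)
    then obtain l' where "l' \<in> \<Lambda>" "l dvd l'"
      by blast
    then show False
      using insert.prems(3) insert.hyps(2) by blast
  qed
  then have "l dvd M"
    using M pl insert.prems(2)[of l] by (auto dest: prime_elem_dvd_multD)
  then show ?case
    using insert.hyps by (auto simp: M mult.commute[of l] intro: mult_dvd_mono)
qed simp

section \<open>Moore determinants\<close>

locale prime_field =
  fixes ty :: "'a::{field,finite} itself" and q :: nat
  assumes card_field [simp]: "card (UNIV :: 'a set) = q" and prime_q: "prime q"
begin

text \<open>Translation by 1 permutes the field, so the sum of all elements is unchanged when
  \<open>q\<close> is added to it.\<close>

lemma of_nat_q: "of_nat q = (0 :: 'a)"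
proof -
  have "(\<Sum>x\<in>UNIV. x + 1) = (\<Sum>x\<in>UNIV. x :: 'a)"
    by (rule sum.reindex_bij_witness[of _ "\<lambda>x. x - 1" "\<lambda>x. x + 1"]) auto
  then show ?thesis
    by (simp add: sum.distrib)
qed

lemma CHAR_eq: "CHAR('a) = q"
proof -
  have "CHAR('a) dvd q"
    using of_nat_q by (simp add: of_nat_eq_0_iff_char_dvd)
  then show ?thesis
    using prime_q CHAR_not_1'[where ?'a = 'a] by (auto simp: prime_nat_iff)
qed

lemma CHAR_mpoly: "CHAR('a mpoly) = q"
proof -
  have "of_nat q = (0 :: 'a mpoly)"
    using mconst.hom_of_nat[of q] of_nat_q by (metis mconst_0)
  then have "CHAR('a mpoly) dvd q"
    by (simp add: of_nat_eq_0_iff_char_dvd)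
  then show ?thesis
    using prime_q CHAR_not_1'[where ?'a = "'a mpoly"] by (auto simp: prime_nat_iff)
qed

lemma q_gt_1: "1 < q"
  using prime_q by (rule prime_gt_1_nat)

lemma frob_add: "((x::'a mpoly) + y) ^ (q ^ t) = x ^ (q ^ t) + y ^ (q ^ t)"
  by (rule freshmans_dream'[of _ t]) (simp_all add: CHAR_mpoly prime_q)

lemma frob_sum: "(\<Sum>i\<in>A. f i :: 'a mpoly) ^ (q ^ t) = (\<Sum>i\<in>A. f i ^ (q ^ t))"
  by (rule freshmans_dream_sum'[of _ t]) (simp_all add: CHAR_mpoly prime_q)

lemma frob_minus_one: "(- 1 :: 'a mpoly) ^ (q ^ t) = - 1"
  using frob_add[of 1 "- 1" t] q_gt_1 by (simp add: zero_power eq_neg_iff_add_eq_0 add.commute)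

lemma frob_uminus: "(- x :: 'a mpoly) ^ (q ^ t) = - (x ^ (q ^ t))"
  using frob_minus_one[of t] by (metis mult_minus1 power_mult_distrib)

lemma frob_diff: "((x::'a mpoly) - y) ^ (q ^ t) = x ^ (q ^ t) - y ^ (q ^ t)"
  using frob_add[of x "- y" t] by (simp add: frob_uminus)

text \<open>The images of 0, ..., q - 1 are fixed by the freshman's dream, and by counting they are
  the whole field.\<close>

lemma coeff_frob: "(c::'a) ^ q = c"
proof -
  have *: "(of_nat k :: 'a) ^ q = of_nat k" for k
  proof (induction k)
    case (Suc k)
    then show ?case
      by (simp add: freshmans_dream CHAR_eq prime_q)
  qed (use q_gt_1 in auto)
  have "inj_on (of_nat :: nat \<Rightarrow> 'a) {..<q}"
  proof (rule linorder_inj_onI')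
    fix i j assume ij: "i \<in> {..<q}" "j \<in> {..<q}" "i < j"
    have "\<not> q dvd j - i"
      using ij by (auto dest: dvd_imp_le)
    then have "of_nat (j - i) \<noteq> (0 :: 'a)"
      by (simp add: of_nat_eq_0_iff_char_dvd CHAR_eq)
    then show "of_nat i \<noteq> (of_nat j :: 'a)"
      using ij by (simp add: of_nat_diff)
  qed
  then have "card ((of_nat :: nat \<Rightarrow> 'a) ` {..<q}) = q"
    by (simp add: card_image)
  then have "(of_nat :: nat \<Rightarrow> 'a) ` {..<q} = UNIV"
    by (intro card_subset_eq) auto
  then show ?thesis
    using * by (metis UNIV_I imageE)
qed

lemma coeff_frob_pow: "(c::'a) ^ (q ^ t) = c"
  by (induction t) (simp_all add: power_mult coeff_frob mult.commute)

text \<open>A linear relation with constant coefficients thereby passes to every row of a Moore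
  matrix.\<close>

lemma frob_lincomb:
  "(\<Sum>i\<in>A. mconst (c i :: 'a) * f i) ^ (q ^ t) = (\<Sum>i\<in>A. mconst (c i) * f i ^ (q ^ t))"
  by (simp add: frob_sum power_mult_distrib coeff_frob_pow flip: mconst_power)

end

definition moore :: "nat \<Rightarrow> (nat \<Rightarrow> 'a mpoly) \<Rightarrow> 'a::{field,finite} mpoly" where
  "moore a \<xi> = det (mat a a (\<lambda>(t,j). \<xi> (Suc j) ^ (card (UNIV :: 'a set) ^ t)))"

text \<open>The free last row covers three uses: the next Moore determinant, the numerator of
  \<delta>, and the artificial row in \<open>moore_cramer\<close>.\<close>

definition bordered :: "nat \<Rightarrow> (nat \<Rightarrow> 'a mpoly) \<Rightarrow> (nat \<Rightarrow> 'a mpoly) \<Rightarrow> 'a::{field,finite} mpoly" where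
  "bordered a r \<xi> = det (mat (Suc a) (Suc a)
     (\<lambda>(t,j). if t < a then \<xi> (Suc j) ^ (card (UNIV :: 'a set) ^ t) else r (Suc j)))"

lemma moore_0 [simp]: "moore 0 \<xi> = 1"
  by (simp add: moore_def det_def)

lemma moore_Suc_bordered:
  "moore (Suc a) \<xi> = bordered a (\<lambda>i. \<xi> i ^ (card (UNIV :: 'a::{field,finite} set) ^ a)) (\<xi> :: nat \<Rightarrow> 'a mpoly)"
  unfolding moore_def bordered_def by (intro arg_cong[of _ _ det] eq_matI) (auto simp: less_Suc_eq)

lemma moore_cong:
  assumes "\<And>i. 1 \<le> i \<Longrightarrow> i \<le> a \<Longrightarrow> \<xi> i = \<eta> i"
  shows "moore a \<xi> = moore a \<eta>"
  unfolding moore_def using assms by (intro arg_cong[of _ _ det] eq_matI) auto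

lemma subst_moore: "subst \<eta> (moore a \<xi>) = moore a (\<lambda>i. subst \<eta> (\<xi> i))"
  unfolding moore_def subst.hom_det[symmetric]
  by (intro arg_cong[of _ _ det] eq_matI) (auto simp: subst.hom_power)

lemma moore_subst: "moore a \<xi> = subst \<xi> (moore a mvar)"
  by (simp add: subst_moore)

lemma bordered_expand:
  "bordered a r \<xi> = (\<Sum>i\<in>{1..Suc a}. (- 1) ^ (Suc a + i) * r i * moore a (\<lambda>j. \<xi> (skip_var i j)))"
proof -
  let ?A = "mat (Suc a) (Suc a)
     (\<lambda>(t,j). if t < a then \<xi> (Suc j) ^ (card (UNIV :: 'a set) ^ t) else r (Suc j))"
  have minor: "det (mat_delete ?A a j) = moore a (\<lambda>k. \<xi> (skip_var (Suc j) k))" if "j < Suc a" for j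
    unfolding moore_def
    by (intro arg_cong[of _ _ det] eq_matI) (use that in \<open>auto simp: mat_delete_def skip_var_def\<close>)
  have "bordered a r \<xi> = (\<Sum>j<Suc a. ?A $$ (a, j) * cofactor ?A a j)"
    unfolding bordered_def by (rule laplace_expansion_row) auto
  also have "\<dots> = (\<Sum>j<Suc a. (- 1) ^ (Suc a + Suc j) * r (Suc j) * moore a (\<lambda>k. \<xi> (skip_var (Suc j) k)))"
    by (intro sum.cong refl) (simp add: cofactor_def minor)
  also have "\<dots> = (\<Sum>i\<in>{1..Suc a}. (- 1) ^ (Suc a + i) * r i * moore a (\<lambda>j. \<xi> (skip_var i j)))"
    by (rule sum.reindex_bij_witness[of _ "\<lambda>i. i - 1" Suc]) auto
  finally show ?thesis .
qed

context prime_field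
begin

text \<open>The vector of the coefficients \<open>c\<close> is a nonzero kernel vector: the Moore
  rows kill it by Frobenius, the last row by assumption.\<close>

lemma bordered_eq_0:
  fixes \<xi> r :: "nat \<Rightarrow> 'a mpoly"
  assumes "(\<Sum>i\<in>{1..Suc a}. mconst (c i) * \<xi> i) = 0" "(\<Sum>i\<in>{1..Suc a}. mconst (c i) * r i) = 0"
    and d: "1 \<le> d" "d \<le> Suc a" "c d \<noteq> 0"
  shows "bordered a r \<xi> = 0"
proof -
  let ?A = "mat (Suc a) (Suc a)
     (\<lambda>(t,j). if t < a then \<xi> (Suc j) ^ (q ^ t) else r (Suc j))"
  define v where "v = vec (Suc a) (\<lambda>j. mconst (c (Suc j)))"
  have reindex: "(\<Sum>j\<in>{0..<Suc a}. g (Suc j)) = (\<Sum>i\<in>{1..Suc a}. g i)" for g :: "nat \<Rightarrow> 'a mpoly"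
    by (rule sum.reindex_bij_witness[of _ "\<lambda>i. i - 1" Suc]) auto
  have "?A *\<^sub>v v = 0\<^sub>v (Suc a)"
  proof (rule eq_vecI)
    fix t assume "t < dim_vec (0\<^sub>v (Suc a) :: 'a mpoly vec)"
    then have t: "t < Suc a"
      by simp
    have "(?A *\<^sub>v v) $ t = (\<Sum>j\<in>{0..<Suc a}. (if t < a then \<xi> (Suc j) ^ (q ^ t) else r (Suc j)) * mconst (c (Suc j)))"
      using t by (simp add: scalar_prod_def v_def row_def del: sum.op_ivl_Suc)
    also have "\<dots> = (\<Sum>i\<in>{1..Suc a}. (if t < a then \<xi> i ^ (q ^ t) else r i) * mconst (c i))"
      by (rule reindex)
    also have "\<dots> = 0"
      using assms(2) frob_lincomb[of c \<xi> "{1..Suc a}" t] q_gt_1 assms(1)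
      by (cases "t < a") (simp_all add: mult.commute zero_power)
    finally show "(?A *\<^sub>v v) $ t = 0\<^sub>v (Suc a) $ t"
      using t by simp
  qed simp
  moreover have "v \<noteq> 0\<^sub>v (Suc a)"
  proof
    assume "v = 0\<^sub>v (Suc a)"
    then have "v $ (d - 1) = 0"
      using d by simp
    then show False
      using d by (simp add: v_def)
  qed
  ultimately show ?thesis
    unfolding bordered_def card_field
    by (subst det_0_iff_vec_prod_zero[of _ "Suc a"]) (auto intro!: exI[of _ v] simp: v_def)
qed

lemma moore_eq_0:
  fixes \<xi> :: "nat \<Rightarrow> 'a mpoly"
  assumes "(\<Sum>i\<in>{1..a}. mconst (c i) * \<xi> i) = 0" "1 \<le> d" "d \<le> a" "c d \<noteq> 0"
  shows "moore a \<xi> = 0"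
proof (cases a)
  case (Suc b)
  then show ?thesis
    unfolding Suc moore_Suc_bordered card_field
    using assms[unfolded Suc] frob_lincomb[of c \<xi> "{1..Suc b}" b] q_gt_1
    by (intro bordered_eq_0[of c _ _ _ d]) (simp_all add: zero_power del: sum.cl_ivl_Suc)
qed (use assms in auto)

text \<open>Border the \<open>a\<close> Moore rows by the row with entries \<open>c k\<close> at \<open>i\<close> and \<open>- c i\<close> at \<open>k\<close>: the vector
  \<open>c\<close> is then in the kernel, and the Laplace expansion has only two terms.\<close>
lemma moore_cramer:
  fixes \<xi> :: "nat \<Rightarrow> 'a mpoly"
  assumes rel: "(\<Sum>i\<in>{1..Suc a}. mconst (c i) * \<xi> i) = 0"
    and ik: "i \<in> {1..Suc a}" "k \<in> {1..Suc a}"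
  shows "mconst (c k) * (- 1) ^ i * moore a (\<lambda>j. \<xi> (skip_var i j)) =
         mconst (c i) * (- 1) ^ k * moore a (\<lambda>j. \<xi> (skip_var k j))"
proof (cases "i = k \<or> c i = 0 \<and> c k = 0")
  case False
  define r where "r j = (if j = i then mconst (c k) else if j = k then - mconst (c i) else 0)" for j
  have two: "(\<Sum>j\<in>{1..Suc a}. g j) = g i + g k" if "\<And>j. j \<noteq> i \<Longrightarrow> j \<noteq> k \<Longrightarrow> g j = 0" for g :: "nat \<Rightarrow> 'a mpoly"
  proof -
    have "(\<Sum>j\<in>{1..Suc a}. g j) = (\<Sum>j\<in>{i,k}. g j)"
      using ik that by (intro sum.mono_neutral_right) auto
    then show ?thesis
      using False by simp
  qed
  have "(\<Sum>j\<in>{1..Suc a}. mconst (c j) * r j) = 0"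
    using False by (subst two) (auto simp: r_def)
  moreover obtain d where "1 \<le> d" "d \<le> Suc a" "c d \<noteq> 0"
    using False ik by auto
  ultimately have "bordered a r \<xi> = 0"
    using rel by (intro bordered_eq_0)
  then have "(- 1) ^ (Suc a + i) * r i * moore a (\<lambda>j. \<xi> (skip_var i j)) +
      (- 1) ^ (Suc a + k) * r k * moore a (\<lambda>j. \<xi> (skip_var k j)) = 0"
    unfolding bordered_expand by (subst (asm) two) (auto simp: r_def)
  then have "(- 1) ^ Suc a * (mconst (c k) * (- 1) ^ i * moore a (\<lambda>j. \<xi> (skip_var i j)) -
         mconst (c i) * (- 1) ^ k * moore a (\<lambda>j. \<xi> (skip_var k j))) = 0"
    using False unfolding r_def power_add by (simp add: algebra_simps)
  then show ?thesis
    by simp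
qed auto

end

section \<open>Linear forms and the factorization of the Moore determinant\<close>

definition lincomb :: "(nat \<Rightarrow> 'a) \<Rightarrow> nat \<Rightarrow> 'a::comm_ring_1 mpoly" where
  "lincomb c i = (\<Sum>j\<in>{1..<i}. mconst (c j) * mvar j)"

definition lspan :: "nat \<Rightarrow> 'a::comm_ring_1 mpoly set" where
  "lspan i = {lincomb c i | c. True}"

lemma muiV_lspan: "muiV i = (\<Prod>w\<in>lspan i. mvar i + w)"
  unfolding muiV_def lspan_def lincomb_def ..

lemma mvars_lincomb: "mvars (lincomb c i) \<subseteq> {1..<i}"
proof -
  have "mvars (mconst (c j) * mvar j) \<subseteq> {1..<i}" if "j \<in> {1..<i}" for j
    using mvars_mult[of "mconst (c j)" "mvar j"] that by auto
  then show ?thesis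
    unfolding lincomb_def
    using mvars_sum[of "\<lambda>j. mconst (c j) * mvar j" "{1..<i}"] by blast
qed

lemma mvars_lspan: "w \<in> lspan i \<Longrightarrow> mvars w \<subseteq> {1..<i}"
  using mvars_lincomb by (auto simp: lspan_def)

lemma single_Suc_0_eq_iff [simp]:
  "Poly_Mapping.single i (Suc 0) = Poly_Mapping.single j (Suc 0) \<longleftrightarrow> i = j"
  by (metis keys_single nat.distinct(1) singleton_inject)

lemma lincomb_upd:
  assumes "r \<in> {1..<j}"
  shows "lincomb (c(r := c r + e)) j = lincomb c j + mconst e * mvar r"
proof -
  have "lincomb (c(r := c r + e)) j = (\<Sum>i\<in>{1..<j}. mconst (c i) * mvar i + (if i = r then mconst e * mvar r else 0))"
    unfolding lincomb_def by (intro sum.cong) (auto simp: mconst_add algebra_simps)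
  then show ?thesis
    using assms by (simp add: lincomb_def sum.distrib)
qed

lemma lookup_lincomb:
  assumes "j \<in> {1..<i}"
  shows "Poly_Mapping.lookup (lincomb c i) (Poly_Mapping.single j 1) = c j"
proof -
  have "Poly_Mapping.lookup (lincomb c i) (Poly_Mapping.single j 1) = (\<Sum>k\<in>{1..<i}. if k = j then c k else 0)"
    unfolding lincomb_def lookup_sum mconst_def mvar_def mult_single
    by (intro sum.cong refl) (auto simp: lookup_single when_def)
  also have "\<dots> = c j"
    using assms by simp
  finally show ?thesis .
qed

lemma bij_betw_lincomb:
  "bij_betw (\<lambda>c. lincomb c i) (PiE {1..<i} (\<lambda>_. UNIV)) (lspan i :: 'a::comm_ring_1 mpoly set)"
proof (rule bij_betw_imageI)
  show "inj_on (\<lambda>c. lincomb c i :: 'a mpoly) (PiE {1..<i} (\<lambda>_. UNIV))"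
  proof (rule inj_onI)
    fix c c' :: "nat \<Rightarrow> 'a"
    assume *: "c \<in> PiE {1..<i} (\<lambda>_. UNIV)" "c' \<in> PiE {1..<i} (\<lambda>_. UNIV)" "lincomb c i = lincomb c' i"
    have "c j = c' j" if "j \<in> {1..<i}" for j
      using lookup_lincomb[OF that] *(3) by metis
    then show "c = c'"
      using *(1,2) by (intro PiE_ext)
  qed
  have "lincomb c i = lincomb (restrict c {1..<i}) i" for c :: "nat \<Rightarrow> 'a"
    by (simp add: lincomb_def)
  then show "(\<lambda>c. lincomb c i) ` (PiE {1..<i} (\<lambda>_. UNIV)) = (lspan i :: 'a mpoly set)"
    by (fastforce simp: lspan_def image_iff)
qed

lemma card_lspan: "card (lspan (Suc a) :: 'a::{field,finite} mpoly set) = card (UNIV :: 'a set) ^ a"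
  using bij_betw_same_card[OF bij_betw_lincomb[of "Suc a", where ?'a = 'a]]
  by (simp add: card_PiE)

lemma finite_lspan [simp]: "finite (lspan i :: 'a::{field,finite} mpoly set)"
  using bij_betw_finite[OF bij_betw_lincomb[of i, where ?'a = 'a]] by (simp add: finite_PiE)

lemma uminus_lspan: "w \<in> lspan i \<Longrightarrow> - w \<in> lspan i"
proof -
  have "- lincomb c i = lincomb (\<lambda>j. - c j) i" for c :: "nat \<Rightarrow> 'a"
    by (simp add: lincomb_def mconst_uminus sum_negf)
  then show "w \<in> lspan i \<Longrightarrow> - w \<in> lspan i"
    by (auto simp: lspan_def)
qed

text \<open>Adapts the factors x_i + w of V_i to a polynomial whose roots are the
  \<open>w\<close>.\<close>

lemma muiV_minus: "(\<Prod>w\<in>lspan i. mvar i - w) = (muiV i :: 'a::{field,finite} mpoly)"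
  unfolding muiV_lspan
  by (rule prod.reindex_bij_witness[of _ uminus uminus]) (auto intro: uminus_lspan)

text \<open>The difference of the two sides has no term of degree \<open>card R\<close>, hence
  smaller degree, yet vanishes on all of \<open>R\<close>.\<close>

lemma poly_eq_smult_prod_roots:
  fixes F :: "'b::idom poly"
  assumes "finite R" "\<And>w. w \<in> R \<Longrightarrow> poly F w = 0" "degree F \<le> card R"
  shows "F = smult (coeff F (card R)) (\<Prod>w\<in>R. [:- w, 1:])"
proof (rule ccontr)
  let ?P = "\<Prod>w\<in>R. [:- w, 1:]"
  define G where "G = F - smult (coeff F (card R)) ?P"
  assume "F \<noteq> smult (coeff F (card R)) ?P"
  then have G: "G \<noteq> 0"
    by (simp add: G_def)
  have deg: "degree ?P = card R"
    using assms(1) by (induction R rule: finite_induct) (auto simp: degree_mult_eq prod_zero_iff simp del: mult_pCons_left)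
  have "lead_coeff ?P = 1"
    by (simp add: lead_coeff_prod)
  then have "coeff G (card R) = 0"
    by (simp add: G_def deg)
  moreover have "degree G \<le> card R"
    unfolding G_def using assms(3) deg by (intro degree_diff_le order.trans[OF degree_smult_le]) auto
  ultimately have "degree G < card R \<or> card R = 0"
    using G by (metis le_neq_implies_less leading_coeff_0_iff)
  moreover have "poly G w = 0" if "w \<in> R" for w
    using that assms(1,2) by (auto simp: G_def poly_prod)
  then have "card R \<le> card {w. poly G w = 0}"
    using G by (intro card_mono poly_roots_finite) auto
  moreover have "card {w. poly G w = 0} \<le> degree G"
    using G by (rule card_poly_roots_bound)
  ultimately show False
    using G \<open>coeff G (card R) = 0\<close> \<open>degree G \<le> card R\<close> by (metis le_neq_implies_less leD le_trans leading_coeff_0_iff)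
qed

context prime_field
begin

text \<open>Expanded along its last column, the Moore determinant is a polynomial of degree \<open>q ^ a\<close> in the last
  variable which vanishes at the \<open>q ^ a\<close> elements of the span of the others.\<close>
lemma moore_Suc: "moore (Suc a) (mvar :: nat \<Rightarrow> 'a mpoly) = moore a mvar * muiV (Suc a)"
proof -
  define A where "A w = mat (Suc a) (Suc a) (\<lambda>(t,j). (mvar(Suc a := w)) (Suc j) ^ (q ^ t))" for w :: "'a mpoly"
  define C where "C t = cofactor (A 0) t a" for t
  define F where "F = (\<Sum>t<Suc a. monom (C t) (q ^ t))"
  have "cofactor (A w) t a = C t" if "t < Suc a" for w t
  proof -
    have "mat_delete (A w) t a = mat_delete (A 0) t a"
      using that by (intro eq_matI) (auto simp: A_def mat_delete_def)
    then show ?thesis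
      by (simp add: C_def cofactor_def)
  qed
  then have F: "moore (Suc a) (mvar(Suc a := w)) = poly F w" for w
    unfolding moore_def card_field A_def[symmetric] F_def
    by (subst laplace_expansion_column[of _ "Suc a" a])
       (auto simp: A_def poly_sum poly_monom mult.commute intro!: sum.cong)
  have "mat_delete (A 0) a a = mat a a (\<lambda>(t,j). mvar (Suc j) ^ (q ^ t))"
    by (intro eq_matI) (auto simp: A_def mat_delete_def)
  then have "C a = moore a mvar"
    by (simp add: C_def cofactor_def moore_def flip: mult_2 power_mult)
  moreover have "coeff F (q ^ a) = (\<Sum>t<Suc a. if t = a then C t else 0)"
    unfolding F_def coeff_sum using q_gt_1 by (intro sum.cong refl) auto
  ultimately have coeff: "coeff F (q ^ a) = moore a mvar"
    by simp
  have "degree F \<le> q ^ a"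
    unfolding F_def
    by (intro degree_sum_le) (use q_gt_1 in \<open>auto intro!: order.trans[OF degree_monom_le] power_increasing\<close>)
  moreover have "poly F w = 0" if w_in: "w \<in> lspan (Suc a)" for w
  proof -
    obtain c where w: "w = lincomb c (Suc a)"
      using w_in by (auto simp: lspan_def)
    have "(\<Sum>i\<in>{1..a}. mconst (c i) * mvar i) = w"
      by (simp add: w lincomb_def atLeastLessThanSuc_atLeastAtMost)
    moreover have "(\<Sum>i\<in>{1..a}. mconst ((c(Suc a := - 1)) i) * (mvar(Suc a := w)) i) = (\<Sum>i\<in>{1..a}. mconst (c i) * mvar i)"
      by (intro sum.cong) auto
    ultimately have "(\<Sum>i\<in>{1..Suc a}. mconst ((c(Suc a := - 1)) i) * (mvar(Suc a := w)) i) = 0"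
      by (simp add: mconst_uminus)
    then show ?thesis
      unfolding F[symmetric] by (rule moore_eq_0[of _ _ _ "Suc a"]) auto
  qed
  ultimately have "F = smult (coeff F (q ^ a)) (\<Prod>w\<in>lspan (Suc a). [:- w, 1:])"
    using poly_eq_smult_prod_roots[of "lspan (Suc a)" F] by (simp add: card_lspan)
  then have "poly F (mvar (Suc a)) = moore a mvar * poly (\<Prod>w\<in>lspan (Suc a). [:- w, 1:]) (mvar (Suc a))"
    unfolding coeff by (metis poly_smult)
  then show ?thesis
    using F[of "mvar (Suc a)"] by (simp add: poly_prod muiV_minus)
qed

lemma moore_eq_prod: "moore a (mvar :: nat \<Rightarrow> 'a mpoly) = (\<Prod>d\<in>{1..a}. muiV d)"
  by (induction a) (simp_all add: moore_Suc mult.commute)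

end

lemma mvar_add_lspan_nonzero:
  assumes "mvars w \<subseteq> {1..<d}"
  shows "mvar d + w \<noteq> (0::'a::comm_ring_1 mpoly)"
proof
  assume "mvar d + w = 0"
  then have "w = - mvar d"
    by (simp add: eq_neg_iff_add_eq_0 add.commute)
  then have "mvars w = {d}"
    by simp
  then show False
    using assms by auto
qed

lemma muiV_nonzero: "(muiV d :: 'a::{field,finite} mpoly) \<noteq> 0"
  unfolding muiV_lspan using mvar_add_lspan_nonzero mvars_lspan by (force simp: prod_zero_iff)

lemma mvars_muiV: "1 \<le> d \<Longrightarrow> mvars (muiV d :: 'a::{field,finite} mpoly) \<subseteq> {1..d}"
proof -
  assume "1 \<le> d"
  have "mvars (mvar d + w) \<subseteq> {1..d}" if "w \<in> lspan d" for w :: "'a mpoly"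
    by (rule order.trans[OF mvars_add]) (use mvars_lspan[OF that] \<open>1 \<le> d\<close> in auto)
  then show ?thesis
    unfolding muiV_lspan using mvars_prod[of "\<lambda>w. mvar d + w :: 'a mpoly" "lspan d"] by blast
qed

lemma subst_upd_lspan:
  assumes "mvars P \<subseteq> {1..<d}"
  shows "subst (mvar(d := l)) P = (P :: 'a::comm_ring_1 mpoly)"
proof -
  have "subst (mvar(d := l)) P = subst mvar P"
    using assms by (intro subst_cong) auto
  then show ?thesis
    by simp
qed

lemma dvd_linear_form_iff:
  assumes "mvars w \<subseteq> {1..<d}"
  shows "(mvar d + w) dvd P \<longleftrightarrow> subst (mvar(d := - w)) P = (0 :: 'a::idom mpoly)"
proof (rule dvd_iff_subst_eq_0)
  show "mvar d + w dvd (mvar(d := - w)) i - mvar i" for i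
  proof (cases "i = d")
    case True
    then have "(mvar(d := - w)) i - mvar i = - (mvar d + w)"
      by simp
    then show ?thesis
      by (metis dvd_minus_iff dvd_refl)
  qed auto
  show "subst (mvar(d := - w)) (mvar d + w) = 0"
    using assms by (simp add: subst.hom_add subst_upd_lspan)
qed

context prime_field
begin

lemma moore_nonzero: "moore a (mvar :: nat \<Rightarrow> 'a mpoly) \<noteq> 0"
  by (simp add: moore_eq_prod prod_zero_iff muiV_nonzero)

text \<open>The assumption says that every form x_d + w with d \<le> a and w in the span of the
  earlier variables divides \<open>N\<close>. These forms are primes, none divides another, and
  their product is the Moore determinant.\<close>

lemma moore_dvdI:
  fixes N :: "'a mpoly"
  assumes "\<And>d c. 1 \<le> d \<Longrightarrow> d \<le> a \<Longrightarrow> subst (mvar(d := - lincomb c d)) N = 0"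
  shows "moore a mvar dvd N"
proof -
  define \<Lambda> where "\<Lambda> d = (\<lambda>w. mvar d + w) ` (lspan d :: 'a mpoly set)" for d
  have prime: "prime_elem (mvar d + w)" if "w \<in> lspan d" for d and w :: "'a mpoly"
  proof (rule prime_elemI)
    have w: "mvars w \<subseteq> {1..<d}"
      using that by (rule mvars_lspan)
    then show "mvar d + w \<noteq> 0"
      by (rule mvar_add_lspan_nonzero)
    show "\<not> mvar d + w dvd 1"
      unfolding dvd_linear_form_iff[OF w] by (simp add: subst.hom_one)
    show "mvar d + w dvd x \<or> mvar d + w dvd y" if "mvar d + w dvd x * y" for x y
      using that unfolding dvd_linear_form_iff[OF w] by (simp add: subst.hom_mult)
  qed
  have uniq: "mvar d + w = mvar d' + w'"
    if "w \<in> lspan d" "w' \<in> lspan d'" "mvar d + w dvd mvar d' + w'" for d d' and w w' :: "'a mpoly"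
  proof -
    note w = mvars_lspan[OF that(1)] and w' = mvars_lspan[OF that(2)]
    have 0: "subst (mvar(d := - w)) (mvar d' + w') = 0"
      using that(3) unfolding dvd_linear_form_iff[OF w] .
    \<comment> \<open>The substitution kills x_d' + w'. For d' < d it would leave that form
      unchanged, and for d < d' the variable x_d' would survive, so d' = d.\<close>
    consider "d' = d" | "d' < d" | "d < d'"
      by linarith
    then show ?thesis
    proof cases
      case 1
      then have "subst (mvar(d := - w)) (mvar d' + w') = - w + w'"
        using w' by (simp add: subst.hom_add subst_upd_lspan)
      then show ?thesis
        using 0 1 by simp
    next
      case 2
      have "mvars (mvar d' + w') \<subseteq> {1..<d} \<or> d' = 0"
        using mvars_add[of "mvar d'" w'] w' 2 by fastforce
      then have "mvar d' + w' = 0"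
      proof
        assume "d' = 0"
        then have "subst (mvar(d := - w)) w' = w'"
          using w' by (intro subst_upd_lspan) auto
        then show ?thesis
          using 0 2 by (simp add: subst.hom_add)
      qed (use 0 subst_upd_lspan in metis)
      then show ?thesis
        using mvar_add_lspan_nonzero[OF w'] by simp
    next
      case 3
      have "mvars (subst (mvar(d := - w)) w') \<subseteq> {1..<d'}"
        using mvars_subst[of "mvar(d := - w)" w'] w w' 3 by (fastforce split: if_splits)
      then have "mvar d' + subst (mvar(d := - w)) w' \<noteq> 0"
        by (rule mvar_add_lspan_nonzero)
      then show ?thesis
        using 0 3 by (simp add: subst.hom_add)
    qed
  qed
  have "\<Lambda> d \<inter> \<Lambda> d' = {}" if "d \<noteq> d'" for d d'
  proof (rule ccontr)
    assume "\<Lambda> d \<inter> \<Lambda> d' \<noteq> {}"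
    then obtain w w' :: "'a mpoly" where *: "w \<in> lspan d" "w' \<in> lspan d'" "mvar d + w = mvar d' + w'"
      unfolding \<Lambda>_def by blast
    \<comment> \<open>Both variables would occur in \<open>w' - w\<close>, but the larger of the two
      lies in neither span.\<close>
    have "{d, d'} \<subseteq> {1..<d} \<union> {1..<d'}"
    proof -
      have "mvar d - mvar d' = w' - w"
        using *(3) by (simp add: algebra_simps)
      moreover have "Poly_Mapping.lookup (mvar d - mvar d' :: 'a mpoly) (Poly_Mapping.single e 1) \<noteq> 0" if "e \<in> {d, d'}" for e
        using that \<open>d \<noteq> d'\<close> by (auto simp: lookup_minus mvar_def lookup_single when_def)
      then have "{d, d'} \<subseteq> mvars (mvar d - mvar d' :: 'a mpoly)"
        unfolding mvars_def by (force simp: in_keys_iff)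
      ultimately show ?thesis
        using mvars_diff[of w' w] mvars_lspan[OF *(1)] mvars_lspan[OF *(2)] by fastforce
    qed
    then show False
      using that by (cases "d < d'") auto
  qed
  then have "(\<Prod>(\<Union>d\<in>{1..a}. \<Lambda> d)) = (\<Prod>d\<in>{1..a}. \<Prod>(\<Lambda> d))"
    by (subst prod.UNION_disjoint) (auto simp: \<Lambda>_def)
  also have "\<dots> = moore a mvar"
    unfolding moore_eq_prod \<Lambda>_def muiV_lspan by (rule prod.cong[OF refl], subst prod.reindex) (auto simp: inj_on_def)
  finally have "moore a mvar = (\<Prod>(\<Union>d\<in>{1..a}. \<Lambda> d))" ..
  also have "\<dots> dvd N"
  proof (rule prod_primes_dvd)
    show "finite (\<Union>d\<in>{1..a}. \<Lambda> d)"
      by (simp add: \<Lambda>_def)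
    show "prime_elem l" if "l \<in> (\<Union>d\<in>{1..a}. \<Lambda> d)" for l
      using that prime by (force simp: \<Lambda>_def)
    show "l = l'" if ll: "l \<in> (\<Union>d\<in>{1..a}. \<Lambda> d)" "l' \<in> (\<Union>d\<in>{1..a}. \<Lambda> d)" "l dvd l'" for l l'
    proof -
      obtain d d' w w' where "l = mvar d + w" "w \<in> lspan d" "l' = mvar d' + w'" "w' \<in> lspan d'"
        using ll(1,2) unfolding \<Lambda>_def by blast
      then show ?thesis
        using uniq ll(3) by blast
    qed
    fix l assume "l \<in> (\<Union>d\<in>{1..a}. \<Lambda> d)"
    then obtain d c where dc: "1 \<le> d" "d \<le> a" "l = mvar d + lincomb c d"
      by (auto simp: \<Lambda>_def lspan_def)
    then show "l dvd N"
      using assms[OF dc(1,2)] dvd_linear_form_iff[OF mvars_lincomb] by metis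
  qed
  finally show ?thesis .
qed

end

section \<open>Delta operators on polynomials\<close>

text \<open>The renaming has a left inverse that closes the gap at \<open>d\<close>.\<close>

lemma subst_skip_var_eq_0_iff:
  "subst (\<lambda>j. mvar (skip_var d j)) P = 0 \<longleftrightarrow> P = (0 :: 'a::comm_ring_1 mpoly)"
proof
  assume "subst (\<lambda>j. mvar (skip_var d j)) P = 0"
  then have "subst (\<lambda>j. mvar (if j < d then j else j - 1)) (subst (\<lambda>j. mvar (skip_var d j)) P) = 0"
    by simp
  moreover have "subst (\<lambda>j. mvar (if j < d then j else j - 1)) (subst (\<lambda>j. mvar (skip_var d j)) P) = subst mvar P"
    unfolding subst_subst by (intro subst_cong) (auto simp: skip_var_def)
  ultimately show "P = 0"
    by simp
qed simp

context prime_field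
begin

text \<open>\<open>num b a f mvar\<close> is the numerator determinant of \<open>\<delta>\<^bsub>a;b\<^esub> f\<close>, expanded along its last row; a general
  \<open>\<xi>\<close> evaluates it at a point.\<close>
definition num :: "nat \<Rightarrow> nat \<Rightarrow> 'a mpoly \<Rightarrow> (nat \<Rightarrow> 'a mpoly) \<Rightarrow> 'a mpoly" where
  "num b a f \<xi> = (\<Sum>i\<in>{1..a}. (- 1) ^ (a + i) * (\<xi> i ^ (q ^ b) * subst (\<lambda>j. \<xi> (skip_var i j)) f)
      * moore (a - 1) (\<lambda>j. \<xi> (skip_var i j)))"

definition syzygy :: "nat \<Rightarrow> (nat \<Rightarrow> 'a) \<Rightarrow> (nat \<Rightarrow> 'a mpoly) \<Rightarrow> bool" where
  "syzygy a c \<xi> \<longleftrightarrow> (\<Sum>i\<in>{1..a}. mconst (c i) * \<xi> i) = 0"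

definition compat_sum :: "nat \<Rightarrow> nat \<Rightarrow> 'a mpoly \<Rightarrow> (nat \<Rightarrow> 'a) \<Rightarrow> (nat \<Rightarrow> 'a mpoly) \<Rightarrow> 'a mpoly" where
  "compat_sum b a f c \<xi> = (\<Sum>i\<in>{1..a}. mconst (c i) * \<xi> i ^ (q ^ b) * subst (\<lambda>j. \<xi> (skip_var i j)) f)"

text \<open>The points \<xi> range over arbitrary polynomials, not just variables. The condition can
  then be applied to deformed points, as in \<open>compat_transv_dvd\<close>, while
  \<open>compatI\<close> reduces its proof to generic points, where the relevant minors are
  nonzero.\<close>

definition compat :: "nat \<Rightarrow> nat \<Rightarrow> 'a mpoly \<Rightarrow> bool" where
  "compat b a f \<longleftrightarrow> (\<forall>\<xi> c. syzygy a c \<xi> \<longrightarrow> compat_sum b a f c \<xi> = 0)"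

text \<open>The generic point of the hyperplane \<open>\<Sum>\<^bsub>i\<le>a\<^esub> c\<^sub>i x\<^sub>i = 0\<close>, solved for \<open>x\<^sub>d\<close>.\<close>
definition gen_pt :: "nat \<Rightarrow> (nat \<Rightarrow> 'a) \<Rightarrow> nat \<Rightarrow> nat \<Rightarrow> 'a mpoly" where
  "gen_pt a c d = mvar(d := - (mconst (inverse (c d)) * (\<Sum>i\<in>{1..a} - {d}. mconst (c i) * mvar i)))"

lemma subst_num: "subst \<eta> (num b a f \<xi>) = num b a f (\<lambda>i. subst \<eta> (\<xi> i))"
  by (simp add: num_def subst.hom_sum subst.hom_mult subst.hom_power subst.hom_uminus subst_subst subst_moore)

lemma num_add: "num b a (f + g) \<xi> = num b a f \<xi> + num b a g \<xi>"
  by (simp add: num_def subst.hom_add distrib_left distrib_right sum.distrib)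

lemma num_diff: "num b a (f - g) \<xi> = num b a f \<xi> - num b a g \<xi>"
  by (simp add: num_def subst.hom_minus left_diff_distrib right_diff_distrib sum_subtractf)

lemma gen_pt_skip: "gen_pt a c d (skip_var d j) = mvar (skip_var d j)"
  by (simp add: gen_pt_def skip_var_def)

lemma syzygy_gen_pt:
  assumes "d \<in> {1..a}" "c d \<noteq> 0"
  shows "syzygy a c (gen_pt a c d)"
proof -
  let ?s = "\<Sum>i\<in>{1..a} - {d}. mconst (c i) * mvar i"
  have "(\<Sum>i\<in>{1..a}. mconst (c i) * gen_pt a c d i) =
      mconst (c d) * gen_pt a c d d + (\<Sum>i\<in>{1..a} - {d}. mconst (c i) * gen_pt a c d i)"
    using assms by (simp add: sum.remove)
  also have "(\<Sum>i\<in>{1..a} - {d}. mconst (c i) * gen_pt a c d i) = ?s"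
    by (intro sum.cong) (auto simp: gen_pt_def)
  also have "mconst (c d) * gen_pt a c d d = - (mconst (c d * inverse (c d)) * ?s)"
    by (simp add: gen_pt_def mconst_mult mult.assoc)
  finally show ?thesis
    using assms by (simp add: syzygy_def)
qed

lemma subst_gen_pt:
  assumes "syzygy a c \<xi>" "d \<in> {1..a}" "c d \<noteq> 0"
  shows "subst \<xi> (gen_pt a c d i) = \<xi> i"
proof (cases "i = d")
  case True
  have "mconst (c d) * \<xi> d + (\<Sum>i\<in>{1..a} - {d}. mconst (c i) * \<xi> i) = 0"
    using assms(1,2) unfolding syzygy_def by (simp add: sum.remove)
  then have *: "(\<Sum>i\<in>{1..a} - {d}. mconst (c i) * \<xi> i) = - (mconst (c d) * \<xi> d)"
    by (simp add: eq_neg_iff_add_eq_0 add.commute)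
  have "subst \<xi> (gen_pt a c d d) = - (mconst (inverse (c d)) * (\<Sum>i\<in>{1..a} - {d}. mconst (c i) * \<xi> i))"
    by (simp add: gen_pt_def subst.hom_uminus subst.hom_mult subst.hom_sum)
  also have "\<dots> = mconst (inverse (c d) * c d) * \<xi> d"
    unfolding * by (simp add: mconst_mult mult.assoc)
  finally show ?thesis
    using assms True by simp
qed (simp add: gen_pt_def)

lemma subst_compat_sum:
  "subst \<eta> (compat_sum b a f c \<xi>) = compat_sum b a f c (\<lambda>i. subst \<eta> (\<xi> i))"
  by (simp add: compat_sum_def subst.hom_sum subst.hom_mult subst.hom_power subst_subst)

text \<open>Every solution of the syzygy specializes the generic one, and if all coefficients vanish
  the sum is trivially 0.\<close>

lemma compatI:
  assumes "\<And>c d. d \<in> {1..a} \<Longrightarrow> c d \<noteq> 0 \<Longrightarrow> compat_sum b a f c (gen_pt a c d) = 0"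
  shows "compat b a f"
  unfolding compat_def
proof (intro allI impI)
  fix \<xi> c assume syz: "syzygy a c \<xi>"
  show "compat_sum b a f c \<xi> = 0"
  proof (cases "\<exists>d\<in>{1..a}. c d \<noteq> 0")
    case True
    then obtain d where d: "d \<in> {1..a}" "c d \<noteq> 0"
      by blast
    have "compat_sum b a f c \<xi> = subst \<xi> (compat_sum b a f c (gen_pt a c d))"
      unfolding subst_compat_sum using subst_gen_pt[OF syz d] by simp
    then show ?thesis
      using assms[of d c] d by simp
  qed (auto simp: compat_sum_def)
qed

lemma compatD: "compat b a f \<Longrightarrow> syzygy a c \<xi> \<Longrightarrow> compat_sum b a f c \<xi> = 0"
  by (simp add: compat_def)

lemma syzygy_Suc_upd: "syzygy (Suc a) (c(Suc a := 0)) \<xi> \<longleftrightarrow> syzygy a c \<xi>"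
proof -
  have "(\<Sum>i\<in>{1..a}. mconst ((c(Suc a := 0)) i) * \<xi> i) = (\<Sum>i\<in>{1..a}. mconst (c i) * \<xi> i)"
    by (intro sum.cong) auto
  then show ?thesis
    by (simp add: syzygy_def)
qed

lemma compat_sum_Suc_upd: "compat_sum b (Suc a) f (c(Suc a := 0)) \<xi> = compat_sum b a f c \<xi>"
proof -
  have "compat_sum b a f (c(Suc a := 0)) \<xi> = compat_sum b a f c \<xi>"
    unfolding compat_sum_def by (intro sum.cong) auto
  then show ?thesis
    by (simp add: compat_sum_def)
qed

text \<open>A syzygy of length \<open>a\<close> is one of length \<open>a + 1\<close> whose last
  coefficient is 0.\<close>

lemma compat_Suc_D:
  assumes "compat b (Suc a) f"
  shows "compat b a f"
  using assms unfolding compat_def by (metis syzygy_Suc_upd compat_sum_Suc_upd)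

lemma compat_mono: "a' \<le> a \<Longrightarrow> compat b a f \<Longrightarrow> compat b a' f"
  by (induction rule: dec_induct) (auto dest: compat_Suc_D)

lemma compat_diff: "compat b a f \<Longrightarrow> compat b a g \<Longrightarrow> compat b a (f - g)"
  by (simp add: compat_def compat_sum_def subst.hom_minus right_diff_distrib sum_subtractf)

text \<open>The coordinate that was solved for is the omitted one, so the entries are distinct
  variables.\<close>

lemma moore_gen_pt_nonzero: "moore a (\<lambda>j. gen_pt a' c d (skip_var d j)) \<noteq> 0"
  unfolding gen_pt_skip using subst_skip_var_eq_0_iff[of d "moore a mvar :: 'a mpoly"] moore_nonzero[of a]
  by (simp add: subst_moore)

lemma syzygy_cramer:
  assumes "syzygy (Suc a) c \<xi>" "i \<in> {1..Suc a}" "d \<in> {1..Suc a}"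
  shows "mconst (c d) * (- 1) ^ i * moore a (\<lambda>j. \<xi> (skip_var i j)) =
         mconst (c i) * (- 1) ^ d * moore a (\<lambda>j. \<xi> (skip_var d j))"
  using assms unfolding syzygy_def by (rule moore_cramer)

text \<open>V_a takes the same value at all points \<xi> without \<xi>_i for which c_i is nonzero,
  so its powers factor out of the sum. Indeed V_a is a quotient of Moore determinants of orders
  \<open>a\<close> and \<open>a - 1\<close>, and by Cramer's rule both change by the same factor
  when \<open>i\<close> changes.\<close>

lemma compat_muiV:
  assumes "compat b a h"
  shows "compat b a (muiV a ^ j * h)"
proof (cases a)
  case 0
  then show ?thesis
    by (simp add: compat_def compat_sum_def)
next
  case (Suc a')
  show ?thesis
  proof (rule compatI)
    fix c d assume d: "d \<in> {1..a}" "c d \<noteq> (0::'a)"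
    let ?\<xi> = "gen_pt a c d"
    have syz: "syzygy (Suc a') c ?\<xi>"
      using d unfolding Suc by (rule syzygy_gen_pt)
    \<comment> \<open>Padding the relation by a zero coefficient gives Cramer's rule for minors of
      order \<open>a\<close>, one more than \<open>syz\<close> does.\<close>
    then have syz': "syzygy (Suc a) (c(Suc a := 0)) ?\<xi>"
      by (simp only: syzygy_Suc_upd Suc)
    have V: "subst \<xi> (muiV a) * moore a' \<xi> = moore a \<xi>" for \<xi> :: "nat \<Rightarrow> 'a mpoly"
      unfolding moore_subst[of _ \<xi>] Suc moore_Suc by (simp add: subst.hom_mult mult.commute)
    have eq: "subst (\<lambda>j. ?\<xi> (skip_var i j)) (muiV a) = subst (\<lambda>j. ?\<xi> (skip_var d j)) (muiV a)"
      if i: "i \<in> {1..a}" "c i \<noteq> 0" for i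
    proof -
      let ?V = "\<lambda>i. subst (\<lambda>j. ?\<xi> (skip_var i j)) (muiV a)"
      let ?m = "\<lambda>i. moore a' (\<lambda>j. ?\<xi> (skip_var i j))"
      let ?M = "\<lambda>i. moore a (\<lambda>j. ?\<xi> (skip_var i j))"
      have "mconst (c i) * (- 1) ^ d * ?m d * ?V i = mconst (c d) * (- 1) ^ i * (?V i * ?m i)"
        using syzygy_cramer[OF syz, of i d] i d Suc by (simp add: mult_ac)
      also have "\<dots> = mconst (c d) * (- 1) ^ i * ?M i"
        by (simp only: V)
      also have "\<dots> = mconst (c i) * (- 1) ^ d * ?M d"
        using syzygy_cramer[OF syz', of i d] i d by simp
      also have "\<dots> = mconst (c i) * (- 1) ^ d * (?V d * ?m d)"
        by (simp only: V)
      finally have "(mconst (c i) * (- 1) ^ d * ?m d) * (?V i - ?V d) = 0"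
        by (simp add: algebra_simps)
      then show ?thesis
        using i moore_gen_pt_nonzero by simp
    qed
    have "compat_sum b a (muiV a ^ j * h) c ?\<xi> = subst (\<lambda>j. ?\<xi> (skip_var d j)) (muiV a) ^ j * compat_sum b a h c ?\<xi>"
      unfolding compat_sum_def sum_distrib_left
    proof (rule sum.cong[OF refl])
      fix i assume "i \<in> {1..a}"
      then show "mconst (c i) * ?\<xi> i ^ (q ^ b) * subst (\<lambda>j. ?\<xi> (skip_var i j)) (muiV a ^ j * h) =
          subst (\<lambda>j. ?\<xi> (skip_var d j)) (muiV a) ^ j * (mconst (c i) * ?\<xi> i ^ (q ^ b) * subst (\<lambda>j. ?\<xi> (skip_var i j)) h)"
        using eq[of i] by (cases "c i = 0") (simp_all add: subst.hom_mult subst.hom_power mult_ac)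
    qed
    then show "compat_sum b a (muiV a ^ j * h) c ?\<xi> = 0"
      using compatD[OF assms syzygy_gen_pt] d by simp
  qed
qed

text \<open>Arbitrary if the numerator is not divisible by the Moore determinant, which cannot happen under
  \<open>compat b a f\<close>.\<close>
definition dl :: "nat \<Rightarrow> nat \<Rightarrow> 'a mpoly \<Rightarrow> 'a mpoly" where
  "dl b a f = (SOME g. moore a mvar * g = num b a f mvar)"

text \<open>On the hyperplane where a factor of the Moore determinant vanishes, the minors are up to
  sign proportional to the coefficients of the relation. The numerator then becomes a multiple of
  the compatibility sum, which is 0.\<close>

lemma dl_eq:
  assumes "compat b a f"
  shows "moore a mvar * dl b a f = num b a f mvar"
proof -
  have "moore a mvar dvd num b a f mvar"
  proof (rule moore_dvdI)
    fix d and c :: "nat \<Rightarrow> 'a"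
    assume d: "1 \<le> d" "d \<le> a"
    define \<xi> where "\<xi> = mvar(d := - lincomb c d)"
    \<comment> \<open>The relation x_d + w = 0, padded by zeros to length \<open>a\<close>; its
      coefficient 1 at \<open>d\<close> makes Cramer's rule express all minors by the one at
      \<open>d\<close>.\<close>
    define c' where "c' i = (if i < d then c i else if i = d then 1 else 0)" for i
    obtain a' where a: "a = Suc a'"
      using d by (cases a) auto
    have "(\<Sum>i\<in>{1..a}. mconst (c' i) * \<xi> i) = (\<Sum>i\<in>insert d {1..<d}. mconst (c' i) * \<xi> i)"
      using d by (intro sum.mono_neutral_right) (auto simp: c'_def)
    also have "\<dots> = \<xi> d + (\<Sum>i\<in>{1..<d}. mconst (c' i) * \<xi> i)"
      by (simp add: c'_def)
    also have "(\<Sum>i\<in>{1..<d}. mconst (c' i) * \<xi> i) = lincomb c d"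
      unfolding lincomb_def by (intro sum.cong) (auto simp: c'_def \<xi>_def)
    finally have syz: "syzygy (Suc a') c' \<xi>"
      by (simp add: syzygy_def \<xi>_def flip: a)
    have "num b a f \<xi> = (- 1) ^ (a + d) * moore a' (\<lambda>j. \<xi> (skip_var d j)) * compat_sum b a f c' \<xi>"
      unfolding num_def compat_sum_def sum_distrib_left
    proof (rule sum.cong[OF refl])
      fix i assume i: "i \<in> {1..a}"
      have "(- 1) ^ i * moore a' (\<lambda>j. \<xi> (skip_var i j)) = mconst (c' i) * (- 1) ^ d * moore a' (\<lambda>j. \<xi> (skip_var d j))"
        using syzygy_cramer[OF syz, of i d] i d a by (simp add: c'_def)
      then have "(- 1) ^ a * (\<xi> i ^ (q ^ b) * subst (\<lambda>j. \<xi> (skip_var i j)) f) * ((- 1) ^ i * moore a' (\<lambda>j. \<xi> (skip_var i j))) =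
        (- 1) ^ a * (\<xi> i ^ (q ^ b) * subst (\<lambda>j. \<xi> (skip_var i j)) f) * (mconst (c' i) * (- 1) ^ d * moore a' (\<lambda>j. \<xi> (skip_var d j)))"
        by simp
      then show "(- 1) ^ (a + i) * (\<xi> i ^ (q ^ b) * subst (\<lambda>j. \<xi> (skip_var i j)) f) * moore (a - 1) (\<lambda>j. \<xi> (skip_var i j)) =
        (- 1) ^ (a + d) * moore a' (\<lambda>j. \<xi> (skip_var d j)) *
          (mconst (c' i) * \<xi> i ^ (q ^ b) * subst (\<lambda>j. \<xi> (skip_var i j)) f)"
        by (simp add: power_add a mult_ac)
    qed
    also have "compat_sum b a f c' \<xi> = 0"
      using assms syz unfolding a by (rule compatD)
    finally show "subst (mvar(d := - lincomb c d)) (num b a f mvar) = 0"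
      by (simp add: subst_num \<xi>_def)
  qed
  then obtain g where "moore a mvar * g = num b a f mvar"
    by (metis dvdE)
  then show ?thesis
    unfolding dl_def by (rule someI)
qed

lemma dl_unique: "moore a mvar * g = num b a f mvar \<Longrightarrow> dl b a f = g"
proof -
  assume g: "moore a mvar * g = num b a f mvar"
  then have "moore a mvar * dl b a f = num b a f mvar"
    unfolding dl_def by (rule someI)
  then show ?thesis
    using g moore_nonzero by (metis mult_left_cancel)
qed

lemma dl_at:
  assumes "compat b a f"
  shows "moore a \<xi> * subst \<xi> (dl b a f) = num b a f \<xi>"
  using arg_cong[OF dl_eq[OF assms], of "subst \<xi>"] by (simp add: subst.hom_mult subst_moore subst_num)

text \<open>Removing \<open>\<xi>\<^sub>i\<close> and then position \<open>k \<ge> i\<close> is removing \<open>\<xi>\<^bsub>k+1\<^esub>\<close> and then position \<open>i\<close>, with the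
  opposite sign.\<close>
lemma alternating_double_sum:
  fixes \<xi> :: "nat \<Rightarrow> 'a mpoly"
  shows "(\<Sum>i\<in>{1..Suc a}. (- 1) ^ i * \<xi> i ^ (q ^ b) * num b a f (\<lambda>j. \<xi> (skip_var i j))) = 0"
proof -
  define T where "T i k = (- 1) ^ (i + k) * (\<xi> i ^ (q ^ b) * \<xi> (skip_var i k) ^ (q ^ b)
     * subst (\<lambda>j. \<xi> (skip_var i (skip_var k j))) f * moore (a - 1) (\<lambda>j. \<xi> (skip_var i (skip_var k j))))" for i k
  let ?A = "{(i,k). 1 \<le> i \<and> i \<le> k \<and> k \<le> a}" and ?B = "{(i,k). 1 \<le> k \<and> k < i \<and> i \<le> Suc a}"
  have fin: "finite ?A" "finite ?B"
    by (rule finite_subset[of _ "{1..Suc a} \<times> {1..Suc a}"]; force)+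
  have anti: "T (Suc k) i = - T i k" if "i \<le> k" for i k
  proof -
    have *: "skip_var (Suc k) (skip_var i j) = skip_var i (skip_var k j)" for j
      using that by (auto simp: skip_var_def)
    show ?thesis
      unfolding T_def * using that by (simp add: skip_var_def add.commute mult_ac)
  qed
  have "(\<Sum>i\<in>{1..Suc a}. (- 1) ^ i * \<xi> i ^ (q ^ b) * num b a f (\<lambda>j. \<xi> (skip_var i j))) =
      (- 1) ^ a * (\<Sum>i\<in>{1..Suc a}. \<Sum>k\<in>{1..a}. T i k)"
    unfolding num_def T_def by (simp add: sum_distrib_left power_add mult_ac del: sum.cl_ivl_Suc)
  also have "(\<Sum>i\<in>{1..Suc a}. \<Sum>k\<in>{1..a}. T i k) = (\<Sum>(i,k)\<in>{1..Suc a} \<times> {1..a}. T i k)"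
    by (simp add: sum.cartesian_product)
  also have "{1..Suc a} \<times> {1..a} = ?A \<union> ?B"
    by auto
  also have "(\<Sum>(i,k)\<in>?A \<union> ?B. T i k) = (\<Sum>(i,k)\<in>?A. T i k) + (\<Sum>(i,k)\<in>?B. T i k)"
    using fin by (intro sum.union_disjoint) auto
  also have "(\<Sum>(i,k)\<in>?B. T i k) = (\<Sum>(i,k)\<in>?A. T (Suc k) i)"
    by (rule sum.reindex_bij_witness[of _ "\<lambda>(i,k). (Suc k, i)" "\<lambda>(i,k). (k, i - 1)"]) auto
  also have "\<dots> = (\<Sum>(i,k)\<in>?A. - T i k)"
    by (intro sum.cong) (auto simp: anti)
  also have "(\<Sum>(i,k)\<in>?A. T i k) + \<dots> = 0"
    by (simp add: case_prod_unfold sum_negf)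
  finally show ?thesis
    by simp
qed

lemma compat_dl:
  assumes "compat b a f"
  shows "compat b (Suc a) (dl b a f)"
proof (rule compatI)
  fix c d assume d: "d \<in> {1..Suc a}" "c d \<noteq> (0::'a)"
  let ?\<xi> = "gen_pt (Suc a) c d" and ?g = "dl b a f"
  let ?m = "\<lambda>i. moore a (\<lambda>j. ?\<xi> (skip_var i j))"
  have syz: "syzygy (Suc a) c ?\<xi>"
    using d by (rule syzygy_gen_pt)
  \<comment> \<open>Multiplication by the minor at \<open>d\<close> trades c_i for the minor at
    \<open>i\<close>, and this is exactly the denominator of the value of \<delta>f in the i-th
    term.\<close>
  have "(- 1) ^ d * ?m d * compat_sum b (Suc a) ?g c ?\<xi> =
      (\<Sum>i\<in>{1..Suc a}. mconst (c d) * ((- 1) ^ i * ?\<xi> i ^ (q ^ b) * num b a f (\<lambda>j. ?\<xi> (skip_var i j))))"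
    unfolding compat_sum_def sum_distrib_left
  proof (rule sum.cong[OF refl])
    fix i assume i: "i \<in> {1..Suc a}"
    have "(- 1) ^ d * ?m d * (mconst (c i) * ?\<xi> i ^ (q ^ b) * subst (\<lambda>j. ?\<xi> (skip_var i j)) ?g) =
        (mconst (c i) * (- 1) ^ d * ?m d) * (?\<xi> i ^ (q ^ b) * subst (\<lambda>j. ?\<xi> (skip_var i j)) ?g)"
      by (simp only: mult_ac)
    also have "\<dots> = (mconst (c d) * (- 1) ^ i * ?m i) * (?\<xi> i ^ (q ^ b) * subst (\<lambda>j. ?\<xi> (skip_var i j)) ?g)"
      by (simp only: syzygy_cramer[OF syz i d(1)])
    also have "\<dots> = mconst (c d) * ((- 1) ^ i * ?\<xi> i ^ (q ^ b) * (?m i * subst (\<lambda>j. ?\<xi> (skip_var i j)) ?g))"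
      by (simp only: mult_ac)
    finally show "(- 1) ^ d * ?m d * (mconst (c i) * ?\<xi> i ^ (q ^ b) * subst (\<lambda>j. ?\<xi> (skip_var i j)) ?g) =
        mconst (c d) * ((- 1) ^ i * ?\<xi> i ^ (q ^ b) * num b a f (\<lambda>j. ?\<xi> (skip_var i j)))"
      by (simp only: dl_at[OF assms])
  qed
  also have "\<dots> = 0"
    unfolding sum_distrib_left[symmetric] alternating_double_sum by simp
  finally show "compat_sum b (Suc a) ?g c ?\<xi> = 0"
    using moore_gen_pt_nonzero by simp
qed

definition transv :: "nat \<Rightarrow> 'a \<Rightarrow> nat \<Rightarrow> 'a mpoly" where
  "transv s c = mvar(s := mvar s + mconst c * mvar (s - 1))"

lemma compat_transv_dvd:
  assumes "compat b (Suc s) h" "2 \<le> s"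
  shows "mvar (s - 1) ^ (q ^ b) dvd subst (transv s c) h - h"
proof -
  let ?Q = "q ^ b"
  \<comment> \<open>The variables with x_s + c x_(s-1) inserted after x_s: omitting entry
    \<open>s\<close> gives the transvected point, omitting entry \<open>Suc s\<close> the original
    one.\<close>
  define \<xi> where "\<xi> i = (if i \<le> s then mvar i else if i = Suc s then mvar s + mconst c * mvar (s - 1)
    else mvar (i - 1))" for i
  define c' where "c' i = (if i = s - 1 then c else if i = s then 1 else if i = Suc s then - 1 else 0)" for i
  have ne: "s - 1 \<noteq> s" "s - 1 \<noteq> Suc s"
    using assms(2) by auto
  have three: "(\<Sum>i\<in>{1..Suc s}. g i) = g (s - 1) + g s + g (Suc s)"
    if "\<And>i. i \<notin> {s - 1, s, Suc s} \<Longrightarrow> g i = 0" for g :: "nat \<Rightarrow> 'a mpoly"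
  proof -
    have "(\<Sum>i\<in>{1..Suc s}. g i) = (\<Sum>i\<in>{s - 1, s, Suc s}. g i)"
      using assms(2) that by (intro sum.mono_neutral_right) auto
    also have "\<dots> = g (s - 1) + g s + g (Suc s)"
      using ne by (subst sum.insert; simp)+
    finally show ?thesis .
  qed
  have "syzygy (Suc s) c' \<xi>"
    unfolding syzygy_def using ne by (subst three) (auto simp: c'_def \<xi>_def mconst_uminus)
  then have "compat_sum b (Suc s) h c' \<xi> = 0"
    using assms(1) by (rule compatD[rotated])
  then have *: "mconst c * mvar (s - 1) ^ ?Q * subst (\<lambda>j. \<xi> (skip_var (s - 1) j)) h
      + mvar s ^ ?Q * subst (\<lambda>j. \<xi> (skip_var s j)) h
      - (mvar s + mconst c * mvar (s - 1)) ^ ?Q * subst (\<lambda>j. \<xi> (skip_var (Suc s) j)) h = 0"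
    unfolding compat_sum_def using ne by (subst (asm) three) (auto simp: c'_def \<xi>_def mconst_uminus)
  have "(\<lambda>j. \<xi> (skip_var s j)) = transv s c" "(\<lambda>j. \<xi> (skip_var (Suc s) j)) = mvar"
    by (auto simp: \<xi>_def skip_var_def transv_def fun_eq_iff)
  moreover have "(mvar s + mconst c * mvar (s - 1)) ^ ?Q = mvar s ^ ?Q + mconst c * mvar (s - 1) ^ ?Q"
    by (simp add: frob_add power_mult_distrib coeff_frob_pow flip: mconst_power)
  \<comment> \<open>Frobenius splits the power of the inserted entry. What remains apart from x_s^Q
    times the difference carries the factor x_(s-1)^Q, which is coprime to x_s^Q.\<close>
  ultimately have "mvar s ^ ?Q * (subst (transv s c) h - h) =
      mvar (s - 1) ^ ?Q * (mconst c * (h - subst (\<lambda>j. \<xi> (skip_var (s - 1) j)) h))"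
    using * by (simp add: algebra_simps)
  then have "mvar (s - 1) ^ ?Q dvd mvar s ^ ?Q * (subst (transv s c) h - h)"
    by simp
  moreover have "\<not> mvar (s - 1) dvd (mvar s :: 'a mpoly) ^ ?Q"
    unfolding mvar_dvd_iff using ne by (simp add: subst.hom_power)
  ultimately show ?thesis
    using prime_elem_power_dvd_cancel[OF prime_elem_mvar] by blast
qed

end

section \<open>Invariance under simple transvections\<close>

lemma mvar_dvd_muiV: "mvar d dvd (muiV d :: 'a::{field,finite} mpoly)"
proof -
  have "(0 :: 'a mpoly) \<in> lspan d"
    unfolding lspan_def lincomb_def by (auto intro!: exI[of _ "\<lambda>_. 0"])
  then show ?thesis
    unfolding muiV_lspan by (metis add.right_neutral dvd_prodI finite_lspan)
qed

text \<open>V_d contains x_d exactly once, because the factors x_d + w with nonzero \<open>w\<close>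
  survive x_d = 0.\<close>

lemma muiV_eq_mvar_mult:
  obtains y where "muiV d = mvar d * y" "subst (mvar(d := 0)) y \<noteq> (0 :: 'a::{field,finite} mpoly)"
proof
  have 0: "(0 :: 'a mpoly) \<in> lspan d"
    unfolding lspan_def lincomb_def by (auto intro!: exI[of _ "\<lambda>_. 0"])
  let ?y = "\<Prod>w\<in>lspan d - {0}. mvar d + w :: 'a mpoly"
  show "muiV d = mvar d * ?y"
    unfolding muiV_lspan using prod.remove[OF finite_lspan 0, of "\<lambda>w. mvar d + w"] by simp
  have "subst (mvar(d := 0)) (mvar d + w) \<noteq> 0" if "w \<in> lspan d - {0}" for w :: "'a mpoly"
    using that mvars_lspan[of w d] by (simp add: subst.hom_add subst_upd_lspan)
  then show "subst (mvar(d := 0)) ?y \<noteq> 0"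
    by (simp add: subst.hom_prod prod_zero_iff)
qed

lemma subst_dvd: "P dvd Q \<Longrightarrow> subst \<xi> P dvd subst \<xi> (Q :: 'a::comm_ring_1 mpoly)"
  by (auto elim!: dvdE simp: subst.hom_mult)

context prime_field
begin

lemma dvd_moore:
  assumes "k \<in> {1..n}"
  shows "\<xi> k dvd moore n (\<xi> :: nat \<Rightarrow> 'a mpoly)"
proof -
  have "muiV k dvd (\<Prod>d\<in>{1..n}. muiV d :: 'a mpoly)"
    using assms by (intro dvd_prodI) auto
  then have "mvar k dvd (moore n mvar :: 'a mpoly)"
    unfolding moore_eq_prod using mvar_dvd_muiV dvd_trans by blast
  then have "subst \<xi> (mvar k) dvd subst \<xi> (moore n mvar)"
    by (rule subst_dvd)
  then show ?thesis
    by (simp add: subst_moore)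
qed

text \<open>The transvection permutes the factors, since translation by c x_(a-1) permutes the
  span.\<close>

lemma muiV_transv_same:
  assumes "2 \<le> a"
  shows "subst (transv a c) (muiV a) = (muiV a :: 'a mpoly)"
proof -
  define l where "l = mconst c * mvar (a - 1)"
  have shift: "w + mconst e * mvar (a - 1) \<in> lspan a" if w: "w \<in> lspan a" for w :: "'a mpoly" and e
  proof -
    obtain f where f: "w = lincomb f a"
      using w by (auto simp: lspan_def)
    have "w + mconst e * mvar (a - 1) = lincomb (f(a - 1 := f (a - 1) + e)) a"
      unfolding f using assms by (intro lincomb_upd[symmetric]) auto
    then show ?thesis
      unfolding lspan_def by blast
  qed
  have "subst (transv a c) (mvar a + w) = mvar a + (w + l)" if "w \<in> lspan a" for w
    unfolding transv_def using mvars_lspan[OF that] by (simp add: subst.hom_add subst_upd_lspan l_def add_ac)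
  then have "subst (transv a c) (muiV a) = (\<Prod>w\<in>lspan a. mvar a + (w + l))"
    unfolding muiV_lspan subst.hom_prod by (intro prod.cong) auto
  also have "\<dots> = (\<Prod>w\<in>lspan a. mvar a + w)"
    by (rule prod.reindex_bij_witness[of _ "\<lambda>w. w - l" "\<lambda>w. w + l"])
       (use shift[of _ c] shift[of _ "- c"] in \<open>auto simp: l_def mconst_uminus\<close>)
  finally show ?thesis
    by (simp add: muiV_lspan)
qed

lemma muiV_transv_greater:
  assumes "1 \<le> a" "a < s"
  shows "subst (transv s c) (muiV a) = (muiV a :: 'a mpoly)"
  unfolding transv_def using mvars_muiV[OF assms(1), where ?'a = 'a] assms(2) by (intro subst_upd_lspan) auto

text \<open>The bound \<open>i + 2 \<le> s\<close> keeps both x_(s-1) and x_s away from the omitted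
  index; for i = s - 1 the omitted variable would be the one that is added.\<close>

lemma transv_skip:
  assumes "1 \<le> i" "i + 2 \<le> s"
  shows "subst (\<lambda>j. transv s c (skip_var i j)) f = subst (\<lambda>j. mvar (skip_var i j)) (subst (transv (s - 1) c) f)"
proof -
  have "transv s c (skip_var i j) = subst (\<lambda>j. mvar (skip_var i j)) (transv (s - 1) c j)" for j
    using assms by (auto simp: transv_def skip_var_def subst.hom_add subst.hom_mult Suc_diff_Suc numeral_2_eq_2)
  then show ?thesis
    by (simp add: subst_subst)
qed

lemma compat_transv:
  assumes "compat b a h" "a < s"
  shows "compat b a (subst (transv s e) h)"
  unfolding compat_def
proof (intro allI impI)
  fix \<xi> :: "nat \<Rightarrow> 'a mpoly" and c
  assume syz: "syzygy a c \<xi>"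
  \<comment> \<open>Once an entry i \<le> a is omitted, entry \<open>Suc s\<close> of the point is
    its s-th argument. The transvection thus moves into the point, beyond the entries that the
    syzygy sees.\<close>
  define \<xi>' where "\<xi>' = \<xi>(Suc s := \<xi> (Suc s) + mconst e * \<xi> s)"
  have \<xi>': "\<xi>' i = \<xi> i" if "i \<in> {1..a}" for i
    using that assms(2) by (auto simp: \<xi>'_def)
  then have "syzygy a c \<xi>'"
    using syz by (simp add: syzygy_def)
  then have "compat_sum b a h c \<xi>' = 0"
    using assms(1) by (rule compatD[rotated])
  also have "compat_sum b a h c \<xi>' = compat_sum b a (subst (transv s e) h) c \<xi>"
    unfolding compat_sum_def
  proof (rule sum.cong[OF refl])
    fix i assume i: "i \<in> {1..a}"
    have "subst (\<lambda>j. \<xi> (skip_var i j)) (transv s e j) = \<xi>' (skip_var i j)" for j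
      using i assms(2) by (auto simp: transv_def skip_var_def \<xi>'_def subst.hom_add subst.hom_mult)
    then show "mconst (c i) * \<xi>' i ^ (q ^ b) * subst (\<lambda>j. \<xi>' (skip_var i j)) h =
        mconst (c i) * \<xi> i ^ (q ^ b) * subst (\<lambda>j. \<xi> (skip_var i j)) (subst (transv s e) h)"
      using \<xi>'[OF i] by (simp add: subst_subst)
  qed
  finally show "compat_sum b a (subst (transv s e) h) c \<xi> = 0" .
qed

text \<open>For t \<ge> a every omission of an entry i \<le> a sends x_t to the same entry
  \<open>Suc t\<close>, so the power is a common factor.\<close>

lemma compat_sum_mvar_power:
  assumes "a \<le> t"
  shows "compat_sum b a (mvar t ^ k * K) c \<xi> = \<xi> (Suc t) ^ k * compat_sum b a K c \<xi>"
  unfolding compat_sum_def sum_distrib_left using assms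
  by (intro sum.cong) (auto simp: skip_var_def subst.hom_mult subst.hom_power mult_ac)

text \<open>The power is cancelled at the generic point, where entry \<open>Suc t\<close> is still a
  variable.\<close>

lemma compat_mvar_power_mult_iff:
  assumes "a \<le> t"
  shows "compat b a (mvar t ^ k * K) \<longleftrightarrow> compat b a K"
proof
  assume *: "compat b a (mvar t ^ k * K)"
  show "compat b a K"
  proof (rule compatI)
    fix c d assume d: "d \<in> {1..a}" "c d \<noteq> (0::'a)"
    have "compat_sum b a (mvar t ^ k * K) c (gen_pt a c d) = 0"
      using * d by (intro compatD syzygy_gen_pt)
    moreover have "gen_pt a c d (Suc t) = mvar (Suc t)"
      using d assms by (auto simp: gen_pt_def)
    ultimately show "compat_sum b a K c (gen_pt a c d) = 0"
      using assms by (simp add: compat_sum_mvar_power)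
  qed
qed (use assms in \<open>auto simp: compat_def compat_sum_mvar_power\<close>)

lemma num_mvar_power:
  assumes "a \<le> t"
  shows "num b a (mvar t ^ k * K) \<xi> = \<xi> (Suc t) ^ k * num b a K \<xi>"
  unfolding num_def sum_distrib_left using assms
  by (intro sum.cong) (auto simp: skip_var_def subst.hom_mult subst.hom_power mult_ac)

text \<open>The defects \<open>f - \<sigma> f\<close> that survive later applications of \<open>\<delta>\<^bsub>a';b\<^esub>\<close>, \<open>a' \<le> a\<close>.  Membership in the ideal
  of the \<open>x\<^sub>t^(q^b)\<close> alone is not stable: \<open>\<delta>\<^bsub>2;b\<^esub>\<close> maps \<open>x\<^sub>1^(q^b+q-2)\<close> to \<open>x\<^sub>1^(q^b-1) x\<^sub>2^(q^b-1)\<close>, up to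
  sign.\<close>
inductive err :: "nat \<Rightarrow> nat \<Rightarrow> 'a mpoly \<Rightarrow> bool" for b a where
  err_zero: "err b a 0"
| err_step: "a \<le> t \<Longrightarrow> compat b a K \<Longrightarrow> err b a e \<Longrightarrow> err b a (mvar t ^ (q ^ b) * K + e)"

lemma err_mono:
  assumes "err b a e" "a' \<le> a"
  shows "err b a' e"
  using assms(1)
proof induction
  case (err_step t K e)
  then show ?case
    using compat_mono[OF assms(2)] assms(2) by (intro err.err_step) auto
qed (rule err_zero)

lemma err_muiV: "err b a e \<Longrightarrow> err b a (muiV a ^ j * e)"
proof (induction rule: err.induct)
  case (err_step t K e)
  have "err b a (mvar t ^ (q ^ b) * (muiV a ^ j * K) + muiV a ^ j * e)"
    using err_step by (intro err.err_step compat_muiV)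
  then show ?case
    by (simp add: distrib_left mult_ac)
qed (simp add: err_zero)

lemma err_if_dvd:
  assumes "mvar a ^ (q ^ b) dvd e" "compat b a e"
  shows "err b a e"
proof -
  obtain K where K: "e = mvar a ^ (q ^ b) * K"
    using assms(1) by blast
  have "err b a (mvar a ^ (q ^ b) * K + 0)"
    using assms(2) by (intro err_step err_zero) (simp_all add: K compat_mvar_power_mult_iff)
  then show ?thesis
    by (simp add: K)
qed

text \<open>\<delta> sends x_t^Q K to x_(t+1)^Q times \<delta>K, and compatibility of the cofactor K
  makes \<delta>K a polynomial of the same kind.\<close>

lemma err_dl: "err b a e \<Longrightarrow> \<exists>g. moore a mvar * g = num b a e mvar \<and> err b a g"
proof (induction rule: err.induct)
  case err_zero
  then show ?case
    by (auto intro!: exI[of _ 0] err.err_zero simp: num_def)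
next
  case (err_step t K e)
  then obtain g where g: "moore a mvar * g = num b a e mvar" "err b a g"
    by blast
  have "moore a mvar * (mvar (Suc t) ^ (q ^ b) * dl b a K + g) = num b a (mvar t ^ (q ^ b) * K + e) mvar"
    using g(1) dl_eq[OF err_step.hyps(2)] err_step.hyps(1)
    by (simp add: num_add num_mvar_power distrib_left mult.left_commute[of "moore a mvar"])
  moreover have "err b a (mvar (Suc t) ^ (q ^ b) * dl b a K + g)"
    using err_step.hyps g(2) compat_Suc_D[OF compat_dl] by (intro err.err_step) auto
  ultimately show ?case
    by blast
qed

text \<open>The invariant of the construction of Y. The clause for s = a turns into the
  \<open>err\<close> clause for s = a + 1 when \<delta> is applied
  (\<open>good_dl_boundary\<close>), or when the level drops from a + 1 to a
  (\<open>good_muiV\<close>).\<close>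

definition good :: "nat \<Rightarrow> nat \<Rightarrow> 'a mpoly \<Rightarrow> bool" where
  "good b a f \<longleftrightarrow> compat b a f
     \<and> (2 \<le> a \<longrightarrow> (\<forall>c. mvar (a - 1) ^ (q ^ b) dvd subst (transv a c) f - f))
     \<and> (\<forall>s c. a < s \<longrightarrow> err b a (f - subst (transv s c) f))"

lemma good_one: "good b a 1"
proof -
  have "compat b a 1"
    unfolding compat_def compat_sum_def syzygy_def
  proof (intro allI impI)
    fix \<xi> :: "nat \<Rightarrow> 'a mpoly" and c
    assume "(\<Sum>i = 1..a. mconst (c i) * \<xi> i) = 0"
    then show "(\<Sum>i = 1..a. mconst (c i) * \<xi> i ^ q ^ b * subst (\<lambda>j. \<xi> (skip_var i j)) 1) = 0"
      using frob_lincomb[of c \<xi> "{1..a}" b] q_gt_1 by (simp add: subst.hom_one zero_power)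
  qed
  then show ?thesis
    by (simp add: good_def subst.hom_one err_zero)
qed

text \<open>Powers of V_a are fixed by all transvections with s \<ge> a, so only \<open>h\<close>
  matters. For s = a its compatibility of length a + 1 is used, for s = a + 1 its own middle clause,
  beyond that its \<open>err\<close> clause.\<close>

lemma good_muiV:
  assumes h: "good b (Suc a) h" and a: "1 \<le> a"
  shows "good b a (muiV a ^ j * h)"
  unfolding good_def
proof (intro conjI allI impI)
  have ch: "compat b (Suc a) h"
    using h by (simp add: good_def)
  then have cha: "compat b a h"
    by (rule compat_Suc_D)
  then show "compat b a (muiV a ^ j * h)"
    by (rule compat_muiV)
  show "mvar (a - 1) ^ (q ^ b) dvd subst (transv a c) (muiV a ^ j * h) - muiV a ^ j * h" if "2 \<le> a" for c
  proof -
    have "subst (transv a c) (muiV a ^ j * h) - muiV a ^ j * h = muiV a ^ j * (subst (transv a c) h - h)"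
      using that by (simp add: subst.hom_mult subst.hom_power muiV_transv_same right_diff_distrib)
    then show ?thesis
      using compat_transv_dvd[OF ch that] by simp
  qed
  show "err b a (muiV a ^ j * h - subst (transv s c) (muiV a ^ j * h))" if "a < s" for s c
  proof -
    have "err b a (h - subst (transv s c) h)"
    proof (cases "s = Suc a")
      case True
      have "mvar a ^ (q ^ b) dvd subst (transv s c) h - h"
        using h a unfolding good_def True by (metis diff_Suc_1 Suc_le_mono one_add_one plus_1_eq_Suc)
      then have "mvar a ^ (q ^ b) dvd h - subst (transv s c) h"
        using dvd_minus_iff by (metis minus_diff_eq)
      then show ?thesis
        using cha that by (intro err_if_dvd compat_diff compat_transv)
    next
      case False
      then show ?thesis
        using h that by (intro err_mono[of b "Suc a" _ a]) (auto simp: good_def)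
    qed
    then have "err b a (muiV a ^ j * (h - subst (transv s c) h))"
      by (rule err_muiV)
    then show ?thesis
      using a that by (simp add: subst.hom_mult subst.hom_power muiV_transv_greater right_diff_distrib)
  qed
qed

lemma moore_eq_mvar_mult:
  assumes "1 \<le> a"
  obtains y where "moore a mvar = mvar a * y" "\<not> mvar a dvd (y :: 'a mpoly)"
proof -
  obtain a' where a: "a = Suc a'"
    using assms by (cases a) auto
  obtain y where y: "muiV a = mvar a * y" "subst (mvar(a := 0)) y \<noteq> (0 :: 'a mpoly)"
    by (rule muiV_eq_mvar_mult)
  have "subst (mvar(a := 0)) (moore a' mvar) = (moore a' mvar :: 'a mpoly)"
    unfolding subst_moore by (rule moore_cong) (auto simp: a)
  then have "\<not> mvar a dvd (moore a' mvar * y :: 'a mpoly)"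
    using y(2) moore_nonzero[of a'] by (simp add: mvar_dvd_iff subst.hom_mult)
  moreover have "moore a mvar = mvar a * (moore a' mvar * y)"
    using moore_Suc[of a'] y(1) by (simp add: a mult_ac)
  ultimately show ?thesis
    by (rule that[rotated])
qed

text \<open>After multiplication by the Moore determinant the difference is divisible by \<open>x\<^sub>a^(q^b+1)\<close>: for
  \<open>i < a\<close> the minor contributes the extra \<open>x\<^sub>a\<close>, for \<open>i = a\<close> the difference of values of \<open>f\<close> does.
  The determinant itself contains \<open>x\<^sub>a\<close> only once.\<close>
lemma good_dl_boundary:
  assumes f: "good b a f" and a: "1 \<le> a"
  shows "mvar a ^ (q ^ b) dvd dl b a f - subst (transv (Suc a) c) (dl b a f)"
proof -
  let ?\<sigma> = "transv (Suc a) c" and ?Q = "q ^ b" and ?g = "dl b a f"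
  have cf: "compat b a f"
    using f by (simp add: good_def)
  have \<sigma>: "?\<sigma> i = mvar i" if "i \<noteq> Suc a" for i
    using that by (simp add: transv_def)
  have "moore a ?\<sigma> = moore a mvar"
    by (rule moore_cong) (auto simp: \<sigma>)
  then have "moore a mvar * (?g - subst ?\<sigma> ?g) = num b a f mvar - num b a f ?\<sigma>"
    using dl_at[OF cf, of ?\<sigma>] dl_eq[OF cf] by (simp add: right_diff_distrib)
  also have "\<dots> = (\<Sum>i\<in>{1..a}. (- 1) ^ (a + i) * mvar i ^ ?Q * (subst (\<lambda>j. mvar (skip_var i j)) f
      - subst (\<lambda>j. ?\<sigma> (skip_var i j)) f) * moore (a - 1) (\<lambda>j. mvar (skip_var i j)))"
    unfolding num_def sum_subtractf[symmetric]
  proof (rule sum.cong[OF refl])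
    fix i assume i: "i \<in> {1..a}"
    have "moore (a - 1) (\<lambda>j. ?\<sigma> (skip_var i j)) = moore (a - 1) (\<lambda>j. mvar (skip_var i j))"
      using i by (intro moore_cong \<sigma>) (auto simp: skip_var_def)
    then show "(- 1) ^ (a + i) * (mvar i ^ ?Q * subst (\<lambda>j. mvar (skip_var i j)) f) * moore (a - 1) (\<lambda>j. mvar (skip_var i j))
      - (- 1) ^ (a + i) * (?\<sigma> i ^ ?Q * subst (\<lambda>j. ?\<sigma> (skip_var i j)) f) * moore (a - 1) (\<lambda>j. ?\<sigma> (skip_var i j))
      = (- 1) ^ (a + i) * mvar i ^ ?Q * (subst (\<lambda>j. mvar (skip_var i j)) f
      - subst (\<lambda>j. ?\<sigma> (skip_var i j)) f) * moore (a - 1) (\<lambda>j. mvar (skip_var i j))"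
      using i \<sigma>[of i] by (simp add: right_diff_distrib left_diff_distrib mult.assoc)
  qed
  also have "mvar a * mvar a ^ ?Q dvd \<dots>"
  proof (rule dvd_sum)
    fix i assume i: "i \<in> {1..a}"
    let ?D = "subst (\<lambda>j. mvar (skip_var i j)) f - subst (\<lambda>j. ?\<sigma> (skip_var i j)) f"
      and ?m = "moore (a - 1) (\<lambda>j. mvar (skip_var i j)) :: 'a mpoly"
    have "mvar a * mvar a ^ ?Q dvd mvar i ^ ?Q * ?D * ?m"
    proof (cases "i = a")
      case True
      have "mvar a dvd ?D"
        by (intro dvd_subst_diff) (auto simp: transv_def True)
      then have "mvar a ^ ?Q * mvar a dvd mvar i ^ ?Q * ?D"
        unfolding True by (intro mult_dvd_mono dvd_refl)
      then show ?thesis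
        by (simp add: mult.commute)
    next
      case False
      then have a2: "2 \<le> a" "i + 2 \<le> Suc a"
        using i by auto
      then have "mvar (a - 1) ^ ?Q dvd subst (transv a c) f - f"
        using f by (simp add: good_def)
      then have "mvar (a - 1) ^ ?Q dvd f - subst (transv a c) f"
        by (metis dvd_minus_iff minus_diff_eq)
      then have "subst (\<lambda>j. mvar (skip_var i j)) (mvar (a - 1) ^ ?Q) dvd
          subst (\<lambda>j. mvar (skip_var i j)) (f - subst (transv a c) f)"
        by (rule subst_dvd)
      moreover have "skip_var i (a - 1) = a"
        using a2 by (simp add: skip_var_def)
      ultimately have "mvar a ^ ?Q dvd ?D"
        using transv_skip[of i "Suc a" c f] i a2 by (simp add: subst.hom_power subst.hom_minus)
      moreover have "mvar a dvd ?m"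
        using dvd_moore[of "a - 1" "a - 1" "\<lambda>j. mvar (skip_var i j)"] a2 \<open>skip_var i (a - 1) = a\<close> by simp
      ultimately have "mvar a ^ ?Q * mvar a dvd ?D * ?m"
        by (rule mult_dvd_mono)
      then show ?thesis
        by (simp add: mult.assoc mult.commute[of "mvar a"])
    qed
    then show "mvar a * mvar a ^ ?Q dvd (- 1) ^ (a + i) * mvar i ^ ?Q * ?D * ?m"
      unfolding mult.assoc by (rule dvd_mult)
  qed
  finally have dvd: "mvar a * mvar a ^ ?Q dvd moore a mvar * (?g - subst ?\<sigma> ?g)" .
  obtain y where y: "moore a mvar = mvar a * y" "\<not> mvar a dvd (y :: 'a mpoly)"
    using a by (rule moore_eq_mvar_mult)
  have "mvar a ^ ?Q dvd y * (?g - subst ?\<sigma> ?g)"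
    using dvd unfolding y(1) mult.assoc by simp
  with prime_elem_mvar y(2) show ?thesis
    by (rule prime_elem_power_dvd_cancel)
qed

text \<open>For s > a + 1 the transvection passes through \<delta> and becomes the one with s - 1,
  so the defect of \<delta>f is \<delta> of a defect of f. The case s = a + 1 is
  \<open>good_dl_boundary\<close>; s = a follows from the compatibility of length a + 1 that
  \<delta> produces.\<close>

lemma good_dl:
  assumes f: "good b a f" and a: "1 \<le> a"
  shows "good b a (dl b a f)"
  unfolding good_def
proof (intro conjI allI impI)
  let ?g = "dl b a f"
  have cf: "compat b a f"
    using f by (simp add: good_def)
  then have cg: "compat b (Suc a) ?g"
    by (rule compat_dl)
  then show cga: "compat b a ?g"
    by (rule compat_Suc_D)
  show "mvar (a - 1) ^ (q ^ b) dvd subst (transv a c) ?g - ?g" if "2 \<le> a" for c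
    using cg that by (rule compat_transv_dvd)
  show "err b a (?g - subst (transv s c) ?g)" if s: "a < s" for s c
  proof (cases "s = Suc a")
    case True
    then show ?thesis
      using good_dl_boundary[OF f a] cga s by (intro err_if_dvd compat_diff compat_transv) auto
  next
    case False
    then have s2: "a < s - 1"
      using s by auto
    have "num b a f (transv s c) = num b a (subst (transv (s - 1) c) f) mvar"
      unfolding num_def
    proof (rule sum.cong[OF refl])
      fix i assume i: "i \<in> {1..a}"
      have "moore (a - 1) (\<lambda>j. transv s c (skip_var i j)) = moore (a - 1) (\<lambda>j. mvar (skip_var i j))"
        using i s by (intro moore_cong) (auto simp: skip_var_def transv_def)
      moreover have i2: "1 \<le> i" "i + 2 \<le> s"
        using i s2 by auto
      moreover have "transv s c i = mvar i"
        using i s by (simp add: transv_def)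
      ultimately show "(- 1) ^ (a + i) * (transv s c i ^ (q ^ b) * subst (\<lambda>j. transv s c (skip_var i j)) f)
          * moore (a - 1) (\<lambda>j. transv s c (skip_var i j)) =
        (- 1) ^ (a + i) * (mvar i ^ (q ^ b) * subst (\<lambda>j. mvar (skip_var i j)) (subst (transv (s - 1) c) f))
          * moore (a - 1) (\<lambda>j. mvar (skip_var i j))"
        using transv_skip[of i s c f] i2 by simp
    qed
    moreover have "moore a (transv s c) = moore a mvar"
      using s by (intro moore_cong) (auto simp: transv_def)
    ultimately have *: "moore a mvar * (?g - subst (transv s c) ?g) = num b a (f - subst (transv (s - 1) c) f) mvar"
      using dl_at[OF cf, of "transv s c"] dl_eq[OF cf] by (simp add: right_diff_distrib num_diff)
    have "err b a (f - subst (transv (s - 1) c) f)"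
      using f s2 by (simp add: good_def)
    then obtain g where g: "moore a mvar * g = num b a (f - subst (transv (s - 1) c) f) mvar" "err b a g"
      using err_dl by blast
    then have "?g - subst (transv s c) ?g = g"
      using * moore_nonzero by (metis mult_left_cancel)
    then show ?thesis
      using g(2) by simp
  qed
qed

section \<open>The polynomials Y and their variables\<close>

fun ypoly :: "nat \<Rightarrow> nat \<Rightarrow> (nat \<times> nat) list \<Rightarrow> 'a mpoly" where
  "ypoly b t [] = 1"
| "ypoly b t ((i, j) # r) = (dl b t ^^ i) (muiV t ^ j * ypoly b (Suc t) r)"

lemma good_funpow_dl: "good b a f \<Longrightarrow> 1 \<le> a \<Longrightarrow> good b a ((dl b a ^^ i) f)"
  by (induction i) (auto intro: good_dl)

lemma good_ypoly: "1 \<le> t \<Longrightarrow> good b t (ypoly b t l)"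
proof (induction b t l rule: ypoly.induct)
  case (2 b t i j r)
  then show ?case
    by (auto intro!: good_funpow_dl good_muiV)
qed (simp add: good_one)

lemma mvars_dl:
  assumes "compat b a f" "mvars f \<subseteq> {1..k}" "a \<le> Suc k"
  shows "mvars (dl b a f) \<subseteq> {1..Suc k}"
proof -
  \<comment> \<open>Sets all variables outside the range to 0. Numerator and Moore determinant do
    not change, hence neither does their quotient.\<close>
  define \<zeta> where "\<zeta> i = (if i \<in> {1..Suc k} then mvar i else 0 :: 'a mpoly)" for i
  have "moore a \<zeta> = moore a mvar"
    using assms(3) by (intro moore_cong) (auto simp: \<zeta>_def)
  moreover have "num b a f \<zeta> = num b a f mvar"
    unfolding num_def
  proof (rule sum.cong[OF refl])
    fix i assume i: "i \<in> {1..a}"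
    have "subst (\<lambda>j. \<zeta> (skip_var i j)) f = subst (\<lambda>j. mvar (skip_var i j)) f"
      using assms(2) by (intro subst_cong) (auto simp: \<zeta>_def skip_var_def)
    moreover have "moore (a - 1) (\<lambda>j. \<zeta> (skip_var i j)) = moore (a - 1) (\<lambda>j. mvar (skip_var i j))"
      using assms(3) i by (intro moore_cong) (auto simp: \<zeta>_def skip_var_def)
    ultimately show "(- 1) ^ (a + i) * (\<zeta> i ^ q ^ b * subst (\<lambda>j. \<zeta> (skip_var i j)) f) * moore (a - 1) (\<lambda>j. \<zeta> (skip_var i j)) =
         (- 1) ^ (a + i) * (mvar i ^ q ^ b * subst (\<lambda>j. mvar (skip_var i j)) f) * moore (a - 1) (\<lambda>j. mvar (skip_var i j))"
      using i assms(3) by (simp add: \<zeta>_def)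
  qed
  ultimately have "moore a mvar * subst \<zeta> (dl b a f) = moore a mvar * dl b a f"
    using dl_at[OF assms(1), of \<zeta>] dl_eq[OF assms(1)] by simp
  then have "subst \<zeta> (dl b a f) = dl b a f"
    using moore_nonzero by simp
  moreover have "mvars (subst \<zeta> (dl b a f)) \<subseteq> {1..Suc k}"
    by (rule order.trans[OF mvars_subst]) (auto simp: \<zeta>_def split: if_splits)
  ultimately show ?thesis
    by simp
qed

lemma mvars_ypoly:
  "1 \<le> t \<Longrightarrow> mvars (ypoly b t l) \<subseteq> {1..t - 1 + length l + sum_list (map fst l)}"
proof (induction b t l rule: ypoly.induct)
  case (2 b t i j r)
  define f where "f = muiV t ^ j * ypoly b (Suc t) r"
  define k where "k = t + length r + sum_list (map fst r)"
  have "mvars (muiV t ^ j :: 'a mpoly) \<subseteq> {1..k}"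
    by (rule order.trans[OF mvars_power]) (use mvars_muiV[OF 2(2), where ?'a = 'a] in \<open>auto simp: k_def\<close>)
  moreover have "mvars (ypoly b (Suc t) r) \<subseteq> {1..k}"
    using 2 by (simp add: k_def)
  ultimately have f: "mvars f \<subseteq> {1..k}"
    unfolding f_def by (intro order.trans[OF mvars_mult]) auto
  have gf: "good b t f"
    unfolding f_def using 2(2) by (intro good_muiV good_ypoly) auto
  have "mvars ((dl b t ^^ i) f) \<subseteq> {1..k + i}"
  proof (induction i)
    case (Suc i)
    have "compat b t ((dl b t ^^ i) f)"
      using good_funpow_dl[OF gf 2(2)] by (simp add: good_def)
    then have "mvars (dl b t ((dl b t ^^ i) f)) \<subseteq> {1..Suc (k + i)}"
      using Suc by (rule mvars_dl) (simp add: k_def)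
    then show ?case
      by simp
  qed (use f in simp)
  moreover have "t - 1 + length ((i, j) # r) + sum_list (map fst ((i, j) # r)) = k + i"
    using 2(2) by (simp add: k_def)
  ultimately show ?case
    unfolding f_def ypoly.simps by (simp only:)
qed simp

end

section \<open>Comparison with the rational functions of the statement\<close>

interpretation Fract_one: comm_ring_hom "\<lambda>P::'a::idom. Fract P 1"
  by unfold_locales (simp_all add: Zero_fract_def One_fract_def)

lemma Fract_one_eq_iff [simp]: "Fract P 1 = Fract Q 1 \<longleftrightarrow> P = (Q :: 'a::idom)"
  by (simp add: eq_fract)

lemma meval_rconst: "meval rconst (\<lambda>j. Fract (\<eta> j) 1) P = Fract (subst \<eta> P) 1"
proof (induction P rule: mpoly_induct)
  case (const c)
  then show ?case
    using rconst.meval_single[of _ 0 c] by (simp add: mconst_def[of c, symmetric] rconst_def[of c])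
next
  case (var i)
  have "meval rconst s (mvar i) = s i" for s :: "nat \<Rightarrow> 'a ratfun"
    unfolding mvar_def rconst.meval_single by simp
  then show ?case
    by simp
next
  case (add P Q)
  then show ?case
    by (simp only: rconst.meval_add subst.hom_add Fract_one.hom_add)
next
  case (mult P Q)
  then show ?case
    by (simp only: rconst.meval_mult subst.hom_mult Fract_one.hom_mult)
qed

text \<open>\<open>ratfun_subst\<close> chooses some representing fraction. Every fraction a / b
  equal to P has a = P b, and b stays nonzero because the renaming is injective.\<close>

lemma omit_Fract: "omit (Fract P 1) i = Fract (subst (\<lambda>j. mvar (skip_var i j)) P) (1 :: 'a::idom mpoly)"
  unfolding omit_def ratfun_subst_def
proof (rule some_equality)
  let ?s = "\<lambda>j. rvar (skip_var i j) :: 'a ratfun" and ?S = "subst (\<lambda>j. mvar (skip_var i j)) :: 'a mpoly \<Rightarrow> _"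
  have s: "meval rconst ?s A = Fract (?S A) 1" for A :: "'a mpoly"
    by (simp add: rvar_def meval_rconst)
  show "\<exists>a b. b \<noteq> 0 \<and> Fract P 1 = Fract a b \<and> Fract (?S P) 1 = meval rconst ?s a / meval rconst ?s b"
    by (rule exI[of _ P], rule exI[of _ 1]) (simp add: s subst.hom_one Fract_one.hom_one)
  fix r assume "\<exists>a b. b \<noteq> 0 \<and> Fract P 1 = Fract a b \<and> r = meval rconst ?s a / meval rconst ?s b"
  then obtain a b where ab: "b \<noteq> 0" "Fract P 1 = Fract a b" "r = meval rconst ?s a / meval rconst ?s b"
    by blast
  then have "a = P * b"
    by (simp add: eq_fract)
  moreover have "?S b \<noteq> 0"
    using ab(1) by (simp add: subst_skip_var_eq_0_iff)
  ultimately show "r = Fract (?S P) 1"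
    using ab(3) by (simp add: s subst.hom_mult eq_fract)
qed

context prime_field
begin

lemma det_L_mat: "det (L_mat a) = Fract (moore a mvar) (1 :: 'a mpoly)"
  unfolding moore_def L_mat_def Fract_one.hom_det[symmetric]
  by (intro arg_cong[of _ _ det] eq_matI) (auto simp: rvar_def Fract_one.hom_power)

lemma det_N_mat:
  assumes "1 \<le> a"
  shows "det (N_mat a b (Fract P 1)) = Fract (num b a P mvar) (1 :: 'a mpoly)"
proof -
  obtain a' where a: "a = Suc a'"
    using assms by (cases a) auto
  let ?r = "\<lambda>i. mvar i ^ (q ^ b) * subst (\<lambda>j. mvar (skip_var i j)) P"
  have "det (N_mat a b (Fract P 1)) = Fract (bordered a' ?r mvar) 1"
    unfolding bordered_def N_mat_def Fract_one.hom_det[symmetric]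
    by (intro arg_cong[of _ _ det] eq_matI) (auto simp: a rvar_def Fract_one.hom_power Fract_one.hom_mult omit_Fract)
  also have "bordered a' ?r mvar = num b a P mvar"
    by (simp add: bordered_expand num_def a)
  finally show ?thesis .
qed

lemma delta_Fract:
  assumes "compat b a P" "1 \<le> a"
  shows "delta a b (Fract P 1) = Fract (dl b a P) 1"
  using assms moore_nonzero[of a] dl_eq[OF assms(1)]
  by (simp add: delta_def det_L_mat det_N_mat eq_fract mult.commute)

lemma Yaux_Fract: "1 \<le> t \<Longrightarrow> Yaux b t l = Fract (ypoly b t l) 1"
proof (induction b t l rule: ypoly.induct)
  case (2 b t i j r)
  define f where "f = muiV t ^ j * ypoly b (Suc t) r"
  have gf: "good b t f"
    unfolding f_def using 2(2) by (intro good_muiV good_ypoly) auto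
  have "(delta t b ^^ i) (Fract f 1) = Fract ((dl b t ^^ i) f) 1"
  proof (induction i)
    case (Suc i)
    have "compat b t ((dl b t ^^ i) f)"
      using good_funpow_dl[OF gf 2(2)] by (simp add: good_def)
    then show ?case
      using Suc 2(2) by (simp add: delta_Fract)
  qed simp
  then show ?case
    using 2 by (simp add: f_def)
qed simp

end

section \<open>From simple transvections to the unitriangular group\<close>

text \<open>The ideal of all x_t^Q, described by its monomials. Having no bound on t, it is stable
  under shifts of the variables.\<close>

definition pow_ideal :: "nat \<Rightarrow> 'a::zero mpoly set" where
  "pow_ideal Q = {P. \<forall>mo\<in>Poly_Mapping.keys P. \<exists>t. Q \<le> Poly_Mapping.lookup mo t}"

lemma pow_ideal_0 [simp]: "0 \<in> pow_ideal Q"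
  by (simp add: pow_ideal_def)

lemma pow_ideal_add: "P \<in> pow_ideal Q \<Longrightarrow> P' \<in> pow_ideal Q \<Longrightarrow> P + P' \<in> pow_ideal Q"
  unfolding pow_ideal_def using keys_add[of P P'] by blast

lemma pow_ideal_mult: "P \<in> pow_ideal Q \<Longrightarrow> R * P \<in> pow_ideal Q"
  unfolding pow_ideal_def using keys_mult[of R P] by (fastforce simp: lookup_add intro: trans_le_add2)

lemma pow_ideal_mult2: "P \<in> pow_ideal Q \<Longrightarrow> P * R \<in> pow_ideal (Q :: nat)" for P :: "'a::comm_ring_1 mpoly"
  using pow_ideal_mult[of P Q R] by (simp add: mult.commute)

lemma pow_ideal_uminus: "P \<in> pow_ideal Q \<Longrightarrow> - P \<in> pow_ideal Q" for P :: "'a::comm_ring_1 mpoly"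
  using pow_ideal_mult[of P Q "- 1"] by simp

lemma pow_ideal_diff: "P \<in> pow_ideal Q \<Longrightarrow> P' \<in> pow_ideal Q \<Longrightarrow> P - P' \<in> pow_ideal Q"
  for P :: "'a::comm_ring_1 mpoly"
  using pow_ideal_add[OF _ pow_ideal_uminus] by fastforce

lemma pow_ideal_sum: "(\<And>i. i \<in> A \<Longrightarrow> f i \<in> pow_ideal Q) \<Longrightarrow> sum f A \<in> pow_ideal Q"
  by (induction A rule: infinite_finite_induct) (auto intro: pow_ideal_add)

lemma pow_ideal_mvar: "(mvar t :: 'a::comm_ring_1 mpoly) ^ Q \<in> pow_ideal Q"
  by (auto simp: mvar_power pow_ideal_def intro!: exI[of _ t])

lemma monomial_split:
  fixes Q :: nat
  assumes "Q \<le> Poly_Mapping.lookup mo t"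
  shows "mo = (mo - Poly_Mapping.single t Q) + Poly_Mapping.single t Q"
  by (rule poly_mapping_eqI) (use assms in \<open>auto simp: lookup_add lookup_minus lookup_single when_def\<close>)

lemma subst_pow_ideal:
  fixes P :: "'a::comm_ring_1 mpoly"
  assumes "\<And>t. \<xi> t ^ Q \<in> pow_ideal Q" "P \<in> pow_ideal Q"
  shows "subst \<xi> P \<in> pow_ideal Q"
  unfolding subst_def meval_def mmon_def[symmetric]
proof (intro pow_ideal_sum pow_ideal_mult)
  fix mo assume "mo \<in> Poly_Mapping.keys P"
  then obtain t where "Q \<le> Poly_Mapping.lookup mo t"
    using assms(2) by (auto simp: pow_ideal_def)
  then have "mmon \<xi> mo = mmon \<xi> (mo - Poly_Mapping.single t Q) * \<xi> t ^ Q"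
    by (subst monomial_split) (simp_all only: mmon_add mmon_single)
  then show "mmon \<xi> mo \<in> pow_ideal Q"
    using assms(1) by (simp add: pow_ideal_mult)
qed

lemma pow_ideal_shift:
  fixes P :: "'a::comm_ring_1 mpoly"
  assumes "P \<in> pow_ideal Q"
  shows "subst (\<lambda>j. mvar (f j)) P \<in> pow_ideal Q"
  using assms by (rule subst_pow_ideal[rotated]) (rule pow_ideal_mvar)

text \<open>\<open>d i j\<close> is the matrix entry above the diagonal in row i and column j,
  counted from 1, whereas matrices count from 0.\<close>

definition ut :: "nat \<Rightarrow> (nat \<Rightarrow> nat \<Rightarrow> 'a) \<Rightarrow> nat \<Rightarrow> 'a::comm_ring_1 mpoly" where
  "ut n d j = (if j \<in> {1..n} then mvar j + lincomb (\<lambda>i. d i j) j else mvar j)"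

lemma act_eq_subst_ut:
  fixes \<sigma> :: "'a::field mat"
  assumes "unitri n \<sigma>"
  shows "act \<sigma> f = subst (ut n (\<lambda>i j. \<sigma> $$ (i - 1, j - 1))) f"
proof -
  have "(\<Sum>i<n. mconst (\<sigma> $$ (i, j - 1)) * mvar (Suc i)) = mvar j + lincomb (\<lambda>i. \<sigma> $$ (i - 1, j - 1)) j"
    if j: "1 \<le> j" "j \<le> n" for j
  proof -
    have "(\<Sum>i<n. mconst (\<sigma> $$ (i, j - 1)) * mvar (Suc i)) = (\<Sum>i\<in>{1..n}. mconst (\<sigma> $$ (i - 1, j - 1)) * mvar i)"
      by (rule sum.reindex_bij_witness[of _ "\<lambda>i. i - 1" Suc]) auto
    also have "\<dots> = (\<Sum>i\<in>insert j {1..<j}. mconst (\<sigma> $$ (i - 1, j - 1)) * mvar i)"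
    proof (rule sum.mono_neutral_right)
      show "\<forall>i\<in>{1..n} - insert j {1..<j}. mconst (\<sigma> $$ (i - 1, j - 1)) * mvar i = 0"
      proof
        fix i assume "i \<in> {1..n} - insert j {1..<j}"
        then have "i - 1 < n" "j - 1 < i - 1"
          using j by auto
        then have "\<sigma> $$ (i - 1, j - 1) = 0"
          using assms unfolding unitri_def by blast
        then show "mconst (\<sigma> $$ (i - 1, j - 1)) * mvar i = 0"
          by simp
      qed
    qed (use j in auto)
    also have "\<dots> = mvar j + lincomb (\<lambda>i. \<sigma> $$ (i - 1, j - 1)) j"
      using assms j by (simp add: lincomb_def unitri_def)
    finally show ?thesis .
  qed
  moreover have "dim_row \<sigma> = n"
    using assms by (auto simp: unitri_def)
  ultimately have "(\<lambda>j. if 1 \<le> j \<and> j \<le> dim_row \<sigma>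
          then (\<Sum>i<dim_row \<sigma>. mconst (\<sigma> $$ (i, j - 1)) * mvar (Suc i)) else mvar j) =
      ut n (\<lambda>i j. \<sigma> $$ (i - 1, j - 1))"
    by (auto simp: ut_def fun_eq_iff)
  then show ?thesis
    by (simp add: act_def subst_def)
qed

lemma ut_cong: "(\<And>i j. 1 \<le> i \<Longrightarrow> i < j \<Longrightarrow> j \<le> n \<Longrightarrow> d i j = d' i j) \<Longrightarrow> ut n d = ut n d'"
  by (auto simp: ut_def lincomb_def fun_eq_iff intro!: sum.cong)

lemma ut_is_act:
  fixes d :: "nat \<Rightarrow> nat \<Rightarrow> 'a::field"
  obtains \<sigma> where "unitri n \<sigma>" "\<And>f. act \<sigma> f = subst (ut n d) f"
proof
  let ?\<sigma> = "mat n n (\<lambda>(i,j). if i = j then 1 else if i < j then d (Suc i) (Suc j) else 0)"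
  show *: "unitri n ?\<sigma>"
    by (simp add: unitri_def)
  have "ut n (\<lambda>i j. ?\<sigma> $$ (i - 1, j - 1)) = ut n d"
    by (rule ut_cong) auto
  then show "act ?\<sigma> f = subst (ut n d) f" for f
    by (simp only: act_eq_subst_ut[OF *])
qed

lemma mvars_subst_ut:
  assumes "mvars f \<subseteq> {1..n}"
  shows "mvars (subst (ut n d) f) \<subseteq> {1..n}"
proof (rule order.trans[OF mvars_subst], rule UN_least)
  fix i assume "i \<in> mvars f"
  then have i: "i \<in> {1..n}"
    using assms by blast
  have "mvars (mvar i + lincomb (\<lambda>k. d k i) i) \<subseteq> {1..n}"
    by (rule order.trans[OF mvars_add]) (use mvars_lincomb[of "\<lambda>k. d k i" i] i in auto)
  then show "mvars (ut n d i) \<subseteq> {1..n}"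
    using i by (simp add: ut_def)
qed

text \<open>A monomial with exponent at least Q at t contains x_t, because Q > 0; the support
  condition then puts t into the range, and the monomial contributes to \<open>g t\<close>.\<close>

lemma QI_iff:
  fixes P :: "'a::{field,finite} mpoly"
  shows "P \<in> QI m n \<longleftrightarrow> mvars P \<subseteq> {1..n} \<and> P \<in> pow_ideal (card (UNIV :: 'a set) ^ m)"
proof (intro iffI conjI)
  let ?Q = "card (UNIV :: 'a set) ^ m"
  show "mvars P \<subseteq> {1..n}" if "P \<in> QI m n"
  proof -
    obtain g where g: "\<forall>i\<in>{1..n}. mvars (g i) \<subseteq> {1..n}" "P = (\<Sum>i\<in>{1..n}. g i * mvar i ^ ?Q)"
      using \<open>P \<in> QI m n\<close> by (auto simp: QI_def)
    have "mvars (g i * mvar i ^ ?Q) \<subseteq> {1..n}" if "i \<in> {1..n}" for i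
      by (rule order.trans[OF mvars_mult])
         (use that g(1) mvars_power[of "mvar i :: 'a mpoly" ?Q] in auto)
    then show ?thesis
      unfolding g(2) by (intro order.trans[OF mvars_sum] UN_least)
  qed
  show "P \<in> pow_ideal ?Q" if "P \<in> QI m n"
    using that by (auto simp: QI_def intro!: pow_ideal_sum pow_ideal_mult pow_ideal_mvar)
  show "P \<in> QI m n" if *: "mvars P \<subseteq> {1..n} \<and> P \<in> pow_ideal ?Q"
  proof -
    have zero: "0 \<in> (QI m n :: 'a mpoly set)"
      unfolding QI_def by (intro CollectI exI[of _ "\<lambda>_. 0"]) simp
    have add: "F + G \<in> QI m n" if "F \<in> QI m n" "G \<in> QI m n" for F G :: "'a mpoly"
    proof -
      obtain f g where f: "\<forall>i\<in>{1..n}. mvars (f i) \<subseteq> {1..n}" "F = (\<Sum>i\<in>{1..n}. f i * mvar i ^ ?Q)"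
        and g: "\<forall>i\<in>{1..n}. mvars (g i) \<subseteq> {1..n}" "G = (\<Sum>i\<in>{1..n}. g i * mvar i ^ ?Q)"
        using \<open>F \<in> QI m n\<close> \<open>G \<in> QI m n\<close> unfolding QI_def by blast
      have "\<forall>i\<in>{1..n}. mvars (f i + g i) \<subseteq> {1..n}"
        using f(1) g(1) mvars_add by (meson Un_least order.trans)
      moreover have "F + G = (\<Sum>i\<in>{1..n}. (f i + g i) * mvar i ^ ?Q)"
        by (simp add: f(2) g(2) distrib_right sum.distrib)
      ultimately show ?thesis
        unfolding QI_def by (intro CollectI exI[of _ "\<lambda>i. f i + g i"]) simp
    qed
    have sum: "(\<Sum>a\<in>A. f a) \<in> QI m n" if "finite A" "\<And>a. a \<in> A \<Longrightarrow> f a \<in> QI m n"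
      for A :: "(nat \<Rightarrow>\<^sub>0 nat) set" and f :: "_ \<Rightarrow> 'a mpoly"
      using that by (induction A rule: finite_induct) (auto intro: zero add)
    have "Poly_Mapping.single mo (Poly_Mapping.lookup P mo) \<in> QI m n" if mo: "mo \<in> Poly_Mapping.keys P" for mo
    proof -
      let ?c = "Poly_Mapping.lookup P mo"
      obtain t where t: "?Q \<le> Poly_Mapping.lookup mo t"
        using mo * by (auto simp: pow_ideal_def)
      let ?r = "mo - Poly_Mapping.single t ?Q"
      have keys: "Poly_Mapping.keys mo \<subseteq> {1..n}"
        using mo * by (auto simp: mvars_def)
      have "Poly_Mapping.lookup mo t \<noteq> 0"
        using t by (auto simp: finite_UNIV_card_ge_0 intro: gr_zeroI)
      then have "t \<in> Poly_Mapping.keys mo"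
        by (simp add: in_keys_iff)
      then have tn: "t \<in> {1..n}"
        using keys by blast
      have "Poly_Mapping.keys ?r \<subseteq> {1..n}"
        using keys by (auto simp: in_keys_iff lookup_minus)
      then have r: "mvars (Poly_Mapping.single ?r ?c) \<subseteq> {1..n}"
        by (auto simp: mvars_def)
      have "Poly_Mapping.single mo ?c = Poly_Mapping.single ?r ?c * mvar t ^ ?Q"
        using monomial_split[OF t] by (simp add: mvar_power mult_single)
      also have "\<dots> = (\<Sum>i\<in>{1..n}. (if i = t then Poly_Mapping.single ?r ?c * mvar t ^ ?Q else 0))"
        using tn by simp
      also have "\<dots> = (\<Sum>i\<in>{1..n}. (if i = t then Poly_Mapping.single ?r ?c else 0) * mvar i ^ ?Q)"
        by (intro sum.cong) auto
      finally show ?thesis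
        unfolding QI_def using r by (intro CollectI exI[of _ "\<lambda>i. if i = t then Poly_Mapping.single ?r ?c else 0"]) auto
    qed
    then have "(\<Sum>mo\<in>Poly_Mapping.keys P. Poly_Mapping.single mo (Poly_Mapping.lookup P mo)) \<in> QI m n"
      by (intro sum) auto
    then show ?thesis
      by (simp flip: poly_mapping_sum_single)
  qed
qed

context prime_field
begin

text \<open>The one consequence of linearity that is used: the ideal is mapped into itself. It holds
  for linear forms because taking q^b-th powers is additive.\<close>

definition linear_subst :: "nat \<Rightarrow> (nat \<Rightarrow> 'a mpoly) \<Rightarrow> bool" where
  "linear_subst b \<xi> \<longleftrightarrow> (\<forall>t. \<xi> t ^ (q ^ b) \<in> pow_ideal (q ^ b))"

definition fixes_mod :: "nat \<Rightarrow> 'a mpoly \<Rightarrow> (nat \<Rightarrow> 'a mpoly) \<Rightarrow> bool" where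
  "fixes_mod b f \<xi> \<longleftrightarrow> subst \<xi> f - f \<in> pow_ideal (q ^ b)"

definition elem :: "nat \<Rightarrow> nat \<Rightarrow> 'a \<Rightarrow> nat \<Rightarrow> 'a mpoly" where
  "elem r s c = mvar(s := mvar s + mconst c * mvar r)"

lemma linear_elem: "linear_subst b (elem r s c)"
  unfolding linear_subst_def elem_def
  by (auto simp: frob_add power_mult_distrib intro!: pow_ideal_add pow_ideal_mult pow_ideal_mvar)

lemma linear_ut: "linear_subst b (ut n d)"
  unfolding linear_subst_def ut_def lincomb_def
  by (auto simp: frob_add frob_lincomb intro!: pow_ideal_add pow_ideal_sum pow_ideal_mult pow_ideal_mvar)

lemma fixes_mod_comp:
  assumes "fixes_mod b f \<xi>" "fixes_mod b f \<eta>" "linear_subst b \<xi>"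
  shows "fixes_mod b f (\<lambda>i. subst \<xi> (\<eta> i))"
proof -
  have *: "subst (\<lambda>i. subst \<xi> (\<eta> i)) f - f = subst \<xi> (subst \<eta> f - f) + (subst \<xi> f - f)"
    by (simp add: subst_subst subst.hom_minus)
  show ?thesis
    using assms unfolding fixes_mod_def linear_subst_def * by (intro pow_ideal_add subst_pow_ideal) auto
qed

text \<open>Non-simple transvections are commutators of shorter ones.\<close>
lemma fixes_mod_elem:
  assumes transv: "\<And>s c. 2 \<le> s \<Longrightarrow> s \<le> n \<Longrightarrow> fixes_mod b f (transv s c)"
    and "1 \<le> r" "Suc r \<le> s" "s \<le> n"
  shows "fixes_mod b f (elem r s c)"
  using assms(3,4)
proof (induction s arbitrary: c rule: dec_induct)
  case base
  then show ?case
    using transv[of "Suc r" c] assms(2) by (simp add: elem_def transv_def fun_upd_def)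
next
  case (step s)
  have A: "fixes_mod b f (elem r s e)" for e
    using step by simp
  have B: "fixes_mod b f (elem s (Suc s) e)" for e
    using transv[of "Suc s" e] step by (simp add: elem_def transv_def fun_upd_def)
  have "fixes_mod b f (\<lambda>i. subst (elem r s (- c)) (subst (elem s (Suc s) (- 1)) (subst (elem r s c) (elem s (Suc s) 1 i))))"
    by (intro fixes_mod_comp A B linear_elem)
  moreover have "subst (elem r s (- c)) (subst (elem s (Suc s) (- 1)) (subst (elem r s c) (elem s (Suc s) 1 i))) = elem r (Suc s) c i" for i
    using step.hyps by (auto simp: elem_def subst.hom_add subst.hom_mult subst.hom_uminus mconst_uminus algebra_simps)
  ultimately show ?case
    by simp
qed

text \<open>The matrix is built column by column, and each column entry by entry: \<open>s\<close>
  bounds the nonzero columns and \<open>r\<close> the nonzero rows of the last of them.\<close>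

lemma fixes_mod_ut:
  assumes transv: "\<And>s c. 2 \<le> s \<Longrightarrow> s \<le> n \<Longrightarrow> fixes_mod b f (transv s c)"
  shows "fixes_mod b f (ut n d)"
proof -
  have main: "fixes_mod b f (ut n d)"
    if "\<And>i j. s < j \<Longrightarrow> d i j = 0" "\<And>i j. j \<le> i \<Longrightarrow> d i j = 0" for s d
    using that
  proof (induction s arbitrary: d)
    case 0
    then have "ut n d j = mvar j" for j
      by (simp add: ut_def lincomb_def)
    then have "ut n d = mvar"
      by blast
    then show ?case
      by (simp add: fixes_mod_def)
  next
    case (Suc s)
    have "fixes_mod b f (ut n d)"
      if "\<And>i j. Suc s < j \<Longrightarrow> d i j = 0" "\<And>i. r < i \<Longrightarrow> d i (Suc s) = 0"
        "\<And>i j. j \<le> i \<Longrightarrow> d i j = 0" for r d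
      using that
    proof (induction r arbitrary: d)
      case 0
      have "fixes_mod b f (ut n (\<lambda>i j. if s < j then 0 else d i j))"
        using 0 by (intro Suc.IH) auto
      also have "ut n (\<lambda>i j. if s < j then 0 else d i j) = ut n d"
      proof (rule ut_cong)
        fix i j :: nat assume "1 \<le> i" "i < j"
        then show "(if s < j then 0 else d i j) = d i j"
          using 0 by (cases "j = Suc s") auto
      qed
      finally show ?case .
    next
      case (Suc r)
      define d' where "d' i j = (if i = Suc r \<and> j = Suc s then 0 else d i j)" for i j
      have d': "fixes_mod b f (ut n d')"
      proof (rule Suc.IH)
        show "d' i j = 0" if "Suc s < j" for i j
          using that Suc.prems(1) by (simp add: d'_def)
        show "d' i (Suc s) = 0" if "r < i" for i
          using that Suc.prems(2)[of i] by (cases "i = Suc r") (auto simp: d'_def)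
        show "d' i j = 0" if "j \<le> i" for i j
          using that Suc.prems(3) by (simp add: d'_def)
      qed
      show ?case
      proof (cases "Suc r < Suc s \<and> Suc s \<le> n")
        case True
        let ?e = "elem (Suc r) (Suc s) (d (Suc r) (Suc s))"
        have "fixes_mod b f (\<lambda>i. subst ?e (ut n d' i))"
          using True by (intro fixes_mod_comp d' linear_elem fixes_mod_elem[OF transv]) auto
        moreover have "subst ?e (ut n d' j) = ut n d j" for j
        proof -
          \<comment> \<open>The elementary substitution moves only x_(s+1), which occurs in none of
            the forms added in columns up to s + 1; later columns are zero.\<close>
          have lin: "subst ?e (lincomb c j) = lincomb c j" if "j \<le> Suc s" for c
            unfolding elem_def using mvars_lincomb[of c j] that by (intro subst_upd_lspan) auto
          consider "j < Suc s" | "j = Suc s" | "Suc s < j"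
            by linarith
          then show ?thesis
          proof cases
            case 1
            then show ?thesis
              using lin by (simp add: ut_def subst.hom_add d'_def elem_def)
          next
            case 2
            have "(\<lambda>i. d' i (Suc s))(Suc r := d' (Suc r) (Suc s) + d (Suc r) (Suc s)) = (\<lambda>i. d i (Suc s))"
              by (auto simp: d'_def)
            then have "lincomb (\<lambda>i. d i (Suc s)) (Suc s) = lincomb (\<lambda>i. d' i (Suc s)) (Suc s) + mconst (d (Suc r) (Suc s)) * mvar (Suc r)"
              using lincomb_upd[of "Suc r" "Suc s" "\<lambda>i. d' i (Suc s)" "d (Suc r) (Suc s)"] True by simp
            then show ?thesis
              using lin 2 True by (simp add: ut_def subst.hom_add elem_def add_ac)
          next
            case 3
            then show ?thesis
              using Suc.prems(1) by (simp add: ut_def d'_def lincomb_def elem_def)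
          qed
        qed
        ultimately show ?thesis
          by simp
      next
        case False
        then have "ut n d' = ut n d"
          by (intro ut_cong) (auto simp: d'_def)
        then show ?thesis
          using d' by simp
      qed
    qed
    from this[of d "Suc s"] show ?case
      using Suc.prems by simp
  qed
  have "fixes_mod b f (ut n (\<lambda>i j. if i < j \<and> j \<le> n then d i j else 0))"
    by (rule main[of n]) auto
  also have "ut n (\<lambda>i j. if i < j \<and> j \<le> n then d i j else 0) = ut n d"
    by (rule ut_cong) auto
  finally show ?thesis .
qed

lemma err_pow_ideal: "err b a e \<Longrightarrow> e \<in> pow_ideal (q ^ b)"
  by (induction rule: err.induct) (auto intro: pow_ideal_add pow_ideal_mult2 pow_ideal_mvar)

text \<open>For a = 1 the \<open>err\<close> clause of \<open>good\<close> covers all simple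
  transvections.\<close>

lemma fixes_mod_ypoly: "fixes_mod b (ypoly b 1 l) (ut n d)"
proof (rule fixes_mod_ut)
  fix s :: nat and c assume "2 \<le> s"
  then have "err b 1 (ypoly b 1 l - subst (transv s c) (ypoly b 1 l))"
    using good_ypoly[of 1 b l] by (simp add: good_def)
  then have "- (ypoly b 1 l - subst (transv s c) (ypoly b 1 l)) \<in> pow_ideal (q ^ b)"
    by (intro pow_ideal_uminus err_pow_ideal)
  then show "fixes_mod b (ypoly b 1 l) (transv s c)"
    by (simp add: fixes_mod_def)
qed

end

section \<open>Setting the first variable to zero\<close>

abbreviation shift :: "'a::comm_ring_1 mpoly \<Rightarrow> 'a mpoly" where
  "shift \<equiv> subst (\<lambda>j. mvar (skip_var (Suc 0) j))"

abbreviation red1 :: "'a::comm_ring_1 mpoly \<Rightarrow> 'a mpoly" where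
  "red1 \<equiv> subst (mvar(Suc 0 := 0))"

lemma red1_shift [simp]: "red1 (shift P) = shift P"
  unfolding subst_subst by (intro subst_cong) (auto simp: skip_var_def)

lemma shift_inj: "shift P = shift Q \<Longrightarrow> P = (Q :: 'a::comm_ring_1 mpoly)"
  using subst_skip_var_eq_0_iff[of "Suc 0" "P - Q"] by (simp add: subst.hom_minus)

lemma lincomb_Suc_shift: "1 \<le> t \<Longrightarrow> lincomb c (Suc t) = mconst (c 1) * mvar 1 + shift (lincomb (\<lambda>j. c (Suc j)) t)"
proof -
  assume t: "1 \<le> t"
  then have "{1..<Suc t} = insert 1 {2..<Suc t}"
    by auto
  then have "lincomb c (Suc t) = mconst (c 1) * mvar 1 + (\<Sum>j\<in>{2..<Suc t}. mconst (c j) * mvar j)"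
    unfolding lincomb_def by simp
  also have "(\<Sum>j\<in>{2..<Suc t}. mconst (c j) * mvar j) = (\<Sum>j\<in>{1..<t}. mconst (c (Suc j)) * mvar (Suc j))"
    by (rule sum.reindex_bij_witness[of _ Suc "\<lambda>j. j - 1"]) auto
  also have "\<dots> = shift (lincomb (\<lambda>j. c (Suc j)) t)"
    unfolding lincomb_def subst.hom_sum by (intro sum.cong) (auto simp: subst.hom_mult skip_var_def)
  finally show ?thesis .
qed

context prime_field
begin

text \<open>Forms in x_1, ..., x_t are c x_1 plus a shifted form. At x_1 = 0 the constant c is lost,
  so each factor of the shifted V_t occurs q times.\<close>

lemma red1_muiV:
  assumes "1 \<le> t"
  shows "red1 (muiV (Suc t)) = shift (muiV t :: 'a mpoly) ^ q"
proof -
  define h where "h = (\<lambda>(c :: 'a, w). mconst c * mvar 1 + shift w)"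
  have bij: "bij_betw h (UNIV \<times> lspan t) (lspan (Suc t))"
  proof (rule bij_betw_imageI)
    have red: "red1 (h (c, w)) = shift w" for c w
      by (simp add: h_def subst.hom_add subst.hom_mult)
    show "inj_on h (UNIV \<times> lspan t)"
    proof (rule inj_onI, clarify)
      fix c c' w w' assume eq: "h (c, w) = h (c', w')"
      then have w: "w = w'"
        using red by (metis shift_inj)
      then have "mconst (c - c') * mvar 1 = (0 :: 'a mpoly)"
        using eq by (simp add: h_def mconst_diff left_diff_distrib)
      then show "c = c' \<and> w = w'"
        using w by simp
    qed
    have "h (c, lincomb f t) \<in> lspan (Suc t)" for c f
      using lincomb_Suc_shift[OF assms, of "\<lambda>j. if j = 1 then c else f (j - 1)"]
      unfolding h_def lspan_def lincomb_def by (auto intro!: exI[of _ "\<lambda>j. if j = 1 then c else f (j - 1)"])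
    moreover have "lincomb c (Suc t) \<in> h ` (UNIV \<times> lspan t)" for c
      using lincomb_Suc_shift[OF assms, of c] unfolding h_def lspan_def by (force simp: image_iff)
    ultimately show "h ` (UNIV \<times> lspan t) = lspan (Suc t)"
      by (auto simp: lspan_def)
  qed
  have "red1 (muiV (Suc t)) = (\<Prod>w\<in>lspan (Suc t). red1 (mvar (Suc t) + w))"
    by (simp add: muiV_lspan subst.hom_prod)
  also have "\<dots> = (\<Prod>(c, w)\<in>UNIV \<times> lspan t. red1 (mvar (Suc t) + h (c, w)))"
    using prod.reindex_bij_betw[OF bij, of "\<lambda>w. red1 (mvar (Suc t) + w)"] by (simp add: case_prod_unfold)
  also have "\<dots> = (\<Prod>(c :: 'a, w)\<in>UNIV \<times> lspan t. shift (mvar t + w))"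
  proof (intro prod.cong refl, clarify)
    fix c :: 'a and w :: "'a mpoly"
    have "shift (mvar t :: 'a mpoly) = mvar (Suc t)"
      using assms by (simp add: skip_var_def)
    then show "red1 (mvar (Suc t) + h (c, w)) = shift (mvar t + w)"
      using assms by (simp add: h_def subst.hom_add subst.hom_mult)
  qed
  also have "\<dots> = (\<Prod>c\<in>(UNIV :: 'a set). \<Prod>w\<in>lspan t. shift (mvar t + w))"
    by (rule prod.cartesian_product[symmetric])
  also have "\<dots> = shift (muiV t) ^ q"
    by (simp add: muiV_lspan subst.hom_prod)
  finally show ?thesis .
qed

lemma lspan_1: "lspan 1 = {0 :: 'a mpoly}"
  by (auto simp: lspan_def lincomb_def)

text \<open>The Moore determinant without its factor V_1 = x_1, which must be cancelled before x_1
  is set to 0.\<close>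

definition moore_red :: "nat \<Rightarrow> 'a mpoly" where
  "moore_red a = (\<Prod>d\<in>{2..a}. muiV d)"

lemma moore_moore_red: "1 \<le> a \<Longrightarrow> moore a mvar = mvar 1 * moore_red a"
proof -
  assume "1 \<le> a"
  then have "{1..a} = insert 1 {2..a}"
    by auto
  then show ?thesis
    by (simp add: moore_eq_prod moore_red_def muiV_lspan lspan_1[simplified])
qed

lemma red1_moore_red: "red1 (moore_red (Suc a)) = shift (moore a mvar) ^ q"
proof -
  have "red1 (moore_red (Suc a)) = (\<Prod>d\<in>{2..Suc a}. red1 (muiV d))"
    unfolding moore_red_def subst.hom_prod ..
  also have "\<dots> = (\<Prod>d\<in>{1..a}. red1 (muiV (Suc d)))"
    by (rule prod.reindex_bij_witness[of _ Suc "\<lambda>d. d - 1"]) auto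
  also have "\<dots> = (\<Prod>d\<in>{1..a}. shift (muiV d) ^ q)"
    by (intro prod.cong refl red1_muiV) simp
  finally show ?thesis
    by (simp add: moore_eq_prod subst.hom_prod prod_power_distrib)
qed

lemma red1_skip:
  assumes "red1 F = shift F' ^ q" "2 \<le> i"
  shows "red1 (subst (\<lambda>j. mvar (skip_var i j)) F) = shift (subst (\<lambda>j. mvar (skip_var (i - 1) j)) F') ^ q"
proof -
  have "red1 (subst (\<lambda>j. mvar (skip_var i j)) F) = subst (\<lambda>j. mvar (skip_var i j)) (red1 F)"
    unfolding subst_subst using assms(2) by (intro subst_cong) (auto simp: skip_var_def)
  also have "\<dots> = subst (\<lambda>j. mvar (skip_var i j)) (shift F') ^ q"
    by (simp add: assms(1) subst.hom_power)
  also have "subst (\<lambda>j. mvar (skip_var i j)) (shift F') = shift (subst (\<lambda>j. mvar (skip_var (i - 1) j)) F')"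
    unfolding subst_subst using assms(2) by (intro subst_cong) (auto simp: skip_var_def)
  finally show ?thesis .
qed

text \<open>Divide the equation defining \<delta> by x_1 and set x_1 = 0. The term omitting x_1
  keeps x_1^(Q-1) with Q > 1 and vanishes; the others are shifted q-th powers of the terms for
  \<open>f'\<close>.\<close>

lemma red1_dl:
  assumes f: "compat (Suc b) (Suc a) f" and f': "compat b a f'" and a: "1 \<le> a"
    and red: "red1 f = shift f' ^ q"
  shows "red1 (dl (Suc b) (Suc a) f) = shift (dl b a f') ^ q"
proof -
  let ?Q = "q ^ Suc b" and ?g = "dl (Suc b) (Suc a) f"
  let ?sk = "\<lambda>i. subst (\<lambda>j. mvar (skip_var i j)) :: 'a mpoly \<Rightarrow> 'a mpoly"
  have Q: "?Q - 1 > 0" "?Q = Suc (?Q - 1)"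
    using one_less_power[OF q_gt_1, of "Suc b"] by auto
  define E where "E = (- 1) ^ (Suc a + 1) * (mvar 1 ^ (?Q - 1) * ?sk 1 f) * ?sk 1 (moore a mvar)
     + (\<Sum>i\<in>{2..Suc a}. (- 1) ^ (Suc a + i) * (mvar i ^ ?Q * ?sk i f) * ?sk i (moore_red a))"
  have "mvar 1 * (moore_red (Suc a) * ?g) = num (Suc b) (Suc a) f mvar"
    using dl_eq[OF f] by (simp add: moore_moore_red mult.assoc)
  also have "\<dots> = (\<Sum>i\<in>insert 1 {2..Suc a}. (- 1) ^ (Suc a + i) * (mvar i ^ ?Q * ?sk i f) * ?sk i (moore a mvar))"
    unfolding num_def by (intro sum.cong) (auto simp: subst_moore)
  also have "\<dots> = (- 1) ^ (Suc a + 1) * (mvar 1 ^ ?Q * ?sk 1 f) * ?sk 1 (moore a mvar)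
     + (\<Sum>i\<in>{2..Suc a}. (- 1) ^ (Suc a + i) * (mvar i ^ ?Q * ?sk i f) * ?sk i (moore a mvar))"
    by (subst sum.insert) auto
  also have "(\<Sum>i\<in>{2..Suc a}. (- 1) ^ (Suc a + i) * (mvar i ^ ?Q * ?sk i f) * ?sk i (moore a mvar)) =
      (\<Sum>i\<in>{2..Suc a}. mvar 1 * ((- 1) ^ (Suc a + i) * (mvar i ^ ?Q * ?sk i f) * ?sk i (moore_red a)))"
  proof (rule sum.cong[OF refl])
    fix i assume "i \<in> {2..Suc a}"
    then have "?sk i (moore a mvar) = mvar 1 * ?sk i (moore_red a)"
      using a by (simp add: moore_moore_red subst.hom_mult skip_var_def)
    then show "(- 1) ^ (Suc a + i) * (mvar i ^ ?Q * ?sk i f) * ?sk i (moore a mvar) =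
        mvar 1 * ((- 1) ^ (Suc a + i) * (mvar i ^ ?Q * ?sk i f) * ?sk i (moore_red a))"
      by (simp only: mult_ac)
  qed
  also have "(- 1) ^ (Suc a + 1) * (mvar 1 ^ ?Q * ?sk 1 f) * ?sk 1 (moore a mvar) + \<dots> = mvar 1 * E"
  proof -
    have "(mvar 1 :: 'a mpoly) ^ ?Q = mvar 1 * mvar 1 ^ (?Q - 1)"
      using Q(2) by (metis power_Suc)
    then show ?thesis
      unfolding E_def distrib_left sum_distrib_left[symmetric] by (simp only: mult_ac)
  qed
  finally have E: "moore_red (Suc a) * ?g = E"
    by simp
  have red_moore: "red1 (moore_red a) = shift (moore (a - 1) mvar) ^ q"
    using red1_moore_red[of "a - 1"] a by simp
  \<comment> \<open>The signs must be q-th powers as well; for q = 2 this holds because -1 =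
    1.\<close>
  have sgn: "((- 1 :: 'a mpoly) ^ k) ^ q = (- 1) ^ k" for k
  proof -
    have "((- 1 :: 'a mpoly) ^ k) ^ q = ((- 1) ^ q) ^ k"
      by (simp only: mult.commute flip: power_mult)
    then show ?thesis
      using frob_minus_one[of 1] by simp
  qed
  have "shift (moore a mvar) ^ q * red1 ?g = red1 E"
    using arg_cong[OF E, of red1] red1_moore_red[of a] by (simp add: subst.hom_mult)
  also have "\<dots> = (\<Sum>i\<in>{2..Suc a}. (- 1) ^ (Suc a + i) * (mvar i ^ ?Q * red1 (?sk i f)) * red1 (?sk i (moore_red a)))"
    using Q(1) unfolding E_def
    by (simp add: subst.hom_add subst.hom_mult subst.hom_power subst.hom_sum subst.hom_uminus zero_power cong: sum.cong_simp)
  also have "\<dots> = (\<Sum>i\<in>{1..a}. (- 1) ^ (Suc a + Suc i) * (mvar (Suc i) ^ ?Q * red1 (?sk (Suc i) f)) * red1 (?sk (Suc i) (moore_red a)))"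
    by (rule sum.reindex_bij_witness[of _ Suc "\<lambda>i. i - 1"]) auto
  also have "\<dots> = (\<Sum>i\<in>{1..a}. shift ((- 1) ^ (a + i) * (mvar i ^ (q ^ b) * ?sk i f') * ?sk i (moore (a - 1) mvar)) ^ q)"
  proof (rule sum.cong[OF refl])
    fix i assume i: "i \<in> {1..a}"
    have 1: "red1 (?sk (Suc i) f) = shift (?sk i f') ^ q"
      using red1_skip[OF red, of "Suc i"] i by simp
    have 2: "red1 (?sk (Suc i) (moore_red a)) = shift (?sk i (moore (a - 1) mvar)) ^ q"
      using red1_skip[OF red_moore, of "Suc i"] i by simp
    have 3: "shift (mvar i :: 'a mpoly) = mvar (Suc i)"
      using i by (simp add: skip_var_def)
    show "(- 1) ^ (Suc a + Suc i) * (mvar (Suc i) ^ ?Q * red1 (?sk (Suc i) f)) * red1 (?sk (Suc i) (moore_red a)) =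
        shift ((- 1) ^ (a + i) * (mvar i ^ (q ^ b) * ?sk i f') * ?sk i (moore (a - 1) mvar)) ^ q"
      unfolding 1 2 subst.hom_mult power_mult_distrib subst.hom_power 3 subst.hom_uminus subst.hom_one sgn
      by (simp add: mult.commute flip: power_mult)
  qed
  also have "\<dots> = shift (num b a f' mvar) ^ q"
    using frob_sum[of _ "{1..a}" 1] by (simp add: num_def subst.hom_sum subst_moore)
  also have "\<dots> = shift (moore a mvar) ^ q * shift (dl b a f') ^ q"
    by (simp only: dl_eq[OF f', symmetric] subst.hom_mult power_mult_distrib)
  finally show ?thesis
    using moore_nonzero[of a] subst_skip_var_eq_0_iff[of "Suc 0" "moore a mvar :: 'a mpoly"] by simp
qed

lemma red1_ypoly: "1 \<le> t \<Longrightarrow> red1 (ypoly (Suc b) (Suc t) r) = shift (ypoly b t r) ^ q"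
proof (induction b t r rule: ypoly.induct)
  case (2 b t i j r)
  define f where "f = muiV (Suc t) ^ j * ypoly (Suc b) (Suc (Suc t)) r"
  define f' where "f' = muiV t ^ j * ypoly b (Suc t) r"
  have gf: "good (Suc b) (Suc t) f" "good b t f'"
    unfolding f_def f'_def using 2(2) by (auto intro!: good_muiV good_ypoly)
  have "red1 ((dl (Suc b) (Suc t) ^^ i) f) = shift ((dl b t ^^ i) f') ^ q"
  proof (induction i)
    case 0
    have IH: "red1 (ypoly (Suc b) (Suc (Suc t)) r) = shift (ypoly b (Suc t) r) ^ q"
      by (rule 2(1)) simp
    have "(shift (muiV t) ^ q) ^ j = (shift (muiV t) ^ j :: 'a mpoly) ^ q"
      by (simp only: mult.commute flip: power_mult)
    then show ?case
      by (simp only: funpow_0 f_def f'_def subst.hom_mult subst.hom_power red1_muiV[OF 2(2)] IH power_mult_distrib)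
  next
    case (Suc i)
    have "compat (Suc b) (Suc t) ((dl (Suc b) (Suc t) ^^ i) f)" "compat b t ((dl b t ^^ i) f')"
      using good_funpow_dl[OF gf(1), of i] good_funpow_dl[OF gf(2), of i] 2(2) by (simp_all add: good_def)
    from red1_dl[OF this 2(2) Suc] show ?case
      by (simp only: funpow.simps o_apply)
  qed
  then show ?case
    by (simp only: ypoly.simps f_def f'_def)
qed (simp add: subst.hom_one)

lemma dl_1: "dl b 1 f = mvar 1 ^ (q ^ b - 1) * shift f"
proof (rule dl_unique)
  have "q ^ b > 0"
    using q_gt_1 by simp
  then have "(mvar 1 :: 'a mpoly) ^ (q ^ b) = mvar 1 * mvar 1 ^ (q ^ b - 1)"
    by (metis power_Suc Suc_diff_1)
  then show "moore 1 mvar * (mvar 1 ^ (q ^ b - 1) * shift f) = num b 1 f mvar"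
    using moore_moore_red[of 1] by (simp add: num_def moore_red_def mult.assoc)
qed

end

section \<open>Lowest coefficients and \<open>p\<close>-th powers\<close>

lemma lookup_single_mult:
  "Poly_Mapping.lookup (Poly_Mapping.single k c * P) (k + mo) = c * Poly_Mapping.lookup (P :: 'a::comm_ring_1 mpoly) mo"
proof -
  have "Poly_Mapping.single k c * P =
      (\<Sum>a\<in>Poly_Mapping.keys P. Poly_Mapping.single (k + a) (c * Poly_Mapping.lookup P a))"
    by (subst poly_mapping_sum_single[of P]) (simp add: sum_distrib_left mult_single)
  then show ?thesis
    by (simp add: lookup_sum lookup_single when_def in_keys_iff cong: if_cong)
qed

lemma mvar_power_mult_coeff_0:
  assumes "Poly_Mapping.lookup mo i < k"
  shows "Poly_Mapping.lookup (mvar i ^ k * P) mo = (0 :: 'a::comm_ring_1)"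
proof (rule ccontr)
  assume "Poly_Mapping.lookup (mvar i ^ k * P) mo \<noteq> (0 :: 'a)"
  then have "mo \<in> Poly_Mapping.keys (mvar i ^ k * P)"
    by (simp add: in_keys_iff)
  then obtain b where "mo = Poly_Mapping.single i k + b"
    using keys_mult[of "mvar i ^ k" P] by (auto simp: mvar_power)
  then show False
    using assms by (simp add: lookup_add)
qed

text \<open>Monomials of x_i^j A have exponent exactly j at x_i, so the second summand cannot cancel
  them. As j < Q, their large exponent belongs to another variable and is already present in
  A.\<close>

lemma lowest_coeff_pow_ideal:
  fixes A B :: "'a::comm_ring_1 mpoly"
  assumes "i \<notin> mvars A" "mvar i ^ j * A + mvar i ^ Suc j * B \<in> pow_ideal Q" "j < Q"
  shows "A \<in> pow_ideal Q"
  unfolding pow_ideal_def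
proof (intro CollectI ballI)
  fix mo assume mo: "mo \<in> Poly_Mapping.keys A"
  then have mo_i: "Poly_Mapping.lookup mo i = 0"
    using assms(1) by (auto simp: mvars_def in_keys_iff)
  let ?k = "Poly_Mapping.single i j + mo"
  have "Poly_Mapping.lookup (mvar i ^ Suc j * B) ?k = 0"
    by (rule mvar_power_mult_coeff_0) (simp add: lookup_add mo_i)
  then have "Poly_Mapping.lookup (mvar i ^ j * A + mvar i ^ Suc j * B) ?k = Poly_Mapping.lookup A mo"
    unfolding lookup_add[of "mvar i ^ j * A"] by (simp add: mvar_power lookup_single_mult del: power_Suc)
  then have "?k \<in> Poly_Mapping.keys (mvar i ^ j * A + mvar i ^ Suc j * B)"
    using mo unfolding in_keys_iff by simp
  then obtain t where "Q \<le> Poly_Mapping.lookup ?k t"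
    using assms(2) by (auto simp: pow_ideal_def)
  then show "\<exists>t. Q \<le> Poly_Mapping.lookup mo t"
    using assms(3) mo_i by (intro exI[of _ t]) (auto simp: lookup_add lookup_single when_def split: if_splits)
qed

lemma red1_decomp:
  obtains B where "P = red1 P + mvar (Suc 0) * (B :: 'a::comm_ring_1 mpoly)"
proof -
  have "mvar (Suc 0) dvd subst mvar P - red1 P"
    by (rule dvd_subst_diff) auto
  then obtain B where "P - red1 P = mvar (Suc 0) * B"
    by auto
  then have "P = red1 P + mvar (Suc 0) * B"
    by (metis add.commute diff_add_cancel)
  then show ?thesis
    by (rule that)
qed

lemma mvars_red1: "mvars (red1 P) \<subseteq> mvars (P :: 'a::comm_ring_1 mpoly) - {Suc 0}"
  by (rule order.trans[OF mvars_subst]) (auto split: if_splits)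

abbreviation unshift :: "'a::comm_ring_1 mpoly \<Rightarrow> 'a mpoly" where
  "unshift \<equiv> subst (\<lambda>j. mvar (j - Suc 0))"

lemma shift_unshift:
  assumes "mvars P \<subseteq> {2..n}"
  shows "shift (unshift P) = (P :: 'a::comm_ring_1 mpoly)"
proof -
  have "shift (unshift P) = subst mvar P"
    unfolding subst_subst using assms by (intro subst_cong) (auto simp: skip_var_def)
  then show ?thesis
    by simp
qed

lemma mvars_unshift:
  assumes "mvars P \<subseteq> {2..Suc n}"
  shows "mvars (unshift P :: 'a::comm_ring_1 mpoly) \<subseteq> {1..n}"
proof (rule order.trans[OF mvars_subst], rule UN_least)
  fix i assume "i \<in> mvars P"
  then have "i \<in> {2..Suc n}"
    using assms by blast
  then show "mvars (mvar (i - Suc 0) :: 'a mpoly) \<subseteq> {1..n}"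
    by auto
qed

lemma shift_pow_ideal_iff:
  "shift P \<in> pow_ideal Q \<longleftrightarrow> (P :: 'a::comm_ring_1 mpoly) \<in> pow_ideal Q"
proof
  assume "shift P \<in> pow_ideal Q"
  then have "subst (\<lambda>j. mvar (if j < Suc 0 then j else j - 1)) (shift P) \<in> pow_ideal Q"
    by (rule pow_ideal_shift)
  moreover have "subst (\<lambda>j. mvar (if j < Suc 0 then j else j - 1)) (shift P) = subst mvar P"
    unfolding subst_subst by (intro subst_cong) (auto simp: skip_var_def)
  ultimately show "P \<in> pow_ideal Q"
    by simp
qed (rule pow_ideal_shift)

lemma mvars_quotient:
  assumes "i \<in> A" "mvars (mvar i * P) \<subseteq> A"
  shows "mvars (P :: 'a::idom mpoly) \<subseteq> A"
proof -
  define \<zeta> where "\<zeta> j = (if j \<in> A then mvar j else 0 :: 'a mpoly)" for j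
  have "subst \<zeta> (mvar i * P) = subst mvar (mvar i * P)"
    using assms(2) by (intro subst_cong) (auto simp: \<zeta>_def)
  then have "subst \<zeta> P = P"
    using assms(1) by (simp add: subst.hom_mult \<zeta>_def)
  moreover have "mvars (subst \<zeta> P) \<subseteq> A"
    by (rule order.trans[OF mvars_subst]) (auto simp: \<zeta>_def split: if_splits)
  ultimately show ?thesis
    by simp
qed

section \<open>Formal partial derivatives\<close>

definition mderiv :: "nat \<Rightarrow> 'a mpoly \<Rightarrow> 'a::comm_ring_1 mpoly" where
  "mderiv i P = (\<Sum>mo\<in>Poly_Mapping.keys P. Poly_Mapping.single (mo - Poly_Mapping.single i 1)
     (of_nat (Poly_Mapping.lookup mo i) * Poly_Mapping.lookup P mo))"

lemma power_add_taylor: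
  obtains R where "((x :: 'b::comm_ring_1) + y) ^ e = x ^ e + y * (of_nat e * x ^ (e - 1)) + y ^ 2 * R"
proof -
  have "\<exists>R. (x + y) ^ e = x ^ e + y * (of_nat e * x ^ (e - 1)) + y ^ 2 * R"
  proof (induction e)
    case 0
    show ?case
      by (rule exI[of _ 0]) simp
  next
    case (Suc e)
    then obtain R where R: "(x + y) ^ e = x ^ e + y * (of_nat e * x ^ (e - 1)) + y ^ 2 * R"
      by blast
    have e: "of_nat e * (x * x ^ (e - 1)) = of_nat e * x ^ e"
      by (cases e) auto
    have "(x + y) ^ Suc e = x ^ Suc e + y * (of_nat e * (x * x ^ (e - 1)) + x ^ e)
        + y ^ 2 * (of_nat e * x ^ (e - 1) + x * R + y * R)"
      by (simp add: R algebra_simps power2_eq_square)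
    also have "\<dots> = x ^ Suc e + y * (of_nat (Suc e) * x ^ (Suc e - 1)) + y ^ 2 * (of_nat e * x ^ (e - 1) + x * R + y * R)"
      unfolding e by (simp add: algebra_simps)
    finally show ?case
      by blast
  qed
  then show ?thesis
    using that by blast
qed

text \<open>Only the linear term is explicit: later x_1 is put for \<open>l\<close>, and a single
  coefficient in x_1 is read off.\<close>

lemma subst_taylor:
  obtains R where "subst (mvar(i := mvar i + l)) P = P + l * mderiv i P + l ^ 2 * (R :: 'a::comm_ring_1 mpoly)"
proof -
  let ?\<sigma> = "mvar(i := mvar i + l)"
  have mono: "\<exists>R. subst ?\<sigma> (Poly_Mapping.single mo c) = Poly_Mapping.single mo c +
     l * Poly_Mapping.single (mo - Poly_Mapping.single i 1) (of_nat (Poly_Mapping.lookup mo i) * c) + l ^ 2 * R" for mo c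
  proof -
    define e where "e = Poly_Mapping.lookup mo i"
    define mo' where "mo' = mo - Poly_Mapping.single i e"
    have mo: "mo = mo' + Poly_Mapping.single i e"
      unfolding mo'_def e_def by (rule monomial_split) simp
    have "i \<notin> Poly_Mapping.keys mo'"
      by (simp add: in_keys_iff mo'_def e_def lookup_minus)
    then have mo'_\<sigma>: "mmon ?\<sigma> mo' = mmon mvar mo'"
      unfolding mmon_def by (intro prod.cong) auto
    obtain R where R: "(mvar i + l) ^ e = mvar i ^ e + l * (of_nat e * mvar i ^ (e - 1)) + l ^ 2 * R"
      by (rule power_add_taylor)
    have "mconst c * mmon mvar mo' * (of_nat e * mvar i ^ (e - 1)) =
        (Poly_Mapping.single (mo - Poly_Mapping.single i 1) (of_nat e * c) :: 'a mpoly)"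
    proof (cases e)
      case (Suc e')
      then have "mo - Poly_Mapping.single i 1 = mo' + Poly_Mapping.single i e'"
        by (intro poly_mapping_eqI) (auto simp: mo lookup_add lookup_minus lookup_single when_def)
      then show ?thesis
        using Suc by (simp add: single_eq_mconst_mmon mmon_add mconst_mult mconst.hom_of_nat mconst_add mult_ac)
    qed simp
    moreover have "subst ?\<sigma> (Poly_Mapping.single mo c) = mconst c * mmon mvar mo' * (mvar i + l) ^ e"
      by (simp add: subst_single mo mmon_add mo'_\<sigma> mult.assoc)
    moreover have "mconst c * mmon mvar mo' * mvar i ^ e = Poly_Mapping.single mo c"
      by (simp add: single_eq_mconst_mmon mo mmon_add mult.assoc)
    ultimately have "subst ?\<sigma> (Poly_Mapping.single mo c) = Poly_Mapping.single mo c +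
       l * Poly_Mapping.single (mo - Poly_Mapping.single i 1) (of_nat e * c) + l ^ 2 * (mconst c * mmon mvar mo' * R)"
      by (simp add: R distrib_left mult.left_commute)
    then show ?thesis
      unfolding e_def by blast
  qed
  then obtain R where R: "\<And>mo c. subst ?\<sigma> (Poly_Mapping.single mo c) = Poly_Mapping.single mo c +
     l * Poly_Mapping.single (mo - Poly_Mapping.single i 1) (of_nat (Poly_Mapping.lookup mo i) * c) + l ^ 2 * R mo c"
    by metis
  let ?s = "\<lambda>mo. Poly_Mapping.single mo (Poly_Mapping.lookup P mo)"
  have "subst ?\<sigma> P = (\<Sum>mo\<in>Poly_Mapping.keys P. subst ?\<sigma> (?s mo))"
    unfolding subst.hom_sum[symmetric] by (simp flip: poly_mapping_sum_single)
  also have "\<dots> = (\<Sum>mo\<in>Poly_Mapping.keys P. ?s mo) + l * mderiv i P + l ^ 2 * (\<Sum>mo\<in>Poly_Mapping.keys P. R mo (Poly_Mapping.lookup P mo))"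
    by (simp add: R mderiv_def sum.distrib sum_distrib_left)
  also have "(\<Sum>mo\<in>Poly_Mapping.keys P. ?s mo) = P"
    by (simp flip: poly_mapping_sum_single)
  finally show ?thesis
    by (rule that)
qed

text \<open>Lowering the exponent at \<open>i\<close> is injective on monomials containing x_i. The
  others, where the subtraction is truncated, enter \<open>mderiv\<close> with coefficient
  0.\<close>

lemma lookup_mderiv:
  assumes "Poly_Mapping.lookup mo i \<noteq> 0"
  shows "Poly_Mapping.lookup (mderiv i P) (mo - Poly_Mapping.single i 1) =
    of_nat (Poly_Mapping.lookup mo i) * Poly_Mapping.lookup P (mo :: nat \<Rightarrow>\<^sub>0 nat)"
proof -
  have uniq: "mo' = mo" if "mo' - Poly_Mapping.single i 1 = mo - Poly_Mapping.single i 1" "Poly_Mapping.lookup mo' i \<noteq> 0" for mo'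
  proof (rule poly_mapping_eqI)
    fix k
    have "Poly_Mapping.lookup (mo' - Poly_Mapping.single i 1) k = Poly_Mapping.lookup (mo - Poly_Mapping.single i 1) k"
      using that(1) by simp
    then show "Poly_Mapping.lookup mo' k = Poly_Mapping.lookup mo k"
      using that(2) assms by (cases "k = i") (auto simp: lookup_minus lookup_single when_def)
  qed
  have "Poly_Mapping.lookup (mderiv i P) (mo - Poly_Mapping.single i 1) =
     (\<Sum>mo'\<in>Poly_Mapping.keys P. if mo' = mo then of_nat (Poly_Mapping.lookup mo i) * Poly_Mapping.lookup P mo else 0)"
    unfolding mderiv_def lookup_sum
  proof (rule sum.cong[OF refl])
    fix mo'
    show "Poly_Mapping.lookup (Poly_Mapping.single (mo' - Poly_Mapping.single i 1)
        (of_nat (Poly_Mapping.lookup mo' i) * Poly_Mapping.lookup P mo')) (mo - Poly_Mapping.single i 1) =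
      (if mo' = mo then of_nat (Poly_Mapping.lookup mo i) * Poly_Mapping.lookup P mo else 0)"
      using uniq[of mo'] by (cases "Poly_Mapping.lookup mo' i = 0") (auto simp: lookup_single when_def)
  qed
  then show ?thesis
    by (simp add: in_keys_iff)
qed

lemma mvars_mderiv: "mvars (mderiv i P) \<subseteq> mvars P"
proof -
  have "mvars (Poly_Mapping.single (mo - Poly_Mapping.single i 1) c) \<subseteq> mvars P" if "mo \<in> Poly_Mapping.keys P" for mo and c :: 'a
    using that by (auto simp: mvars_def in_keys_iff lookup_minus split: if_splits)
  then show ?thesis
    unfolding mderiv_def by (intro order.trans[OF mvars_sum] UN_least)
qed

section \<open>q-th powers and q-th roots\<close>

abbreviation dilate :: "nat \<Rightarrow> (nat \<Rightarrow>\<^sub>0 nat) \<Rightarrow> nat \<Rightarrow>\<^sub>0 nat" where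
  "dilate k \<equiv> Poly_Mapping.map ((*) k)"

lemma lookup_map_0: "f 0 = 0 \<Longrightarrow> Poly_Mapping.lookup (Poly_Mapping.map f p) k = f (Poly_Mapping.lookup p k)"
  by (simp add: map.rep_eq when_def)

lemma single_power: "Poly_Mapping.single mo c ^ k = Poly_Mapping.single (dilate k mo) ((c :: 'a::comm_ring_1) ^ k)"
proof (induction k)
  case 0
  have "dilate 0 mo = 0"
    by (rule poly_mapping_eqI) (simp add: lookup_map_0)
  then show ?case
    unfolding power_0 by (metis single_one)
next
  case (Suc k)
  have "mo + dilate k mo = dilate (Suc k) mo"
    by (rule poly_mapping_eqI) (simp add: lookup_map_0 lookup_add)
  then show ?case
    unfolding power_Suc Suc by (simp only: mult_single)
qed

lemma dilate_inj: "0 < k \<Longrightarrow> dilate k mo = dilate k mo' \<Longrightarrow> mo = mo'"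
proof (rule poly_mapping_eqI)
  fix t assume "0 < k" "dilate k mo = dilate k mo'"
  then show "Poly_Mapping.lookup mo t = Poly_Mapping.lookup mo' t"
    using lookup_map_0[of "(*) k" mo t] lookup_map_0[of "(*) k" mo' t] by simp
qed

context prime_field
begin

lemma frob_sum_q: "(\<Sum>i\<in>A. f i :: 'a mpoly) ^ q = (\<Sum>i\<in>A. f i ^ q)"
  using frob_sum[of f A 1] by simp

text \<open>Frobenius fixes the coefficients, so only the exponents change. The two lemmas on the
  ideal and on roots rest on this.\<close>

lemma power_q_eq: "(P :: 'a mpoly) ^ q =
  (\<Sum>mo\<in>Poly_Mapping.keys P. Poly_Mapping.single (dilate q mo) (Poly_Mapping.lookup P mo))"
proof -
  have "P ^ q = (\<Sum>mo\<in>Poly_Mapping.keys P. Poly_Mapping.single mo (Poly_Mapping.lookup P mo)) ^ q"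
    by (simp flip: poly_mapping_sum_single)
  also have "\<dots> = (\<Sum>mo\<in>Poly_Mapping.keys P. Poly_Mapping.single mo (Poly_Mapping.lookup P mo) ^ q)"
    by (rule frob_sum_q)
  finally show ?thesis
    by (simp add: single_power coeff_frob)
qed

lemma lookup_power_q: "Poly_Mapping.lookup ((P :: 'a mpoly) ^ q) (dilate q mo) = Poly_Mapping.lookup P mo"
proof -
  have "Poly_Mapping.lookup (P ^ q) (dilate q mo) = (\<Sum>mo'\<in>Poly_Mapping.keys P. if mo' = mo then Poly_Mapping.lookup P mo' else 0)"
    unfolding power_q_eq lookup_sum using q_gt_1
    by (intro sum.cong) (auto simp: lookup_single when_def dest: dilate_inj[rotated])
  then show ?thesis
    by (simp add: in_keys_iff)
qed

lemma power_q_pow_ideal_iff: "(P :: 'a mpoly) ^ q \<in> pow_ideal (q ^ Suc b) \<longleftrightarrow> P \<in> pow_ideal (q ^ b)"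
proof
  assume *: "P ^ q \<in> pow_ideal (q ^ Suc b)"
  show "P \<in> pow_ideal (q ^ b)"
    unfolding pow_ideal_def
  proof (intro CollectI ballI)
    fix mo assume "mo \<in> Poly_Mapping.keys P"
    then have "dilate q mo \<in> Poly_Mapping.keys (P ^ q)"
      by (simp add: in_keys_iff lookup_power_q)
    then obtain t where "q ^ Suc b \<le> Poly_Mapping.lookup (dilate q mo) t"
      using * by (auto simp: pow_ideal_def)
    then show "\<exists>t. q ^ b \<le> Poly_Mapping.lookup mo t"
      using q_gt_1 by (auto simp: lookup_map_0)
  qed
next
  assume *: "P \<in> pow_ideal (q ^ b)"
  show "P ^ q \<in> pow_ideal (q ^ Suc b)"
    unfolding power_q_eq
  proof (rule pow_ideal_sum)
    fix mo assume "mo \<in> Poly_Mapping.keys P"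
    then show "Poly_Mapping.single (dilate q mo) (Poly_Mapping.lookup P mo) \<in> pow_ideal (q ^ Suc b)"
      using * by (auto simp: pow_ideal_def lookup_map_0)
  qed
qed

lemma power_q_root:
  assumes "\<And>mo t. mo \<in> Poly_Mapping.keys P \<Longrightarrow> q dvd Poly_Mapping.lookup mo t"
  obtains V where "(P :: 'a mpoly) = V ^ q" "mvars V \<subseteq> mvars P"
proof
  let ?r = "Poly_Mapping.map (\<lambda>x. x div q) :: (nat \<Rightarrow>\<^sub>0 nat) \<Rightarrow> _"
  let ?V = "\<Sum>mo\<in>Poly_Mapping.keys P. Poly_Mapping.single (?r mo) (Poly_Mapping.lookup P mo)"
  have "dilate q (?r mo) = mo" if "mo \<in> Poly_Mapping.keys P" for mo
    by (rule poly_mapping_eqI) (use assms[OF that] in \<open>simp add: lookup_map_0\<close>)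
  then have "P = (\<Sum>mo\<in>Poly_Mapping.keys P. Poly_Mapping.single (dilate q (?r mo)) (Poly_Mapping.lookup P mo))"
    by (subst poly_mapping_sum_single) (intro sum.cong, simp_all)
  also have "\<dots> = (\<Sum>mo\<in>Poly_Mapping.keys P. Poly_Mapping.single (?r mo) (Poly_Mapping.lookup P mo) ^ q)"
    by (simp add: single_power coeff_frob)
  also have "\<dots> = ?V ^ q"
    by (rule frob_sum_q[symmetric])
  finally show "P = ?V ^ q" .
  have "mvars (Poly_Mapping.single (?r mo) c) \<subseteq> mvars P" if "mo \<in> Poly_Mapping.keys P" for mo and c :: 'a
  proof -
    have "Poly_Mapping.keys (?r mo) \<subseteq> Poly_Mapping.keys mo"
      using div_0 by (auto simp: in_keys_iff lookup_map_0 intro!: gr0I)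
    then show ?thesis
      using that by (auto simp: mvars_def)
  qed
  then show "mvars ?V \<subseteq> mvars P"
    by (intro order.trans[OF mvars_sum] UN_least)
qed

section \<open>Independence and spanning\<close>

text \<open>The pairs of sequences \<open>(I; J)\<close>, zipped into one list.\<close>
definition idx :: "nat \<Rightarrow> nat \<Rightarrow> (nat \<times> nat) list set" where
  "idx m n = {l. 1 \<le> length l \<and> length l \<le> min n (m + 1) \<and> sum_list (map fst l) = n - length l \<and>
      (\<forall>t < length l - 1. snd (l ! t) < q ^ (m - t) - 1) \<and>
      snd (l ! (length l - 1)) \<le> q ^ (m + 1 - length l) - 1}"

text \<open>Raising i_1 by one is one more application of \<delta> with a = 1; see
  \<open>ypoly_inc_head\<close>.\<close>

fun inc_head :: "(nat \<times> nat) list \<Rightarrow> (nat \<times> nat) list" where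
  "inc_head [] = []"
| "inc_head ((i, j) # r) = (Suc i, j) # r"

lemma inc_head_inj: "l \<noteq> [] \<Longrightarrow> l' \<noteq> [] \<Longrightarrow> inc_head l = inc_head l' \<Longrightarrow> l = l'"
  by (cases l; cases l') auto

lemma idx_nonempty: "l \<in> idx m n \<Longrightarrow> l \<noteq> []"
  by (auto simp: idx_def)

lemma Bset_eq: "Bset m n = (\<lambda>l. Fract (ypoly m 1 l) 1 :: 'a ratfun) ` idx m n"
proof (intro Set.set_eqI iffI)
  fix y :: "'a ratfun" assume "y \<in> Bset m n"
  then obtain I J k where IJ: "y = Y m I J" "1 \<le> k" "k \<le> min n (m + 1)" "length I = k" "length J = k"
      "sum_list I = n - k" "\<forall>t < k - 1. J ! t < q ^ (m - t) - 1" "J ! (k - 1) \<le> q ^ (m + 1 - k) - 1"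
    by (auto simp: Bset_def)
  then have "zip I J \<in> idx m n"
    by (simp add: idx_def)
  moreover have "y = Fract (ypoly m 1 (zip I J)) 1"
    by (simp add: IJ(1) Y_def Yaux_Fract)
  ultimately show "y \<in> (\<lambda>l. Fract (ypoly m 1 l) 1) ` idx m n"
    by blast
next
  fix y :: "'a ratfun" assume "y \<in> (\<lambda>l. Fract (ypoly m 1 l) 1) ` idx m n"
  then obtain l where l: "l \<in> idx m n" "y = Fract (ypoly m 1 l) 1"
    by blast
  have "y = Y m (map fst l) (map snd l)"
    by (simp add: l(2) Y_def Yaux_Fract zip_map_fst_snd)
  then show "y \<in> Bset m n"
    using l(1) unfolding Bset_def idx_def
    by (intro CollectI exI[of _ "map fst l"] exI[of _ "map snd l"] exI[of _ "length l"]) auto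
qed

lemma Bpoly_eq: "Bpoly m n = (ypoly m 1 ` idx m n :: 'a mpoly set)"
  by (auto simp: Bpoly_def Bset_eq)

lemma mvars_ypoly_idx: "l \<in> idx m n \<Longrightarrow> mvars (ypoly m 1 l) \<subseteq> {1..n}"
  using mvars_ypoly[of 1 m l] by (auto simp: idx_def)

lemma idx_1: "idx m 1 = (\<lambda>j. [(0, j)]) ` {..q ^ m - 1}"
proof (intro Set.set_eqI iffI)
  fix l assume "l \<in> idx m 1"
  then obtain i j where "l = [(i, j)]"
    by (cases l) (auto simp: idx_def)
  then show "l \<in> (\<lambda>j. [(0, j)]) ` {..q ^ m - 1}"
    using \<open>l \<in> idx m 1\<close> by (auto simp: idx_def)
qed (auto simp: idx_def)

text \<open>Split by whether i_1 is 0. If it is, n + 1 > 1 forces a second pair, so the bound on j_1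
  is the strict one, and the tail satisfies the bounds for m - 1. For m = 0 that part is empty, so
  the truncation in \<open>m - 1\<close> does no harm.\<close>

lemma idx_Suc:
  assumes "1 \<le> n"
  shows "idx m (Suc n) = inc_head ` idx m n \<union> (\<lambda>(j, r). (0, j) # r) ` ({..<q ^ m - 1} \<times> idx (m - 1) n)"
proof (intro Set.set_eqI iffI)
  fix l assume l: "l \<in> idx m (Suc n)"
  then obtain i j r where ijr: "l = (i, j) # r"
    by (cases l) (auto simp: idx_def)
  show "l \<in> inc_head ` idx m n \<union> (\<lambda>(j, r). (0, j) # r) ` ({..<q ^ m - 1} \<times> idx (m - 1) n)"
  proof (cases i)
    case 0
    have r: "r \<noteq> []"
      using l assms by (auto simp: idx_def ijr 0)
    then have m: "1 \<le> m"
      using l by (cases r) (auto simp: idx_def ijr)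
    have j: "j < q ^ m - 1"
      using l r by (auto simp: idx_def ijr)
    have "snd (r ! t) < q ^ (m - 1 - t) - 1" if "t < length r - 1" for t
    proof -
      have "\<forall>t < length r. snd (l ! t) < q ^ (m - t) - 1"
        using l by (simp add: idx_def ijr)
      then have "snd (l ! Suc t) < q ^ (m - Suc t) - 1"
        using that by simp
      then show ?thesis
        by (simp add: ijr)
    qed
    moreover have "snd (r ! (length r - 1)) \<le> q ^ (m - 1 + 1 - length r) - 1"
      using l r m by (simp add: idx_def ijr nth_Cons')
    ultimately have "r \<in> idx (m - 1) n"
      using l r m 0 by (auto simp: idx_def ijr Suc_le_eq)
    then show ?thesis
      using j by (auto simp: ijr 0)
  next
    case (Suc i')
    have "(i', j) # r \<in> idx m n"
      using l by (auto simp: idx_def ijr Suc nth_Cons')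
    then show ?thesis
      by (auto simp: ijr Suc image_iff intro!: bexI[of _ "(i', j) # r"])
  qed
next
  fix l assume "l \<in> inc_head ` idx m n \<union> (\<lambda>(j, r). (0, j) # r) ` ({..<q ^ m - 1} \<times> idx (m - 1) n)"
  then show "l \<in> idx m (Suc n)"
  proof
    assume "l \<in> inc_head ` idx m n"
    then obtain l' where l': "l' \<in> idx m n" "l = inc_head l'"
      by blast
    then obtain i j r where "l' = (i, j) # r"
      by (cases l') (auto simp: idx_def)
    then show ?thesis
      using l' by (auto simp: idx_def nth_Cons')
  next
    assume "l \<in> (\<lambda>(j, r). (0, j) # r) ` ({..<q ^ m - 1} \<times> idx (m - 1) n)"
    then obtain j r where jr: "l = (0, j) # r" "j < q ^ m - 1" "r \<in> idx (m - 1) n"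
      by auto
    then have m: "1 \<le> m"
      by (cases m) auto
    have "snd (l ! t) < q ^ (m - t) - 1" if "t < length r" for t
    proof (cases t)
      case (Suc t')
      have "snd (r ! t') < q ^ (m - 1 - t') - 1"
        using that jr(3) Suc by (auto simp: idx_def)
      then show ?thesis
        by (simp add: jr(1) Suc)
    qed (use jr in simp)
    moreover have "r \<noteq> []"
      using jr(3) by (rule idx_nonempty)
    ultimately show ?thesis
      using jr m by (auto simp: idx_def nth_Cons')
  qed
qed

lemma finite_idx: "1 \<le> n \<Longrightarrow> finite (idx m n)"
proof (induction n arbitrary: m rule: nat_induct_at_least)
  case base
  then show ?case
    by (simp only: idx_1) simp
next
  case (Suc n)
  then show ?case
    by (simp add: idx_Suc)
qed

lemma sum_idx_Suc:
  assumes "1 \<le> n"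
  shows "(\<Sum>l\<in>idx m (Suc n). g l) =
    (\<Sum>j<q ^ m - 1. \<Sum>r\<in>idx (m - 1) n. g ((0, j) # r)) + (\<Sum>l\<in>idx m n. g (inc_head l) :: 'b::comm_monoid_add)"
proof -
  let ?c = "\<lambda>(j, r). (0 :: nat, j :: nat) # r"
  have disj: "inc_head ` idx m n \<inter> ?c ` ({..<q ^ m - 1} \<times> idx (m - 1) n) = {}"
  proof -
    have "inc_head l \<noteq> (0, j) # r" for l j r
      by (cases l rule: inc_head.cases) auto
    then show ?thesis
      by auto
  qed
  have "inj_on inc_head (idx m n)"
    by (rule inj_onI) (auto dest: idx_nonempty intro: inc_head_inj)
  moreover have "inj_on ?c ({..<q ^ m - 1} \<times> idx (m - 1) n)"
    by (auto simp: inj_on_def)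
  ultimately show ?thesis
    unfolding idx_Suc[OF assms]
    by (subst sum.union_disjoint[OF _ _ disj])
       (simp_all add: finite_idx[OF assms] sum.reindex sum.cartesian_product case_prod_unfold add.commute)
qed

lemma muiV_1: "muiV (Suc 0) = (mvar (Suc 0) :: 'a mpoly)"
  using lspan_1 by (simp add: muiV_lspan)

lemma ypoly_inc_head:
  assumes "l \<noteq> []"
  shows "ypoly m (Suc 0) (inc_head l) = mvar (Suc 0) ^ (q ^ m - 1) * shift (ypoly m (Suc 0) l)"
  using assms dl_1[of m "ypoly m (Suc 0) l"] by (cases l rule: inc_head.cases) simp_all

lemma ypoly_Cons_0: "ypoly m (Suc 0) ((0, j) # r) = mvar (Suc 0) ^ j * ypoly m (Suc (Suc 0)) r"
  by (simp add: muiV_1)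

lemma red1_sum_ypoly:
  "red1 (\<Sum>r\<in>A. mconst (c r) * ypoly (Suc b) (Suc (Suc 0)) r) =
   shift (\<Sum>r\<in>A. mconst (c r) * ypoly b (Suc 0) r) ^ q"
proof -
  have "red1 (\<Sum>r\<in>A. mconst (c r) * ypoly (Suc b) (Suc (Suc 0)) r) =
      (\<Sum>r\<in>A. mconst (c r) * red1 (ypoly (Suc b) (Suc (Suc 0)) r))"
    by (simp only: subst.hom_sum subst.hom_mult subst_mconst)
  also have "\<dots> = (\<Sum>r\<in>A. mconst (c r) * shift (ypoly b (Suc 0) r) ^ q)"
    by (simp only: red1_ypoly le_refl One_nat_def)
  also have "\<dots> = (\<Sum>r\<in>A. mconst (c r) * shift (ypoly b (Suc 0) r)) ^ q"
    using frob_lincomb[of c _ A 1] by simp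
  finally show ?thesis
    by (simp only: subst.hom_sum subst.hom_mult subst_mconst)
qed

lemma q_pow_pos: "0 < q ^ m"
  using q_gt_1 by simp

lemma Suc_0_notin_mvars_red1: "Suc 0 \<notin> mvars (red1 P)"
  using mvars_red1[of P] by blast

lemma Suc_0_notin_mvars_shift: "Suc 0 \<notin> mvars (shift P)"
  using Suc_0_notin_mvars_red1[of "shift P"] by simp

section \<open>Linear independence modulo the ideal\<close>

lemma ypoly_independent:
  assumes "1 \<le> n" "(\<Sum>l\<in>idx m n. mconst (c l) * ypoly m (Suc 0) l) \<in> pow_ideal (q ^ m)" "l \<in> idx m n"
  shows "c l = 0"
  using assms
proof (induction n arbitrary: m c l rule: nat_induct_at_least)
  case base
  define P where "P = (\<Sum>l\<in>idx m 1. mconst (c l) * ypoly m (Suc 0) l)"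
  have inj: "inj_on (\<lambda>j. [(0 :: nat, j :: nat)]) {..q ^ m - 1}"
    by (auto simp: inj_on_def)
  have "P = (\<Sum>j\<le>q ^ m - 1. mconst (c [(0, j)]) * mvar 1 ^ j)"
    unfolding P_def idx_1 sum.reindex[OF inj] by (simp add: muiV_1)
  then have P: "P = (\<Sum>j\<le>q ^ m - 1. Poly_Mapping.single (Poly_Mapping.single (Suc 0) j) (c [(0, j)]))"
    by (simp add: mvar_power mconst_def mult_single)
  obtain j where j: "j \<le> q ^ m - 1" "l = [(0, j)]"
    using base(2) by (auto simp: idx_1[simplified])
  have "Poly_Mapping.lookup P (Poly_Mapping.single (Suc 0) j) = (\<Sum>k\<le>q ^ m - 1. if k = j then c [(0, k)] else 0)"
    unfolding P lookup_sum
    by (intro sum.cong refl) (auto simp: lookup_single when_def dest: arg_cong[of _ _ "\<lambda>p. Poly_Mapping.lookup p (Suc 0)"])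
  then have coeff: "Poly_Mapping.lookup P (Poly_Mapping.single (Suc 0) j) = c l"
    using j by simp
  show ?case
  proof (rule ccontr)
    assume "c l \<noteq> 0"
    then have "Poly_Mapping.single (Suc 0) j \<in> Poly_Mapping.keys P"
      using coeff by (simp add: in_keys_iff)
    then obtain t where "q ^ m \<le> Poly_Mapping.lookup (Poly_Mapping.single (Suc 0) j) t"
      using base(1) unfolding P_def[symmetric] by (auto simp: pow_ideal_def)
    then have "q ^ m \<le> j"
      using q_gt_1 by (auto simp: lookup_single when_def split: if_splits)
    then show False
      using j(1) q_pow_pos[of m] by linarith
  qed
next
  case (Suc n)
  let ?x = "mvar (Suc 0) :: 'a mpoly" and ?N = "q ^ m - 1"
  \<comment> \<open>\<open>A j\<close> collects the elements with i_1 = 0 and j_1 = j, freed of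
    x_1^j; \<open>T\<close> collects those with i_1 > 0, freed of one application of
    \<delta>.\<close>
  define A where "A j = (\<Sum>r\<in>idx (m - 1) n. mconst (c ((0, j) # r)) * ypoly m (Suc (Suc 0)) r)" for j
  define T where "T = (\<Sum>l\<in>idx m n. mconst (c (inc_head l)) * ypoly m (Suc 0) l)"
  have N: "?N < q ^ m"
    using q_pow_pos[of m] by simp
  have "(\<Sum>l\<in>idx m n. mconst (c (inc_head l)) * ypoly m (Suc 0) (inc_head l)) = ?x ^ ?N * shift T"
    unfolding T_def subst.hom_sum sum_distrib_left
    by (intro sum.cong refl) (simp add: ypoly_inc_head idx_nonempty subst.hom_mult mult.left_commute)
  then have "(\<Sum>l\<in>idx m (Suc n). mconst (c l) * ypoly m (Suc 0) l) = (\<Sum>j<?N. ?x ^ j * A j) + ?x ^ ?N * shift T"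
    unfolding sum_idx_Suc[OF Suc.hyps] A_def sum_distrib_left ypoly_Cons_0 by (simp add: mult.left_commute)
  then have total: "(\<Sum>j<?N. ?x ^ j * A j) + ?x ^ ?N * shift T \<in> pow_ideal (q ^ m)"
    using Suc.prems(1) by simp
  \<comment> \<open>When all earlier \<open>A k\<close> vanish, \<open>A j\<close> at x_1 = 0 is the
    lowest coefficient of the relation. It is a shifted q-th power of a relation for m - 1 in n
    variables.\<close>
  have low: "\<forall>r\<in>idx (m - 1) n. c ((0, j) # r) = 0" if "j < ?N" for j
    using that
  proof (induction j rule: less_induct)
    case (less j)
    have m: "m = Suc (m - 1)"
      using less.prems by (cases m) auto
    have "A k = 0" if "k < j" for k
      using less.IH[of k] less.prems that by (simp add: A_def)
    then have "(\<Sum>k<?N. ?x ^ k * A k) = (\<Sum>k\<in>{j..<?N}. ?x ^ k * A k)"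
      by (intro sum.mono_neutral_right) auto
    also have "\<dots> = ?x ^ j * A j + (\<Sum>k\<in>{Suc j..<?N}. ?x ^ k * A k)"
      using less.prems by (simp add: sum.atLeast_Suc_lessThan)
    also have "(\<Sum>k\<in>{Suc j..<?N}. ?x ^ k * A k) = ?x ^ Suc j * (\<Sum>k\<in>{Suc j..<?N}. ?x ^ (k - Suc j) * A k)"
      unfolding sum_distrib_left
      by (intro sum.cong refl) (simp add: mult.assoc[symmetric] del: power_Suc flip: power_add)
    finally have 1: "(\<Sum>k<?N. ?x ^ k * A k) =
      ?x ^ j * A j + ?x ^ Suc j * (\<Sum>k\<in>{Suc j..<?N}. ?x ^ (k - Suc j) * A k)" .
    have 2: "?x ^ ?N = ?x ^ Suc j * ?x ^ (?N - Suc j)"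
    proof -
      have "Suc j + (?N - Suc j) = ?N"
        using less.prems by linarith
      then show ?thesis
        by (metis power_add)
    qed
    obtain B where B: "A j = red1 (A j) + ?x * B"
      by (rule red1_decomp)
    have "?x ^ j * red1 (A j) + ?x ^ Suc j * (B + (\<Sum>k\<in>{Suc j..<?N}. ?x ^ (k - Suc j) * A k) + ?x ^ (?N - Suc j) * shift T)
        = (?x ^ j * (red1 (A j) + ?x * B) + ?x ^ Suc j * (\<Sum>k\<in>{Suc j..<?N}. ?x ^ (k - Suc j) * A k)) + ?x ^ ?N * shift T"
      unfolding 2 by (simp add: distrib_left mult_ac add_ac)
    also have "\<dots> = (\<Sum>j<?N. ?x ^ j * A j) + ?x ^ ?N * shift T"
      unfolding B[symmetric] 1 ..
    finally have "?x ^ j * red1 (A j) + ?x ^ Suc j * (B + (\<Sum>k\<in>{Suc j..<?N}. ?x ^ (k - Suc j) * A k) + ?x ^ (?N - Suc j) * shift T)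
        \<in> pow_ideal (q ^ m)"
      using total by (simp only:)
    then have "red1 (A j) \<in> pow_ideal (q ^ m)"
      by (rule lowest_coeff_pow_ideal[OF Suc_0_notin_mvars_red1]) (use less.prems in simp)
    moreover have "red1 (A j) = shift (\<Sum>r\<in>idx (m - 1) n. mconst (c ((0, j) # r)) * ypoly (m - 1) (Suc 0) r) ^ q"
      unfolding A_def using red1_sum_ypoly[where c = "\<lambda>r. c ((0, j) # r)" and b = "m - 1"] by (simp only: m[symmetric])
    ultimately have "shift ((\<Sum>r\<in>idx (m - 1) n. mconst (c ((0, j) # r)) * ypoly (m - 1) (Suc 0) r) ^ q) \<in> pow_ideal (q ^ Suc (m - 1))"
      by (simp only: subst.hom_power m[symmetric])
    then have "(\<Sum>r\<in>idx (m - 1) n. mconst (c ((0, j) # r)) * ypoly (m - 1) (Suc 0) r) \<in> pow_ideal (q ^ (m - 1))"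
      by (simp only: shift_pow_ideal_iff power_q_pow_ideal_iff)
    then show ?case
      using Suc.IH[of "\<lambda>r. c ((0, j) # r)" "m - 1"] by blast
  qed
  then have "A j = 0" if "j < ?N" for j
    using that by (simp add: A_def)
  then have "?x ^ ?N * shift T \<in> pow_ideal (q ^ m)"
    using total by simp
  then have "shift T \<in> pow_ideal (q ^ m)"
    using lowest_coeff_pow_ideal[OF Suc_0_notin_mvars_shift, of "?N" T 0 "q ^ m"] N by simp
  then have "T \<in> pow_ideal (q ^ m)"
    by (simp only: shift_pow_ideal_iff)
  then have high: "c (inc_head l) = 0" if "l \<in> idx m n" for l
    unfolding T_def using Suc.IH[of "\<lambda>l. c (inc_head l)" m] that by blast
  show ?case
    using Suc.prems(2) low high unfolding idx_Suc[OF Suc.hyps] by auto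
qed

section \<open>Spanning of the invariants\<close>

definition span_mod :: "nat \<Rightarrow> nat \<Rightarrow> 'a mpoly \<Rightarrow> bool" where
  "span_mod m n F \<longleftrightarrow> (\<exists>c. F - (\<Sum>l\<in>idx m n. mconst (c l) * ypoly m (Suc 0) l) \<in> pow_ideal (q ^ m))"

lemma span_mod_add:
  assumes "span_mod m n F" "span_mod m n G"
  shows "span_mod m n (F + G)"
proof -
  obtain c d where cd: "F - (\<Sum>l\<in>idx m n. mconst (c l) * ypoly m (Suc 0) l) \<in> pow_ideal (q ^ m)"
    "G - (\<Sum>l\<in>idx m n. mconst (d l) * ypoly m (Suc 0) l) \<in> pow_ideal (q ^ m)"
    using assms by (auto simp: span_mod_def)
  have eq: "F + G - (\<Sum>l\<in>idx m n. mconst (c l + d l) * ypoly m (Suc 0) l) =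
      (F - (\<Sum>l\<in>idx m n. mconst (c l) * ypoly m (Suc 0) l)) + (G - (\<Sum>l\<in>idx m n. mconst (d l) * ypoly m (Suc 0) l))"
    by (simp add: mconst_add distrib_right sum.distrib)
  show ?thesis
    using pow_ideal_add[OF cd] unfolding eq[symmetric] span_mod_def by (rule exI[of _ "\<lambda>l. c l + d l"])
qed

lemma span_mod_pow_ideal: "F \<in> pow_ideal (q ^ m) \<Longrightarrow> span_mod m n F"
  unfolding span_mod_def by (intro exI[of _ "\<lambda>_. 0"]) simp

lemma span_mod_ypoly:
  assumes "1 \<le> n" "l \<in> idx m n"
  shows "span_mod m n (mconst e * ypoly m (Suc 0) l)"
proof -
  have "(\<Sum>k\<in>idx m n. mconst (if k = l then e else 0) * ypoly m (Suc 0) k) =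
      (\<Sum>k\<in>idx m n. if k = l then mconst e * ypoly m (Suc 0) k else 0)"
    by (intro sum.cong) auto
  then show ?thesis
    unfolding span_mod_def using finite_idx[OF assms(1)] assms(2)
    by (intro exI[of _ "\<lambda>k. if k = l then e else 0"]) simp
qed

lemma span_mod_sum:
  "(\<And>i. i \<in> A \<Longrightarrow> span_mod m n (f i)) \<Longrightarrow> span_mod m n (sum f A)"
  by (induction A rule: infinite_finite_induct) (auto intro: span_mod_add span_mod_pow_ideal)

lemma fixes_mod_diff:
  "fixes_mod b F \<xi> \<Longrightarrow> fixes_mod b G \<xi> \<Longrightarrow> fixes_mod b (F - G) \<xi>"
proof -
  assume "fixes_mod b F \<xi>" "fixes_mod b G \<xi>"
  moreover have "subst \<xi> (F - G) - (F - G) = (subst \<xi> F - F) - (subst \<xi> G - G)"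
    by (simp add: subst.hom_minus)
  ultimately show ?thesis
    unfolding fixes_mod_def by (simp only: pow_ideal_diff)
qed

lemma fixes_mod_sum: "(\<And>i. i \<in> A \<Longrightarrow> fixes_mod b (f i) \<xi>) \<Longrightarrow> fixes_mod b (sum f A) \<xi>"
  unfolding fixes_mod_def subst.hom_sum sum_subtractf[symmetric] by (rule pow_ideal_sum)

lemma fixes_mod_scale: "fixes_mod b F \<xi> \<Longrightarrow> fixes_mod b (mconst c * F) \<xi>"
  unfolding fixes_mod_def using pow_ideal_mult[of "subst \<xi> F - F" "q ^ b" "mconst c"]
  by (simp add: subst.hom_mult right_diff_distrib)

lemma fixes_mod_pow_ideal: "F \<in> pow_ideal (q ^ b) \<Longrightarrow> fixes_mod b F (ut n d)"
  unfolding fixes_mod_def using linear_ut[of b n d]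
  by (intro pow_ideal_diff subst_pow_ideal) (auto simp: linear_subst_def)

lemma subst_ut_Suc_0: "ut n d (Suc 0) = mvar (Suc 0)"
  by (simp add: ut_def lincomb_def)

lemma fixes_mod_lowest:
  assumes fixed: "\<And>d. fixes_mod m (mvar (Suc 0) ^ j * F) (ut (Suc n) d)"
    and F: "F = shift u + mvar (Suc 0) * B" and j: "j < q ^ m"
  shows "fixes_mod m u (ut n d)"
proof -
  \<comment> \<open>The matrix \<open>d\<close> moved one step down and to the right, with zero
    first row: x_1 is fixed and the other variables transform among themselves.\<close>
  define d' where "d' k l = (if 2 \<le> k \<and> 2 \<le> l then d (k - 1) (l - 1) else 0)" for k l :: nat
  let ?\<xi> = "ut (Suc n) d'" and ?x = "mvar (Suc 0) :: 'a mpoly"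
  have comm: "?\<xi> (skip_var (Suc 0) i) = shift (ut n d i)" for i
  proof (cases "i \<in> {1..n}")
    case True
    then have "lincomb (\<lambda>k. d' k (Suc i)) (Suc i) = shift (lincomb (\<lambda>k. d' (Suc k) (Suc i)) i)"
      by (subst lincomb_Suc_shift) (auto simp: d'_def)
    also have "lincomb (\<lambda>k. d' (Suc k) (Suc i)) i = lincomb (\<lambda>k. d k i) i"
      unfolding lincomb_def using True by (intro sum.cong) (auto simp: d'_def)
    finally show ?thesis
      using True by (simp add: ut_def skip_var_def subst.hom_add)
  next
    case False
    then show ?thesis
      by (auto simp: ut_def skip_var_def)
  qed
  have "subst ?\<xi> (shift u) = shift (subst (ut n d) u)"
    by (simp only: subst_subst subst_mvar comm)
  then have "subst ?\<xi> (?x ^ j * F) - ?x ^ j * F =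
      ?x ^ j * shift (subst (ut n d) u - u) + ?x ^ Suc j * (subst ?\<xi> B - B)"
    unfolding F subst.hom_mult subst.hom_power subst.hom_add subst_mvar subst_ut_Suc_0 subst.hom_minus
    by (simp add: algebra_simps)
  then have "?x ^ j * shift (subst (ut n d) u - u) + ?x ^ Suc j * (subst ?\<xi> B - B) \<in> pow_ideal (q ^ m)"
    using fixed[of d'] unfolding fixes_mod_def by (simp only:)
  then have "shift (subst (ut n d) u - u) \<in> pow_ideal (q ^ m)"
    using j by (rule lowest_coeff_pow_ideal[OF Suc_0_notin_mvars_shift])
  then show ?thesis
    by (simp only: fixes_mod_def shift_pow_ideal_iff)
qed

text \<open>Under x_i \<mapsto> x_i + x_1 the change of x_1^j F has lowest coefficient the
  derivative of W, at x_1^(j+1), since \<open>B\<close> contributes only from x_1^(j+2) on. That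
  coefficient lies in the ideal because j + 1 < q^m. A monomial outside the ideal stays outside
  after differentiation, so its derivative must have coefficient 0.\<close>

lemma lowest_exponents:
  assumes fixed: "\<And>d. fixes_mod m (mvar (Suc 0) ^ j * F) (ut (Suc n) d)"
    and F: "F = W + mvar (Suc 0) * B" and W: "mvars W \<subseteq> {2..Suc n}" and j: "Suc j < q ^ m"
    and mo: "mo \<in> Poly_Mapping.keys W" "\<And>t. Poly_Mapping.lookup mo t < q ^ m"
  shows "q dvd Poly_Mapping.lookup mo i"
proof (cases "i \<in> {2..Suc n}")
  case False
  moreover have "Poly_Mapping.keys mo \<subseteq> mvars W"
    using mo(1) by (auto simp: mvars_def)
  ultimately have "Poly_Mapping.lookup mo i = 0"
    using W by (metis in_keys_iff subsetD)
  then show ?thesis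
    by simp
next
  case True
  let ?x = "mvar (Suc 0) :: 'a mpoly"
  define \<sigma> where "\<sigma> = mvar(i := mvar i + ?x)"
  have "ut (Suc n) (\<lambda>k l. if k = Suc 0 \<and> l = i then 1 else 0) = \<sigma>"
  proof
    fix k
    have "lincomb (\<lambda>k'. if k' = Suc 0 \<and> k = i then 1 else 0) k = (if k = i then ?x else 0)" if "1 \<le> k"
    proof (cases "k = i")
      case k: True
      have "lincomb (\<lambda>k'. if k' = Suc 0 \<and> k = i then 1 else 0) k = (\<Sum>l\<in>{1..<k}. if l = Suc 0 then ?x else 0)"
        unfolding lincomb_def using k by (intro sum.cong) auto
      then show ?thesis
        using True k by simp
    qed (simp add: lincomb_def)
    then show "ut (Suc n) (\<lambda>k l. if k = Suc 0 \<and> l = i then 1 else 0) k = \<sigma> k"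
      using True by (auto simp: ut_def \<sigma>_def)
  qed
  then have fix\<sigma>: "subst \<sigma> (?x ^ j * F) - ?x ^ j * F \<in> pow_ideal (q ^ m)"
    using fixed[of "\<lambda>k l. if k = Suc 0 \<and> l = i then 1 else 0"] by (simp add: fixes_mod_def)
  have \<sigma>x: "\<sigma> (Suc 0) = ?x"
    using True by (simp add: \<sigma>_def)
  obtain R where R: "subst \<sigma> W = W + ?x * mderiv i W + ?x ^ 2 * R"
    unfolding \<sigma>_def by (rule subst_taylor)
  have "?x dvd subst \<sigma> B - subst mvar B"
    by (rule dvd_subst_diff) (auto simp: \<sigma>_def)
  then obtain C where C: "subst \<sigma> B - B = ?x * C"
    by auto
  have "subst \<sigma> (?x ^ j * F) - ?x ^ j * F = ?x ^ j * (subst \<sigma> W - W + ?x * (subst \<sigma> B - B))"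
    unfolding F subst.hom_mult subst.hom_power subst.hom_add subst_mvar \<sigma>x by (simp add: algebra_simps)
  also have "\<dots> = ?x ^ Suc j * mderiv i W + ?x ^ Suc (Suc j) * (R + C)"
    unfolding C R by (simp add: algebra_simps power2_eq_square)
  finally have "?x ^ Suc j * mderiv i W + ?x ^ Suc (Suc j) * (R + C) \<in> pow_ideal (q ^ m)"
    using fix\<sigma> by (simp only:)
  moreover have "Suc 0 \<notin> mvars (mderiv i W)"
    using mvars_mderiv[of i W] W by auto
  ultimately have D: "mderiv i W \<in> pow_ideal (q ^ m)"
    using j lowest_coeff_pow_ideal by blast
  show ?thesis
  proof (rule ccontr)
    assume ndvd: "\<not> q dvd Poly_Mapping.lookup mo i"
    then have "of_nat (Poly_Mapping.lookup mo i) \<noteq> (0 :: 'a)"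
      by (simp add: of_nat_eq_0_iff_char_dvd CHAR_eq)
    moreover have "Poly_Mapping.lookup mo i \<noteq> 0"
      using ndvd by (metis dvd_0_right)
    ultimately have "mo - Poly_Mapping.single i 1 \<in> Poly_Mapping.keys (mderiv i W)"
      using mo(1) unfolding in_keys_iff by (subst lookup_mderiv) auto
    then obtain t where "q ^ m \<le> Poly_Mapping.lookup (mo - Poly_Mapping.single i 1) t"
      using D by (auto simp: pow_ideal_def)
    also have "\<dots> \<le> Poly_Mapping.lookup mo t"
      by (simp add: lookup_minus)
    finally show False
      using mo(2)[of t] by simp
  qed
qed

text \<open>\<open>lowest_exponents\<close> says nothing about monomials that lie in the ideal;
  these are gathered in \<open>E\<close>.\<close>

lemma split_reduced:
  assumes "\<And>mo t. mo \<in> Poly_Mapping.keys W \<Longrightarrow> (\<And>t. Poly_Mapping.lookup mo t < Q) \<Longrightarrow> q dvd Poly_Mapping.lookup mo t"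
  obtains V E where "(W :: 'a mpoly) = V ^ q + E" "E \<in> pow_ideal Q" "mvars V \<subseteq> mvars W"
proof -
  define K where "K = {mo \<in> Poly_Mapping.keys W. \<forall>t. Poly_Mapping.lookup mo t < Q}"
  define W1 where "W1 = (\<Sum>mo\<in>K. Poly_Mapping.single mo (Poly_Mapping.lookup W mo))"
  define E where "E = (\<Sum>mo\<in>Poly_Mapping.keys W - K. Poly_Mapping.single mo (Poly_Mapping.lookup W mo))"
  have KW: "K \<subseteq> Poly_Mapping.keys W"
    by (auto simp: K_def)
  then have fin: "finite K"
    by (rule finite_subset) simp
  have "W = W1 + E"
    unfolding W1_def E_def using KW
    by (subst poly_mapping_sum_single) (simp add: sum.subset_diff add.commute)
  moreover have E: "E \<in> pow_ideal Q"
    unfolding E_def by (rule pow_ideal_sum) (auto simp: pow_ideal_def K_def not_less)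
  moreover have "Poly_Mapping.keys W1 \<subseteq> K"
    unfolding W1_def by (rule order.trans[OF keys_sum]) (auto split: if_splits)
  then have "q dvd Poly_Mapping.lookup mo t" if "mo \<in> Poly_Mapping.keys W1" for mo t
    using that assms by (auto simp: K_def)
  then obtain V where V: "W1 = V ^ q" "mvars V \<subseteq> mvars W1"
    by (rule power_q_root)
  moreover have "mvars W1 \<subseteq> mvars W"
    using \<open>Poly_Mapping.keys W1 \<subseteq> K\<close> KW by (auto simp: mvars_def)
  ultimately show ?thesis
    using that by blast
qed

lemma ypoly_span:
  assumes "1 \<le> n" "mvars f \<subseteq> {1..n}" "\<And>d. fixes_mod m f (ut n d)"
  shows "span_mod m n f"
  using assms
proof (induction n arbitrary: m f rule: nat_induct_at_least)
  case base
  let ?g = "\<lambda>j. Poly_Mapping.single (Poly_Mapping.single (Suc 0) j) (Poly_Mapping.lookup f (Poly_Mapping.single (Suc 0) j))"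
  define P where "P = (\<Sum>j\<le>q ^ m - 1. ?g j)"
  have "f - P \<in> pow_ideal (q ^ m)"
    unfolding pow_ideal_def
  proof (intro CollectI ballI)
    fix mo assume mo: "mo \<in> Poly_Mapping.keys (f - P)"
    have "mvars P \<subseteq> {1}"
      unfolding P_def by (intro order.trans[OF mvars_sum] UN_least) (auto simp: mvars_def split: if_splits)
    then have "mvars (f - P) \<subseteq> {1}"
      using mvars_diff[of f P] base(1) by auto
    then have "Poly_Mapping.keys mo \<subseteq> {1}"
      using mo by (auto simp: mvars_def)
    then have mo1: "mo = Poly_Mapping.single (Suc 0) (Poly_Mapping.lookup mo (Suc 0))"
      by (intro poly_mapping_eqI) (auto simp: lookup_single when_def in_keys_iff)
    define e where "e = Poly_Mapping.lookup mo (Suc 0)"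
    have "\<not> e < q ^ m"
    proof
      assume e: "e < q ^ m"
      have "Poly_Mapping.lookup P mo = (\<Sum>j\<le>q ^ m - 1. if j = e then Poly_Mapping.lookup f mo else 0)"
        unfolding P_def lookup_sum
      proof (rule sum.cong[OF refl])
        fix j
        show "Poly_Mapping.lookup (?g j) mo = (if j = e then Poly_Mapping.lookup f mo else 0)"
          using mo1 by (auto simp: lookup_single when_def e_def)
      qed
      then have "Poly_Mapping.lookup (f - P) mo = 0"
        using e by (simp add: lookup_minus)
      then show False
        using mo by (simp add: in_keys_iff)
    qed
    then show "\<exists>t. q ^ m \<le> Poly_Mapping.lookup mo t"
      unfolding e_def by (intro exI[of _ "Suc 0"]) simp
  qed
  moreover have "P = (\<Sum>l\<in>idx m 1. mconst (Poly_Mapping.lookup f (Poly_Mapping.single (Suc 0) (snd (hd l)))) * ypoly m (Suc 0) l)"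
  proof -
    have inj: "inj_on (\<lambda>j. [(0 :: nat, j :: nat)]) {..q ^ m - 1}"
      by (auto simp: inj_on_def)
    show ?thesis
      unfolding P_def idx_1 sum.reindex[OF inj] by (simp add: muiV_1 mvar_power mconst_def mult_single)
  qed
  ultimately show ?case
    unfolding span_mod_def by (intro exI[of _ "\<lambda>l. Poly_Mapping.lookup f (Poly_Mapping.single (Suc 0) (snd (hd l)))"]) simp
next
  case (Suc n)
  let ?x = "mvar (Suc 0) :: 'a mpoly" and ?N = "q ^ m - 1"
  have N: "Suc ?N = q ^ m"
    using q_pow_pos[of m] by simp
  have fixed_ypoly: "fixes_mod m (ypoly m (Suc 0) l) (ut (Suc n) d)" for l d
    using fixes_mod_ypoly[of m l] by simp
  \<comment> \<open>The claim is widened to invariants divisible by x_1^j and proved by descending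
    induction: each step removes the lowest coefficient and leaves an invariant divisible by
    x_1^(j+1). The case j = 0 is the goal.\<close>
  have "span_mod m (Suc n) (?x ^ j * F)"
    if "j \<le> ?N" "mvars F \<subseteq> {1..Suc n}" "\<And>d. fixes_mod m (?x ^ j * F) (ut (Suc n) d)" for j F
    using that
  proof (induction j arbitrary: F rule: inc_induct)
    case base
    obtain B where B: "F = red1 F + ?x * B"
      by (rule red1_decomp)
    have "mvars (red1 F) \<subseteq> {2..Suc n}"
      using mvars_red1[of F] base(1) by (force simp: Suc_le_eq)
    define u where "u = unshift (red1 F)"
    have u: "shift u = red1 F" "mvars u \<subseteq> {1..n}"
      unfolding u_def using \<open>mvars (red1 F) \<subseteq> {2..Suc n}\<close> by (rule shift_unshift, rule mvars_unshift)
    have F: "F = shift u + ?x * B"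
      using B by (simp only: u)
    have "span_mod m n u"
      using fixes_mod_lowest[OF base(2) F] N by (intro Suc.IH u(2)) simp
    then obtain c where c: "u - (\<Sum>l\<in>idx m n. mconst (c l) * ypoly m (Suc 0) l) \<in> pow_ideal (q ^ m)"
      by (auto simp: span_mod_def)
    \<comment> \<open>Here x_1^(N+1) is x_1^(q^m), so everything above the lowest coefficient lies
      in the ideal.\<close>
    have "?x ^ ?N * F = (\<Sum>l\<in>idx m n. mconst (c l) * ypoly m (Suc 0) (inc_head l))
       + (?x ^ ?N * shift (u - (\<Sum>l\<in>idx m n. mconst (c l) * ypoly m (Suc 0) l)) + ?x ^ Suc ?N * B)"
    proof -
      have "(\<Sum>l\<in>idx m n. mconst (c l) * ypoly m (Suc 0) (inc_head l)) =
          ?x ^ ?N * shift (\<Sum>l\<in>idx m n. mconst (c l) * ypoly m (Suc 0) l)"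
        unfolding subst.hom_sum sum_distrib_left
        by (intro sum.cong refl) (simp add: ypoly_inc_head idx_nonempty subst.hom_mult mult.left_commute)
      then show ?thesis
        by (subst F) (simp add: subst.hom_minus algebra_simps)
    qed
    moreover have "span_mod m (Suc n) (\<Sum>l\<in>idx m n. mconst (c l) * ypoly m (Suc 0) (inc_head l))"
      using Suc.hyps by (intro span_mod_sum span_mod_ypoly) (auto simp: idx_Suc)
    moreover have "?x ^ ?N * shift (u - (\<Sum>l\<in>idx m n. mconst (c l) * ypoly m (Suc 0) l)) + ?x ^ Suc ?N * B \<in> pow_ideal (q ^ m)"
      unfolding N using c by (intro pow_ideal_add pow_ideal_mult pow_ideal_mult2[OF pow_ideal_mvar]) (simp add: shift_pow_ideal_iff)
    ultimately show ?case
      by (simp only: span_mod_add span_mod_pow_ideal)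
  next
    case (step j)
    have j: "Suc j < q ^ m" "j < q ^ m" "j < ?N"
      using step.hyps by auto
    then obtain b where m: "m = Suc b"
      by (cases m) auto
    obtain B where B: "F = red1 F + ?x * B"
      by (rule red1_decomp)
    have W: "mvars (red1 F) \<subseteq> {2..Suc n}"
      using mvars_red1[of F] step.prems(1) by (force simp: Suc_le_eq)
    obtain V E where VE: "red1 F = V ^ q + E" "E \<in> pow_ideal (q ^ m)" "mvars V \<subseteq> mvars (red1 F)"
      using split_reduced lowest_exponents[OF step.prems(2) B W j(1)] by blast
    define u where "u = unshift (red1 F)"
    define v where "v = unshift V"
    have u: "shift u = red1 F"
      unfolding u_def using W by (rule shift_unshift)
    have V: "mvars V \<subseteq> {2..Suc n}"
      using VE(3) W by blast
    then have v: "shift v = V" "mvars v \<subseteq> {1..n}"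
      unfolding v_def by (simp_all only: shift_unshift mvars_unshift)
    have uv: "u = v ^ q + unshift E"
      unfolding u_def v_def VE(1) by (simp only: subst.hom_add subst.hom_power)
    have E': "unshift E \<in> pow_ideal (q ^ m)"
      using VE(2) by (rule pow_ideal_shift)
    have F: "F = shift u + ?x * B"
      using B by (simp only: u)
    have "fixes_mod b v (ut n d)" for d
    proof -
      have "fixes_mod m (u - unshift E) (ut n d)"
        using fixes_mod_lowest[OF step.prems(2) F j(2)] E' by (intro fixes_mod_diff[OF _ fixes_mod_pow_ideal])
      then have "subst (ut n d) v ^ q - v ^ q \<in> pow_ideal (q ^ Suc b)"
        by (simp add: uv fixes_mod_def subst.hom_power m)
      also have "subst (ut n d) v ^ q - v ^ q = (subst (ut n d) v - v) ^ q"
        using frob_diff[of _ _ 1] by simp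
      finally show ?thesis
        unfolding power_q_pow_ideal_iff fixes_mod_def .
    qed
    then have "span_mod b n v"
      using v(2) by (intro Suc.IH)
    then obtain c where c: "v - (\<Sum>r\<in>idx b n. mconst (c r) * ypoly b (Suc 0) r) \<in> pow_ideal (q ^ b)"
      by (auto simp: span_mod_def)
    \<comment> \<open>Lifts the expansion of \<open>v\<close> back to m: x_1^j S is a combination of
      basis elements, and at x_1 = 0 it has the lowest coefficient V^q modulo the ideal.\<close>
    define S where "S = (\<Sum>r\<in>idx b n. mconst (c r) * ypoly m (Suc (Suc 0)) r)"
    obtain G where G: "S = red1 S + ?x * G"
      by (rule red1_decomp)
    have "(v - (\<Sum>r\<in>idx b n. mconst (c r) * ypoly b (Suc 0) r)) ^ q \<in> pow_ideal (q ^ m)"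
      using c unfolding m power_q_pow_ideal_iff .
    then have "shift ((v - (\<Sum>r\<in>idx b n. mconst (c r) * ypoly b (Suc 0) r)) ^ q) \<in> pow_ideal (q ^ m)"
      by (simp only: shift_pow_ideal_iff)
    also have "shift ((v - (\<Sum>r\<in>idx b n. mconst (c r) * ypoly b (Suc 0) r)) ^ q) = V ^ q - red1 S"
      unfolding S_def m red1_sum_ypoly subst.hom_power subst.hom_minus v(1) using frob_diff[of _ _ 1] by simp
    finally have VS: "V ^ q - red1 S \<in> pow_ideal (q ^ m)" .
    have FB: "F - red1 F = ?x * B"
      using arg_cong[OF B, of "\<lambda>z. z - red1 F"] by simp
    have SG: "S - red1 S = ?x * G"
      using arg_cong[OF G, of "\<lambda>z. z - red1 S"] by simp
    have S_mvars: "mvars S \<subseteq> {1..Suc n}"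
      unfolding S_def
    proof (intro order.trans[OF mvars_sum] UN_least)
      fix r assume "r \<in> idx b n"
      \<comment> \<open>The head (0, 0) contributes the factor 1; it only makes the known bound on
        the variables applicable to the tail.\<close>
      then have "(0, 0) # r \<in> idx m (Suc n)"
        using Suc.hyps j(3) by (auto simp: idx_Suc m)
      then have "mvars (ypoly m (Suc (Suc 0)) r) \<subseteq> {1..Suc n}"
        using mvars_ypoly_idx[of "(0, 0) # r" m "Suc n"] by (simp add: ypoly_Cons_0)
      then show "mvars (mconst (c r) * ypoly m (Suc (Suc 0)) r) \<subseteq> {1..Suc n}"
        using mvars_mult[of "mconst (c r)" "ypoly m (Suc (Suc 0)) r"] by auto
    qed
    \<comment> \<open>\<open>B\<close> and \<open>G\<close> were obtained without any bound on their
      variables; it is recovered from x_1 (B - G).\<close>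
    have "mvars (F - red1 F - (S - red1 S)) \<subseteq> {1..Suc n}"
      by (intro order.trans[OF mvars_diff] Un_least step.prems(1) S_mvars)
         (use mvars_red1[of F] mvars_red1[of S] step.prems(1) S_mvars in blast)+
    then have "mvars (?x * (B - G)) \<subseteq> {1..Suc n}"
      by (simp only: FB SG right_diff_distrib)
    then have BG: "mvars (B - G) \<subseteq> {1..Suc n}"
      by (rule mvars_quotient[rotated]) simp
    have "?x ^ j * (V ^ q + E + ?x * B) =
        ?x ^ j * (red1 S + ?x * G) + (?x ^ j * (V ^ q - red1 S + E) + ?x ^ Suc j * (B - G))"
      by (simp add: algebra_simps)
    then have eq: "?x ^ j * F = ?x ^ j * S + (?x ^ j * (V ^ q - red1 S + E) + ?x ^ Suc j * (B - G))"
      by (simp only: B[unfolded VE(1), symmetric] G[symmetric])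
    have low: "?x ^ j * (V ^ q - red1 S + E) \<in> pow_ideal (q ^ m)"
      using VS VE(2) by (intro pow_ideal_mult pow_ideal_add)
    have S_eq: "?x ^ j * S = (\<Sum>r\<in>idx b n. mconst (c r) * ypoly m (Suc 0) ((0, j) # r))"
      unfolding S_def sum_distrib_left ypoly_Cons_0 by (simp add: mult.left_commute)
    have "fixes_mod m (?x ^ Suc j * (B - G)) (ut (Suc n) d)" for d
    proof -
      have "fixes_mod m (?x ^ j * S) (ut (Suc n) d)"
        unfolding S_eq by (intro fixes_mod_sum fixes_mod_scale fixed_ypoly)
      then have "fixes_mod m (?x ^ j * F - ?x ^ j * S - ?x ^ j * (V ^ q - red1 S + E)) (ut (Suc n) d)"
        using step.prems(2) fixes_mod_pow_ideal[OF low] by (intro fixes_mod_diff)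
      also have "?x ^ j * F - ?x ^ j * S - ?x ^ j * (V ^ q - red1 S + E) = ?x ^ Suc j * (B - G)"
        unfolding eq by (simp del: power_Suc)
      finally show ?thesis .
    qed
    then have "span_mod m (Suc n) (?x ^ Suc j * (B - G))"
      using BG by (intro step.IH)
    moreover have "span_mod m (Suc n) (?x ^ j * S)"
      unfolding S_eq using Suc.hyps j(3) by (intro span_mod_sum span_mod_ypoly) (auto simp: idx_Suc m)
    ultimately show ?case
      unfolding eq using span_mod_pow_ideal[OF low] by (intro span_mod_add)
  qed
  from this[of 0 f] Suc.prems show ?case
    by simp
qed

end

theorem mainTheorem8:
  fixes p m n :: nat
  assumes "prime p" and "card (UNIV :: ('a::{field,finite}) set) = p" and "1 \<le> n"
  shows "(\<forall>Yv \<in> (Bset m n :: 'a ratfun set). \<exists>P. mvars P \<subseteq> {1..n} \<and> Yv = Fract P 1)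
    \<and> (\<forall>P \<in> (Bpoly m n :: 'a mpoly set). \<forall>P' \<in> Bpoly m n. P \<noteq> P' \<longrightarrow> P - P' \<notin> QI m n)
    \<and> (\<forall>P \<in> (Bpoly m n :: 'a mpoly set). \<forall>\<sigma>. unitri n \<sigma> \<longrightarrow> act \<sigma> P - P \<in> QI m n)
    \<and> (\<forall>F (c :: 'a mpoly \<Rightarrow> 'a). finite F \<and> F \<subseteq> Bpoly m n \<and>
          (\<Sum>P\<in>F. mconst (c P) * P) \<in> QI m n \<longrightarrow> (\<forall>P\<in>F. c P = 0))
    \<and> (\<forall>f :: 'a mpoly. mvars f \<subseteq> {1..n} \<and> (\<forall>\<sigma>. unitri n \<sigma> \<longrightarrow> act \<sigma> f - f \<in> QI m n)
          \<longrightarrow> (\<exists>F c. finite F \<and> F \<subseteq> Bpoly m n \<and>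
                 f - (\<Sum>P\<in>F. mconst (c P) * P) \<in> QI m n))"
proof -
  interpret prime_field "TYPE('a)" p
    by unfold_locales (use assms in auto)
  let ?y = "ypoly m (Suc 0) :: _ \<Rightarrow> 'a mpoly" and ?I = "idx m n"
  have B: "Bpoly m n = ?y ` ?I"
    by (simp add: Bpoly_eq)
  have fin: "finite ?I"
    using assms(3) by (rule finite_idx)
  have QI: "P \<in> QI m n \<longleftrightarrow> mvars P \<subseteq> {1..n} \<and> P \<in> pow_ideal (p ^ m)" for P :: "'a mpoly"
    by (simp add: QI_iff assms(2))
  have mv: "mvars (?y l) \<subseteq> {1..n}" if "l \<in> ?I" for l
    using mvars_ypoly_idx[OF that] by simp
  have distinct: "l = l'" if ll: "l \<in> ?I" "l' \<in> ?I" "?y l - ?y l' \<in> pow_ideal (p ^ m)" for l l'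
  proof (rule ccontr)
    assume ne: "l \<noteq> l'"
    \<comment> \<open>Two elements with the same residue give a relation with coefficients 1 and -1.
      This also shows that distinct index lists give distinct polynomials.\<close>
    define c where "c k = (if k = l then 1 else if k = l' then - 1 else 0 :: 'a)" for k
    have "(\<Sum>k\<in>?I. mconst (c k) * ?y k) = (\<Sum>k\<in>{l, l'}. mconst (c k) * ?y k)"
      using fin ll by (intro sum.mono_neutral_right) (auto simp: c_def)
    also have "\<dots> = ?y l - ?y l'"
      using ne by (simp add: c_def mconst_uminus)
    finally have "(\<Sum>k\<in>?I. mconst (c k) * ?y k) \<in> pow_ideal (p ^ m)"
      using ll(3) by (simp only:)
    then have "c l = 0"
      using ll(1) by (rule ypoly_independent[OF assms(3)])
    then show False
      by (simp add: c_def)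
  qed
  have inj: "inj_on ?y ?I"
    using distinct by (auto intro!: inj_onI)
  show ?thesis
  proof (intro conjI ballI allI impI)
    show "\<exists>P. mvars P \<subseteq> {1..n} \<and> Yv = Fract P 1" if "Yv \<in> Bset m n" for Yv :: "'a ratfun"
      using that mv by (auto simp: Bset_eq)
    show "P - P' \<notin> QI m n" if "P \<in> Bpoly m n" "P' \<in> Bpoly m n" "P \<noteq> P'" for P P' :: "'a mpoly"
      using that distinct unfolding B QI by blast
    show "act \<sigma> P - P \<in> QI m n" if P: "P \<in> Bpoly m n" "unitri n \<sigma>" for P :: "'a mpoly" and \<sigma>
    proof -
      obtain l where l: "l \<in> ?I" "P = ?y l"
        using P(1) by (auto simp: B)
      let ?d = "\<lambda>i j. \<sigma> $$ (i - 1, j - 1)"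
      have "subst (ut n ?d) P - P \<in> pow_ideal (p ^ m)"
        using fixes_mod_ypoly[of m l n ?d] by (simp add: fixes_mod_def l(2))
      moreover have "mvars (subst (ut n ?d) P - P) \<subseteq> {1..n}"
        using mvars_diff[of "subst (ut n ?d) P" P] mvars_subst_ut[OF mv[OF l(1)], of ?d] mv[OF l(1)]
        unfolding l(2) by blast
      ultimately show ?thesis
        unfolding act_eq_subst_ut[OF P(2)] QI by blast
    qed
    show "c P = 0" if *: "finite F \<and> F \<subseteq> Bpoly m n \<and> (\<Sum>P\<in>F. mconst (c P) * P) \<in> QI m n" and P: "P \<in> F"
      for F and c :: "'a mpoly \<Rightarrow> 'a" and P
    proof -
      \<comment> \<open>The coefficients on \<open>F\<close>, extended by 0 to the whole
        basis.\<close>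
      let ?c = "\<lambda>l. if ?y l \<in> F then c (?y l) else 0"
      have "(\<Sum>l\<in>?I. mconst (?c l) * ?y l) = (\<Sum>R\<in>?y ` ?I. mconst (if R \<in> F then c R else 0) * R)"
        by (simp add: sum.reindex[OF inj])
      also have "\<dots> = (\<Sum>R\<in>F. mconst (c R) * R)"
        using * fin unfolding B by (intro sum.mono_neutral_cong_right) auto
      finally have "(\<Sum>l\<in>?I. mconst (?c l) * ?y l) \<in> pow_ideal (p ^ m)"
        using * by (simp add: QI)
      moreover have "P \<in> ?y ` ?I"
        using * P unfolding B by blast
      then obtain l where l: "l \<in> ?I" "P = ?y l"
        by blast
      ultimately have "?c l = 0"
        by (intro ypoly_independent[OF assms(3)])
      then show ?thesis
        using l P by simp
    qed
    show "\<exists>F c. finite F \<and> F \<subseteq> Bpoly m n \<and> f - (\<Sum>P\<in>F. mconst (c P) * P) \<in> QI m n"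
      if f: "mvars f \<subseteq> {1..n} \<and> (\<forall>\<sigma>. unitri n \<sigma> \<longrightarrow> act \<sigma> f - f \<in> QI m n)" for f :: "'a mpoly"
    proof -
      have "fixes_mod m f (ut n d)" for d
      proof -
        obtain \<sigma> :: "'a mat" where "unitri n \<sigma>" "\<And>f. act \<sigma> f = subst (ut n d) f"
          using ut_is_act[of n d] by blast
        then show ?thesis
          using f unfolding fixes_mod_def QI by metis
      qed
      then have "span_mod m n f"
        using f assms(3) by (intro ypoly_span) auto
      then obtain c where c: "f - (\<Sum>l\<in>?I. mconst (c l) * ?y l) \<in> pow_ideal (p ^ m)"
        by (auto simp: span_mod_def)
      \<comment> \<open>The statement indexes coefficients by polynomials; injectivity lets each
        polynomial recover its index list.\<close>
      let ?c = "\<lambda>P. c (inv_into ?I ?y P)"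
      have sum: "(\<Sum>P\<in>?y ` ?I. mconst (?c P) * P) = (\<Sum>l\<in>?I. mconst (c l) * ?y l)"
        unfolding sum.reindex[OF inj] o_def by (intro sum.cong refl) (simp only: inv_into_f_f[OF inj])
      have "mvars (mconst (c l) * ?y l) \<subseteq> {1..n}" if "l \<in> ?I" for l
        using mvars_mult[of "mconst (c l)" "?y l"] mv[OF that] by auto
      then have "mvars (\<Sum>l\<in>?I. mconst (c l) * ?y l) \<subseteq> {1..n}"
        by (intro order.trans[OF mvars_sum] UN_least)
      then have "mvars (f - (\<Sum>l\<in>?I. mconst (c l) * ?y l)) \<subseteq> {1..n}"
        using f by (intro order.trans[OF mvars_diff]) auto
      then have "f - (\<Sum>P\<in>?y ` ?I. mconst (?c P) * P) \<in> QI m n"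
        unfolding sum QI using c by blast
      then show ?thesis
        unfolding B using fin by (intro exI[of _ "?y ` ?I"] exI[of _ ?c] conjI finite_imageI subset_refl)
    qed
  qed
qed

end
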